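(* Let $G$ be a finite connected simple graph. Then the following conditions are equivalent: (i) $I_{A_G}=\langle C_{A_G}^{\mathrm{sf}}\rangle$; (ii) any circuit in $C_{A_G}\setminus C_{A_G}^{\mathrm{sf}}$ is redundant; (iii) any circuit in $C_{A_G}\setminus C_{A_G}^{\mathrm{sf}}$ is not indispensable; (iv) any circuit in $C_{A_G}\setminus C_{A_G}^{\mathrm{sf}}$ is not fundamental; (v) there exists no induced subgraph of $G$ consisting of two odd cycles $C_1,C_2$ having no common vertex and a path of length $\ge2$ which connects a vertex of $C_1$ and a vertex of $C_2$ (the path meeting $C_1$ and $C_2$ only in its two end vertices). In particular, if $G$ satisfies the odd cycle condition, then $G$ satisfies (v).
   Context: Let $G$ have vertex set $[d]=\{1,\dots,d\}$ and edge set $E(G)=\{e_1,\dots,e_n\}$. For an edge $e=\{i,j\}$ put $\rho(e)=\mathbf{e}_i+\mathbf{e}_j\in\mathbb{R}^d$, where $\mathbf{e}_1,\dots,\mathbf{e}_d$ are the unit coordinate vectors. $A_G\in\mathbb{Z}^{d\times n}$ is the matrix with columns $\rho(e_1),\dots,\rho(e_n)$ (the vertex-edge incidence matrix). Cycles have length at least 3 and do not repeat vertices; paths do not repeat vertices; the length is the number of edges. The odd cycle condition: for any two odd cycles $C_1$ and $C_2$ of $G$ without common vertex, there exists an edge of $G$ joining a vertex of $C_1$ with a vertex of $C_2$. Let $K$ be a field. For an integer matrix $A\in\mathbb{Z}^{d\times n}$ with columns $\mathbf{a}_1,\dots,\mathbf{a}_n$, the toric ideal $I_A$ is the kernel of the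 $K$-algebra map $\pi:K[x_1,\dots,x_n]\to K[t_1^{\pm1},\dots,t_d^{\pm1}]$, $x_j\mapsto T^{\mathbf{a}_j}=t_1^{a_{1j}}\cdots t_d^{a_{dj}}$. A binomial is a difference $u-v$ of two distinct monomials. The support of a monomial $u$ is $\mathrm{supp}(u)=\{x_i : x_i \mid u\}$, and $\mathrm{supp}(u-v)=\mathrm{supp}(u)\cup\mathrm{supp}(v)$. An irreducible binomial $f\in I_A$ is a circuit of $I_A$ if there is no binomial $g\in I_A$ with $\mathrm{supp}(g)\subsetneq\mathrm{supp}(f)$. $C_A$ is the set of circuits of $I_A$, and $C_A^{\mathrm{sf}}$ is the set of circuits $u-v\in C_A$ such that at least one of $u,v$ is squarefree. For a binomial $f=u-v\in I_A$, let $T_f$ be the set of variables $t_i$ dividing $\pi(u)=\pi(v)$, let $K[T_f]=K[\{t_i : t_i\in T_f\}]$, and let $A_f$ be the matrix whose columns are those $\mathbf{a}_i$ with $T^{\mathbf{a}_i}\in K[T_f]$; its toric ideal is identified with $I_{A_f}=I_A\cap K[\{x_i : \pi(x_i)\in K[T_f]\}]$. The binomial $f$ is fundamental if $I_{A_f}$ is generated by $f$. It is indispensable if for every system $F$ of binomial generators of $I_A$, either $f\in F$ or $-f\in F$. It is not redundant if it belongs to some minimal (with respect to inclusion) system of binomial generators of $I_A$, and redundant otherwise. *)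

theory Defs
  imports
    "HOL-Library.Poly_Mapping"
    "HOL-Algebra.Ideal"
    "HOL-Algebra.Ring_Divisibility"
begin

section \<open>Polynomial rings\<close>

text \<open>
  A monomial in variables \<open>x\<^sub>j\<close> is its finitely supported exponent vector \<open>j \<mapsto> u\<^sub>j\<close>; a polynomial is a
  finitely supported map from monomials to coefficients, and multiplication is the convolution
  product of \<open>Poly_Mapping\<close>.  Laurent polynomials are the same with integer exponents.
\<close>

type_synonym 'j monomial = "'j \<Rightarrow>\<^sub>0 nat"
type_synonym ('j, 'k) polynomial = "'j monomial \<Rightarrow>\<^sub>0 'k"
type_synonym ('i, 'k) laurent = "('i \<Rightarrow>\<^sub>0 int) \<Rightarrow>\<^sub>0 'k"

definition supp :: "('j, 'k::zero) polynomial \<Rightarrow> 'j set" where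
  "supp f = (\<Union>m\<in>Poly_Mapping.keys f. Poly_Mapping.keys m)"

definition poly_ring :: "'j set \<Rightarrow> ('j, 'k::comm_ring_1) polynomial ring" where
  "poly_ring J =
     \<lparr>carrier = {f. supp f \<subseteq> J}, monoid.mult = (*), one = 1, ring.zero = 0, add = (+)\<rparr>"

lemma supp_mult_subset: "supp (f * g) \<subseteq> supp f \<union> supp (g :: ('j, 'k::comm_ring_1) polynomial)"
proof
  fix j assume "j \<in> supp (f * g)"
  then obtain m where m: "m \<in> Poly_Mapping.keys (f * g)" "j \<in> Poly_Mapping.keys m"
    by (auto simp: supp_def)
  then obtain a b where "m = a + b" "a \<in> Poly_Mapping.keys f" "b \<in> Poly_Mapping.keys g"
    using keys_mult[of f g] by blast
  with m(2) show "j \<in> supp f \<union> supp g"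
    using Poly_Mapping.keys_add[of a b] by (auto simp: supp_def)
qed

lemma supp_add_subset: "supp (f + g) \<subseteq> supp f \<union> supp (g :: ('j, 'k::comm_ring_1) polynomial)"
  using Poly_Mapping.keys_add[of f g] by (auto simp: supp_def)

lemma supp_uminus: "supp (- f) = supp (f :: ('j, 'k::comm_ring_1) polynomial)"
  by (simp add: supp_def)

lemma supp_zero: "supp 0 = {}"
  by (simp add: supp_def)

lemma supp_one: "supp (1 :: ('j, 'k::comm_ring_1) polynomial) = {}"
  by (simp add: supp_def)

lemma cring_poly_ring: "cring (poly_ring J :: ('j, 'k::comm_ring_1) polynomial ring)"
proof (rule cringI)
  show "abelian_group (poly_ring J :: ('j, 'k) polynomial ring)"
  proof (rule abelian_groupI)
    fix f :: "('j, 'k) polynomial" assume "f \<in> carrier (poly_ring J)"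
    then show "\<exists>g\<in>carrier (poly_ring J). g \<oplus>\<^bsub>poly_ring J\<^esub> f = \<zero>\<^bsub>poly_ring J\<^esub>"
      by (intro bexI[of _ "- f"]) (auto simp: poly_ring_def supp_uminus)
  qed (auto dest!: subsetD[OF supp_add_subset] simp: poly_ring_def supp_zero add.assoc add.commute)
  show "Group.comm_monoid (poly_ring J :: ('j, 'k) polynomial ring)"
    by (rule comm_monoidI)
      (auto dest!: subsetD[OF supp_mult_subset] simp: poly_ring_def supp_one mult.assoc mult.commute)
qed (simp add: poly_ring_def distrib_right)

section \<open>Toric ideals\<close>

text \<open>
  An integer matrix is given by the finite set \<open>J\<close> of its column indices and its columns
  \<open>a j\<close>, which are integer vectors indexed by the rows.
\<close>

definition toric_map :: "('j \<Rightarrow> 'i \<Rightarrow>\<^sub>0 int) \<Rightarrow> ('j, 'k::comm_ring_1) polynomial \<Rightarrow> ('i, 'k) laurent" where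
  "toric_map a f =
     (\<Sum>m\<in>Poly_Mapping.keys f. Poly_Mapping.single 0 (Poly_Mapping.lookup f m) *
        (\<Prod>j\<in>Poly_Mapping.keys m. Poly_Mapping.single (a j) 1 ^ Poly_Mapping.lookup m j))"

definition toric_ideal :: "'j set \<Rightarrow> ('j \<Rightarrow> 'i \<Rightarrow>\<^sub>0 int) \<Rightarrow> ('j, 'k::comm_ring_1) polynomial set" where
  "toric_ideal J a = {f \<in> carrier (poly_ring J). toric_map a f = 0}"

definition is_difference :: "('j, 'k::comm_ring_1) polynomial \<Rightarrow> 'j monomial \<Rightarrow> 'j monomial \<Rightarrow> bool" where
  "is_difference f u v \<longleftrightarrow> u \<noteq> v \<and> f = Poly_Mapping.single u 1 - Poly_Mapping.single v 1"

definition is_binomial :: "('j, 'k::comm_ring_1) polynomial \<Rightarrow> bool" where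
  "is_binomial f \<longleftrightarrow> (\<exists>u v. is_difference f u v)"

definition squarefree_monomial :: "'j monomial \<Rightarrow> bool" where
  "squarefree_monomial u \<longleftrightarrow> (\<forall>j. Poly_Mapping.lookup u j \<le> 1)"

definition circuits :: "'j set \<Rightarrow> ('j \<Rightarrow> 'i \<Rightarrow>\<^sub>0 int) \<Rightarrow> ('j, 'k::comm_ring_1) polynomial set" where
  "circuits J a =
     {f \<in> toric_ideal J a. is_binomial f \<and> ring_irreducible\<^bsub>poly_ring J\<^esub> f \<and>
        \<not> (\<exists>g \<in> (toric_ideal J a :: ('j, 'k) polynomial set). is_binomial g \<and> supp g \<subset> supp f)}"

definition sf_circuits :: "'j set \<Rightarrow> ('j \<Rightarrow> 'i \<Rightarrow>\<^sub>0 int) \<Rightarrow> ('j, 'k::comm_ring_1) polynomial set" where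
  "sf_circuits J a =
     {f \<in> circuits J a.
        \<exists>u v. is_difference f u v \<and> (squarefree_monomial u \<or> squarefree_monomial v)}"

text \<open>
  For a binomial \<open>f = u - v\<close> the set \<open>Poly_Mapping.keys f\<close> is \<open>{u, v}\<close>, so that the following is
  the set of \<open>t\<^sub>i\<close> which occur in \<open>\<pi>(u)\<close> or \<open>\<pi>(v)\<close>; for \<open>f\<close> in the toric ideal these coincide.
\<close>

definition torus_vars :: "('j \<Rightarrow> 'i \<Rightarrow>\<^sub>0 int) \<Rightarrow> ('j, 'k::comm_ring_1) polynomial \<Rightarrow> 'i set" where
  "torus_vars a f =
     {i. \<exists>m\<in>Poly_Mapping.keys f.
           \<exists>w\<in>Poly_Mapping.keys (toric_map a (Poly_Mapping.single m (1::'k))).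
             Poly_Mapping.lookup w i > 0}"

definition poly_in_laurent :: "'i set \<Rightarrow> ('i, 'k::comm_ring_1) laurent set" where
  "poly_in_laurent T =
     {q. \<forall>w\<in>Poly_Mapping.keys q. Poly_Mapping.keys w \<subseteq> T \<and> (\<forall>i. Poly_Mapping.lookup w i \<ge> 0)}"

definition torus_columns :: "'j set \<Rightarrow> ('j \<Rightarrow> 'i \<Rightarrow>\<^sub>0 int) \<Rightarrow> ('j, 'k::comm_ring_1) polynomial \<Rightarrow> 'j set" where
  "torus_columns J a f =
     {j \<in> J. Poly_Mapping.single (a j) (1::'k) \<in> poly_in_laurent (torus_vars a f)}"

definition fundamental :: "'j set \<Rightarrow> ('j \<Rightarrow> 'i \<Rightarrow>\<^sub>0 int) \<Rightarrow> ('j, 'k::comm_ring_1) polynomial \<Rightarrow> bool" where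
  "fundamental J a f \<longleftrightarrow>
     f \<in> carrier (poly_ring (torus_columns J a f)) \<and>
     toric_ideal (torus_columns J a f) a = Idl\<^bsub>poly_ring (torus_columns J a f)\<^esub> {f}"

definition binomial_generators ::
    "'j set \<Rightarrow> ('j \<Rightarrow> 'i \<Rightarrow>\<^sub>0 int) \<Rightarrow> ('j, 'k::comm_ring_1) polynomial set \<Rightarrow> bool" where
  "binomial_generators J a F \<longleftrightarrow>
     F \<subseteq> carrier (poly_ring J) \<and> (\<forall>f\<in>F. is_binomial f) \<and> Idl\<^bsub>poly_ring J\<^esub> F = toric_ideal J a"

definition indispensable :: "'j set \<Rightarrow> ('j \<Rightarrow> 'i \<Rightarrow>\<^sub>0 int) \<Rightarrow> ('j, 'k::comm_ring_1) polynomial \<Rightarrow> bool" where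
  "indispensable J a f \<longleftrightarrow> (\<forall>F. binomial_generators J a F \<longrightarrow> f \<in> F \<or> - f \<in> F)"

definition redundant :: "'j set \<Rightarrow> ('j \<Rightarrow> 'i \<Rightarrow>\<^sub>0 int) \<Rightarrow> ('j, 'k::comm_ring_1) polynomial \<Rightarrow> bool" where
  "redundant J a f \<longleftrightarrow>
     \<not> (\<exists>F. binomial_generators J a F \<and> (\<forall>F'. F' \<subset> F \<longrightarrow> \<not> binomial_generators J a F') \<and> f \<in> F)"

section \<open>Graphs\<close>

definition finite_simple_graph :: "'v set \<Rightarrow> 'v set set \<Rightarrow> bool" where
  "finite_simple_graph V E \<longleftrightarrow> finite V \<and> (\<forall>e\<in>E. e \<subseteq> V \<and> card e = 2)"

text \<open>Paths and cycles are given by the list of their vertices.\<close>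

definition path_edges :: "'v list \<Rightarrow> 'v set set" where
  "path_edges p = {{p ! i, p ! Suc i} |i. Suc i < length p}"

definition is_path :: "'v set \<Rightarrow> 'v set set \<Rightarrow> 'v list \<Rightarrow> bool" where
  "is_path V E p \<longleftrightarrow> p \<noteq> [] \<and> distinct p \<and> set p \<subseteq> V \<and> path_edges p \<subseteq> E"

definition cycle_edges :: "'v list \<Rightarrow> 'v set set" where
  "cycle_edges c = {{c ! i, c ! (Suc i mod length c)} |i. i < length c}"

definition is_cycle :: "'v set \<Rightarrow> 'v set set \<Rightarrow> 'v list \<Rightarrow> bool" where
  "is_cycle V E c \<longleftrightarrow> 3 \<le> length c \<and> distinct c \<and> set c \<subseteq> V \<and> cycle_edges c \<subseteq> E"

definition odd_cycle :: "'v set \<Rightarrow> 'v set set \<Rightarrow> 'v list \<Rightarrow> bool" where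
  "odd_cycle V E c \<longleftrightarrow> is_cycle V E c \<and> odd (length c)"

definition connected_graph :: "'v set \<Rightarrow> 'v set set \<Rightarrow> bool" where
  "connected_graph V E \<longleftrightarrow>
     V \<noteq> {} \<and> (\<forall>u\<in>V. \<forall>v\<in>V. \<exists>p. is_path V E p \<and> hd p = u \<and> last p = v)"

definition induced_edges :: "'v set set \<Rightarrow> 'v set \<Rightarrow> 'v set set" where
  "induced_edges E W = {e \<in> E. e \<subseteq> W}"

text \<open>A path with at least 3 vertices has length at least 2.\<close>

definition induced_cycles_joined_by_path ::
    "'v set \<Rightarrow> 'v set set \<Rightarrow> 'v list \<Rightarrow> 'v list \<Rightarrow> 'v list \<Rightarrow> bool" where
  "induced_cycles_joined_by_path V E c\<^sub>1 c\<^sub>2 p \<longleftrightarrow>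
     odd_cycle V E c\<^sub>1 \<and> odd_cycle V E c\<^sub>2 \<and> set c\<^sub>1 \<inter> set c\<^sub>2 = {} \<and>
     is_path V E p \<and> 3 \<le> length p \<and> set p \<inter> set c\<^sub>1 = {hd p} \<and> set p \<inter> set c\<^sub>2 = {last p} \<and>
     induced_edges E (set c\<^sub>1 \<union> set c\<^sub>2 \<union> set p) = cycle_edges c\<^sub>1 \<union> cycle_edges c\<^sub>2 \<union> path_edges p"

definition odd_cycle_condition :: "'v set \<Rightarrow> 'v set set \<Rightarrow> bool" where
  "odd_cycle_condition V E \<longleftrightarrow>
     (\<forall>c\<^sub>1 c\<^sub>2. odd_cycle V E c\<^sub>1 \<and> odd_cycle V E c\<^sub>2 \<and> set c\<^sub>1 \<inter> set c\<^sub>2 = {} \<longrightarrow>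
        (\<exists>v\<in>set c\<^sub>1. \<exists>w\<in>set c\<^sub>2. {v, w} \<in> E))"

text \<open>
  The columns of the vertex-edge incidence matrix: for \<open>e = {i, j}\<close> the sum of the \<open>i\<close>-th and
  the \<open>j\<close>-th unit coordinate vector.  Columns, and hence the variables \<open>x\<^sub>e\<close>, are
  indexed by the edges themselves.
\<close>

definition rho :: "'v set \<Rightarrow> 'v \<Rightarrow>\<^sub>0 int" where
  "rho e = (\<Sum>i\<in>e. Poly_Mapping.single i 1)"

end

theory Submission
  imports Defs
begin

text \<open>
  Two monomials of the same fibre that share a variable differ by a consequence of binomials of
  lower degree, so a binomial \<open>u - v\<close> matters for generation only if \<open>u\<close> and \<open>v\<close> are not
  connected through such monomials.  In that case \<open>u\<close> and \<open>v\<close> are the alternate edges of a closed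
  walk that is rigid: returns of even length, chords of odd length, and edges between the two odd
  halves at a repeated vertex would each connect \<open>u\<close> with \<open>v\<close>.  A rigid walk with a repeated
  vertex splits off an odd closed walk at each of two vertices \<open>x\<close> and \<open>y\<close>.  Unless \<open>x\<close> and \<open>y\<close> are
  equal or adjacent, induced lollipops in these two walks and an induced path between \<open>x\<close> and
  \<open>y\<close> form the induced subgraph excluded in (v); otherwise the walk is a circuit with a squarefree
  side.  Conversely, the circuit of a subgraph as in (v) is not squarefree, and it generates the
  toric ideal of its vertex set because the incidence relations of that subgraph have a
  one-dimensional solution space.
\<close>

section \<open>Ideals of polynomial rings\<close>

text \<open>For a pair that is not linked in its fibre, (v) gives more than generation:
  \<open>binom u v\<close> is itself a circuit with a squarefree side. The circle is closed by (i)
  to (iii), (ii) to (iii), (iii) to (iv) and (iv) to (v). Passing from (ii) to (iii) requires an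
  inclusion-minimal generating set. A finite one exists because unlinked monomials have degree at
  most the number of vertices: on a rigid walk the vertices in even positions are distinct.
  Everything rests on the grading by \<open>lexp\<close>: incidence columns are nonnegative with sum
  2, so equal images force equal degrees and only the trivial monomial has weight zero.\<close>

lemma poly_ring_simps [simp]:
  "carrier (poly_ring J) = {f. supp f \<subseteq> J}"
  "f \<otimes>\<^bsub>poly_ring J\<^esub> g = f * g" "f \<oplus>\<^bsub>poly_ring J\<^esub> g = f + g"
  "\<zero>\<^bsub>poly_ring J\<^esub> = 0" "\<one>\<^bsub>poly_ring J\<^esub> = 1"
  by (simp_all add: poly_ring_def)

lemma poly_mapping_decompose:
  fixes f :: "'a \<Rightarrow>\<^sub>0 'b::comm_monoid_add"
  shows "f = (\<Sum>m\<in>Poly_Mapping.keys f. Poly_Mapping.single m (Poly_Mapping.lookup f m))"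
  by (rule poly_mapping_eqI) (auto simp: lookup_sum lookup_single when_def in_keys_iff)

lemma supp_single [simp]:
  "supp (Poly_Mapping.single m (c::'k::zero)) = (if c = 0 then {} else Poly_Mapping.keys m)"
  by (simp add: supp_def)

lemma supp_subset_iff: "supp f \<subseteq> J \<longleftrightarrow> (\<forall>m\<in>Poly_Mapping.keys f. Poly_Mapping.keys m \<subseteq> J)"
  by (auto simp: supp_def)

text \<open>A multiplier is a finite sum of terms, so it suffices to control multiplication by a
  single term.\<close>

lemma poly_mult_closedI:
  fixes H :: "('j, 'k::comm_ring_1) polynomial set"
  assumes "0 \<in> H" and "\<And>f g. f \<in> H \<Longrightarrow> g \<in> H \<Longrightarrow> f + g \<in> H"
    and mon: "\<And>m c f. Poly_Mapping.keys m \<subseteq> J \<Longrightarrow> f \<in> H \<Longrightarrow> Poly_Mapping.single m c * f \<in> H"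
    and "supp k \<subseteq> J" "h \<in> H"
  shows "k * h \<in> H"
proof -
  have "(\<Sum>m\<in>M. Poly_Mapping.single m (Poly_Mapping.lookup k m) * h) \<in> H"
    if "finite M" "M \<subseteq> Poly_Mapping.keys k" for M
    using that
  proof (induction M rule: finite_induct)
    case (insert m M)
    then have "Poly_Mapping.single m (Poly_Mapping.lookup k m) * h \<in> H"
      using assms(4,5) by (intro mon) (auto simp: supp_subset_iff)
    with insert show ?case using assms(2) by simp
  qed (use assms(1) in simp)
  then have "(\<Sum>m\<in>Poly_Mapping.keys k. Poly_Mapping.single m (Poly_Mapping.lookup k m)) * h \<in> H"
    by (simp add: sum_distrib_right)
  then show ?thesis by (simp flip: poly_mapping_decompose)
qed

lemma poly_idealI:
  fixes H :: "('j, 'k::comm_ring_1) polynomial set"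
  assumes "\<And>f. f \<in> H \<Longrightarrow> supp f \<subseteq> J" "0 \<in> H" "\<And>f g. f \<in> H \<Longrightarrow> g \<in> H \<Longrightarrow> f + g \<in> H"
    and mult: "\<And>k f. supp k \<subseteq> J \<Longrightarrow> f \<in> H \<Longrightarrow> k * f \<in> H"
  shows "ideal H (poly_ring J)"
proof -
  interpret cring "poly_ring J :: ('j, 'k) polynomial ring" by (rule cring_poly_ring)
  show ?thesis
  proof (rule idealI)
    show "subgroup H (add_monoid (poly_ring J))"
    proof (rule add.subgroupI)
      fix f assume f: "f \<in> H"
      have "- f = \<ominus>\<^bsub>poly_ring J\<^esub> f"
        using assms(1)[OF f] by (intro minus_equality[symmetric]) (auto simp: supp_uminus)
      moreover have "- f \<in> H" using mult[of "-1" f] f by (simp add: supp_uminus supp_one)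
      ultimately show "\<ominus>\<^bsub>poly_ring J\<^esub> f \<in> H" by simp
    qed (use assms in auto)
    fix a x :: "('j, 'k) polynomial" assume "a \<in> H" "x \<in> carrier (poly_ring J)"
    then show "x \<otimes>\<^bsub>poly_ring J\<^esub> a \<in> H" and "a \<otimes>\<^bsub>poly_ring J\<^esub> x \<in> H"
      using mult[of x a] by (simp_all add: mult.commute)
  qed (rule ring_axioms)
qed

text \<open>Meant for sets \<open>H\<close> that are given by conditions on coefficients, where
  multiplication by one term is easy to follow.\<close>

lemma Idl_subsetI:
  fixes H :: "('j, 'k::comm_ring_1) polynomial set"
  assumes "S \<subseteq> H" and "\<And>f. f \<in> H \<Longrightarrow> supp f \<subseteq> J" "0 \<in> H" "\<And>f g. f \<in> H \<Longrightarrow> g \<in> H \<Longrightarrow> f + g \<in> H"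
    and "\<And>m c f. Poly_Mapping.keys m \<subseteq> J \<Longrightarrow> f \<in> H \<Longrightarrow> Poly_Mapping.single m c * f \<in> H"
  shows "Idl\<^bsub>poly_ring J\<^esub> S \<subseteq> H"
proof -
  interpret cring "poly_ring J :: ('j, 'k) polynomial ring" by (rule cring_poly_ring)
  show ?thesis
  proof (rule genideal_minimal[OF poly_idealI assms(1)])
    show "k * f \<in> H" if "supp k \<subseteq> J" "f \<in> H" for k f
      by (rule poly_mult_closedI[OF assms(3,4,5) that])
  qed (use assms in blast)+
qed

context
  fixes J :: "'j set" and S :: "('j, 'k::comm_ring_1) polynomial set"
  assumes S: "S \<subseteq> carrier (poly_ring J)"
begin

interpretation R: cring "poly_ring J :: ('j, 'k) polynomial ring" by (rule cring_poly_ring)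

lemma Idl_ideal: "ideal (Idl\<^bsub>poly_ring J\<^esub> S) (poly_ring J)"
  by (rule R.genideal_ideal[OF S])

lemma Idl_superset: "S \<subseteq> Idl\<^bsub>poly_ring J\<^esub> S"
  by (rule R.genideal_self[OF S])

lemma Idl_least: "ideal H (poly_ring J) \<Longrightarrow> S \<subseteq> H \<Longrightarrow> Idl\<^bsub>poly_ring J\<^esub> S \<subseteq> H"
  by (rule R.genideal_minimal)

end

lemma poly_idealD:
  fixes H :: "('j, 'k::comm_ring_1) polynomial set"
  assumes "ideal H (poly_ring J)"
  shows "f \<in> H \<Longrightarrow> supp f \<subseteq> J" "0 \<in> H" "f \<in> H \<Longrightarrow> g \<in> H \<Longrightarrow> f + g \<in> H"
    "supp k \<subseteq> J \<Longrightarrow> f \<in> H \<Longrightarrow> k * f \<in> H" "f \<in> H \<Longrightarrow> - f \<in> H" "f \<in> H \<Longrightarrow> g \<in> H \<Longrightarrow> f - g \<in> H"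
proof -
  interpret ideal H "poly_ring J" by fact
  show 1: "supp f \<subseteq> J" if "f \<in> H" for f using a_subset that by auto
  show "0 \<in> H" using additive_subgroup.zero_closed[OF is_additive_subgroup] by simp
  show 2: "f + g \<in> H" if "f \<in> H" "g \<in> H" for f g
    using additive_subgroup.a_closed[OF is_additive_subgroup that] by simp
  show 3: "k * f \<in> H" if "supp k \<subseteq> J" "f \<in> H" for k f using I_l_closed[of f k] that by simp
  show 4: "- f \<in> H" if "f \<in> H" for f using 3[of "-1" f] that by (simp add: supp_uminus supp_one)
  show "f - g \<in> H" if "f \<in> H" "g \<in> H" for f g using 2[OF that(1) 4[OF that(2)]] by simp
qed

lemma Idl_singleton:
  fixes f :: "('j, 'k::comm_ring_1) polynomial"
  assumes "supp f \<subseteq> J"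
  shows "Idl\<^bsub>poly_ring J\<^esub> {f} = {k * f |k. supp (k :: ('j, 'k) polynomial) \<subseteq> J}" (is "_ = ?H")
proof
  show "Idl\<^bsub>poly_ring J\<^esub> {f} \<subseteq> ?H"
  proof (rule Idl_least)
    show "ideal ?H (poly_ring J)"
    proof (rule poly_idealI)
      fix g assume "g \<in> ?H"
      then show "supp g \<subseteq> J" using supp_mult_subset[of _ f] assms by blast
    next
      show "0 \<in> ?H" by (intro CollectI exI[of _ 0]) (simp add: supp_zero)
    next
      fix g h assume "g \<in> ?H" "h \<in> ?H"
      then obtain a b where "g = a * f" "h = b * f" "supp a \<subseteq> J" "supp b \<subseteq> J" by blast
      then show "g + h \<in> ?H" using supp_add_subset[of a b]
        by (intro CollectI exI[of _ "a + b"]) (auto simp: distrib_right)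
    next
      fix k g :: "('j, 'k) polynomial" assume "supp k \<subseteq> J" "g \<in> ?H"
      then obtain a where "g = a * f" "supp a \<subseteq> J" by blast
      then show "k * g \<in> ?H" using supp_mult_subset[of k a] \<open>supp k \<subseteq> J\<close>
        by (intro CollectI exI[of _ "k * a"]) (auto simp: mult.assoc)
    qed
    show "{f} \<subseteq> ?H" by (auto intro!: exI[of _ 1] simp: supp_one)
  qed (use assms in simp)
  show "?H \<subseteq> Idl\<^bsub>poly_ring J\<^esub> {f}"
    using poly_idealD(4)[OF Idl_ideal[of "{f}" J]] Idl_superset[of "{f}" J] assms by auto
qed

section \<open>Absence of zero divisors\<close>

text \<open>The exponent types carry no order here, so the leading monomials are taken with respect to
  a linear functional that separates the finitely many exponents involved.\<close>

lemma separating_functional: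
  fixes D :: "('i \<Rightarrow> int) set"
  assumes "finite D"
  shows "\<exists>S c. finite S \<and> (\<forall>d\<in>D. d \<noteq> (\<lambda>_. 0) \<longrightarrow> (\<Sum>i\<in>S. c i * d i) \<noteq> 0)"
  using assms
proof (induction D rule: finite_induct)
  case (insert d D)
  then obtain S c where S: "finite S" "\<And>e. e \<in> D \<Longrightarrow> e \<noteq> (\<lambda>_. 0) \<Longrightarrow> (\<Sum>i\<in>S. c i * e i) \<noteq> 0" by blast
  show ?case
  proof (cases "d = (\<lambda>_. 0) \<or> (\<Sum>i\<in>S. c i * d i) \<noteq> 0")
    case True
    then show ?thesis using S by blast
  next
    case False
    then obtain j where j: "d j \<noteq> 0" by blast
    \<comment> \<open>The new vector \<open>d\<close> is detected by coordinate \<open>j\<close>;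
      scaling the old functional by \<open>M\<close> makes its nonzero values too large to be
      cancelled by that coordinate.\<close>
    define M where "M = 1 + (\<Sum>e\<in>D. \<bar>e j\<bar>)"
    define c' where "c' i = M * (if i \<in> S then c i else 0) + (if i = j then 1 else 0)" for i
    have eq: "(\<Sum>i\<in>insert j S. c' i * e i) = M * (\<Sum>i\<in>S. c i * e i) + e j" for e :: "'i \<Rightarrow> int"
    proof -
      have "(\<Sum>i\<in>insert j S. c' i * e i) =
        (\<Sum>i\<in>insert j S. M * ((if i \<in> S then c i else 0) * e i)) + (\<Sum>i\<in>insert j S. if i = j then e i else 0)"
        by (simp add: c'_def algebra_simps flip: sum.distrib) (rule sum.cong, auto simp: algebra_simps)
      also have "(\<Sum>i\<in>insert j S. if i = j then e i else 0) = e j" using S(1) by simp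
      also have "(\<Sum>i\<in>insert j S. M * ((if i \<in> S then c i else 0) * e i)) = M * (\<Sum>i\<in>S. c i * e i)"
        unfolding sum_distrib_left using S(1) by (intro sum.mono_neutral_cong_right) auto
      finally show ?thesis .
    qed
    have "(\<Sum>i\<in>insert j S. c' i * e i) \<noteq> 0" if "e \<in> insert d D" "e \<noteq> (\<lambda>_. 0)" for e
    proof (cases "e = d")
      case True
      then show ?thesis using False j unfolding eq by simp
    next
      case e: False
      then have "e \<in> D" using that by simp
      then have "\<bar>e j\<bar> < M" using member_le_sum[of e D "\<lambda>e. \<bar>e j\<bar>"] insert.hyps by (simp add: M_def)
      moreover have "M \<le> M * \<bar>\<Sum>i\<in>S. c i * e i\<bar>"
        using S(2)[OF \<open>e \<in> D\<close> that(2)] \<open>\<bar>e j\<bar> < M\<close>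
        by (smt (verit) mult_le_cancel_left1 zero_less_abs_iff)
      ultimately have "\<bar>e j\<bar> < \<bar>M * (\<Sum>i\<in>S. c i * e i)\<bar>" by (simp add: abs_mult)
      then show ?thesis unfolding eq by linarith
    qed
    then show ?thesis using S(1) by (intro exI[of _ "insert j S"] exI[of _ c']) auto
  qed
qed (auto intro: exI[of _ "{}"])

text \<open>Adding \<open>M\<close> times coordinate \<open>j\<close>, with \<open>M\<close> above
  all old values, lets coordinate \<open>j\<close> decide the sign whenever it is nonzero. A leading
  monomial then also has the largest exponent of the variable \<open>j\<close>.\<close>

lemma separating_functional_dominated:
  fixes D :: "('i \<Rightarrow> int) set"
  assumes "finite D"
  shows "\<exists>S c. finite S \<and> (\<forall>d\<in>D. (d \<noteq> (\<lambda>_. 0) \<longrightarrow> (\<Sum>i\<in>S. c i * d i) \<noteq> 0) \<and>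
     (d j > 0 \<longrightarrow> (\<Sum>i\<in>S. c i * d i) > 0))"
proof -
  obtain S c where S: "finite S" "\<And>e. e \<in> D \<Longrightarrow> e \<noteq> (\<lambda>_. 0) \<Longrightarrow> (\<Sum>i\<in>S. c i * e i) \<noteq> 0"
    using separating_functional[OF assms] by blast
  define L where "L e = (\<Sum>i\<in>S. c i * e i)" for e
  define M where "M = 1 + (\<Sum>e\<in>D. \<bar>L e\<bar>)"
  define c' where "c' i = (if i \<in> S then c i else 0) + (if i = j then M else 0)" for i
  have eq: "(\<Sum>i\<in>insert j S. c' i * e i) = L e + M * e j" for e :: "'i \<Rightarrow> int"
  proof -
    have "(\<Sum>i\<in>insert j S. c' i * e i) =
      (\<Sum>i\<in>insert j S. (if i \<in> S then c i else 0) * e i) + (\<Sum>i\<in>insert j S. if i = j then M * e i else 0)"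
      unfolding sum.distrib[symmetric] by (rule sum.cong, auto simp: c'_def algebra_simps)
    also have "(\<Sum>i\<in>insert j S. if i = j then M * e i else 0) = M * e j" using S(1) by simp
    also have "(\<Sum>i\<in>insert j S. (if i \<in> S then c i else 0) * e i) = L e"
      unfolding L_def using S(1) by (intro sum.mono_neutral_cong_right) auto
    finally show ?thesis .
  qed
  have M: "\<bar>L e\<bar> < M" if "e \<in> D" for e
    using that member_le_sum[of e D "\<lambda>e. \<bar>L e\<bar>"] assms by (simp add: M_def)
  have pos: "(\<Sum>i\<in>insert j S. c' i * e i) > 0" if "e \<in> D" "e j > 0" for e
    using M[OF that(1)] that(2) unfolding eq by (smt (verit) mult_le_cancel_left1)
  have neg: "(\<Sum>i\<in>insert j S. c' i * e i) < 0" if "e \<in> D" "e j < 0" for e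
  proof -
    have "M * e j \<le> M * (-1)" using M[OF that(1)] that(2) by (intro mult_left_mono) auto
    then show ?thesis using M[OF that(1)] unfolding eq by simp
  qed
  have "(\<Sum>i\<in>insert j S. c' i * e i) \<noteq> 0" if "e \<in> D" "e \<noteq> (\<lambda>_. 0)" for e
  proof (cases "e j = 0")
    case True
    then show ?thesis unfolding eq using S(2)[OF that] by (simp add: L_def)
  next
    case False
    then show ?thesis using pos[OF that(1)] neg[OF that(1)] by linarith
  qed
  then show ?thesis using S(1) pos by (intro exI[of _ "insert j S"] exI[of _ c']) auto
qed

text \<open>If \<open>a + b = m + n\<close>, maximality in both factors forces \<open>a\<close> and
  \<open>m\<close> to have the same value, so injectivity and cancellation leave only the pair of
  leading monomials. The coefficient at \<open>m + n\<close> is thus a product of two nonzero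
  elements of a domain.\<close>

lemma leading_monomial_mult:
  fixes f g :: "'a::cancel_comm_monoid_add \<Rightarrow>\<^sub>0 'k::idom" and \<phi> :: "'a \<Rightarrow> int"
  assumes "\<And>a b. \<phi> (a + b) = \<phi> a + \<phi> b" "inj_on \<phi> (Poly_Mapping.keys f)" "inj_on \<phi> (Poly_Mapping.keys g)"
    "f \<noteq> 0" "g \<noteq> 0"
  obtains m n where "m \<in> Poly_Mapping.keys f" "n \<in> Poly_Mapping.keys g" "m + n \<in> Poly_Mapping.keys (f * g)"
    "\<And>m'. m' \<in> Poly_Mapping.keys f \<Longrightarrow> \<phi> m' \<le> \<phi> m"
proof -
  have ex: "\<exists>m\<in>Poly_Mapping.keys h. \<forall>m'\<in>Poly_Mapping.keys h. \<phi> m' \<le> \<phi> m" if "h \<noteq> 0" for h :: "'a \<Rightarrow>\<^sub>0 'k"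
  proof -
    have "Max (\<phi> ` Poly_Mapping.keys h) \<in> \<phi> ` Poly_Mapping.keys h"
      using that by (intro Max_in) (auto simp: poly_mapping_eq_iff fun_eq_iff in_keys_iff)
    then obtain m where m: "m \<in> Poly_Mapping.keys h" "\<phi> m = Max (\<phi> ` Poly_Mapping.keys h)" by force
    show ?thesis by (rule bexI[OF _ m(1)]) (auto simp: m(2))
  qed
  obtain m where m: "m \<in> Poly_Mapping.keys f" "\<And>m'. m' \<in> Poly_Mapping.keys f \<Longrightarrow> \<phi> m' \<le> \<phi> m"
    using ex[OF assms(4)] by blast
  obtain n where n: "n \<in> Poly_Mapping.keys g" "\<And>m'. m' \<in> Poly_Mapping.keys g \<Longrightarrow> \<phi> m' \<le> \<phi> n"
    using ex[OF assms(5)] by blast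
  have uniq: "a = m \<and> b = n" if "a \<in> Poly_Mapping.keys f" "b \<in> Poly_Mapping.keys g" "a + b = m + n" for a b
  proof -
    have "\<phi> a + \<phi> b = \<phi> m + \<phi> n" using that assms(1) by metis
    then have "\<phi> a = \<phi> m" using m(2)[OF that(1)] n(2)[OF that(2)] by linarith
    then have "a = m" using assms(2) that(1) m(1) by (auto dest: inj_onD)
    then show ?thesis using that(3) by simp
  qed
  have "f * g = (\<Sum>a\<in>Poly_Mapping.keys f. \<Sum>b\<in>Poly_Mapping.keys g.
      Poly_Mapping.single (a + b) (Poly_Mapping.lookup f a * Poly_Mapping.lookup g b))"
    by (subst poly_mapping_decompose[of f], subst poly_mapping_decompose[of g])
      (simp add: sum_product mult_single)
  then have "Poly_Mapping.lookup (f * g) (m + n) = (\<Sum>a\<in>Poly_Mapping.keys f. \<Sum>b\<in>Poly_Mapping.keys g.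
      if a = m \<and> b = n then Poly_Mapping.lookup f m * Poly_Mapping.lookup g n else 0)"
    by (simp add: lookup_sum lookup_single when_def) (intro sum.cong refl, use uniq in auto)
  also have "\<dots> = (\<Sum>a\<in>Poly_Mapping.keys f. if a = m then Poly_Mapping.lookup f m * Poly_Mapping.lookup g n else 0)"
    using n(1) by (intro sum.cong refl) auto
  also have "\<dots> = Poly_Mapping.lookup f m * Poly_Mapping.lookup g n"
    using m(1) by simp
  finally have "m + n \<in> Poly_Mapping.keys (f * g)"
    using m(1) n(1) by (simp add: in_keys_iff)
  with m n that show ?thesis by blast
qed

text \<open>Separation concerns differences of exponents, which are integral; the embedding
  \<open>h\<close> covers natural and integer exponents at once.\<close>

lemma exponent_functional:
  fixes K :: "('i \<Rightarrow>\<^sub>0 'n::comm_monoid_add) set" and h :: "'n \<Rightarrow> int"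
  assumes "finite K" "inj h" "\<And>a b. h (a + b) = h a + h b"
  obtains \<phi> :: "('i \<Rightarrow>\<^sub>0 'n) \<Rightarrow> int" where "\<And>a b. \<phi> (a + b) = \<phi> a + \<phi> b" "inj_on \<phi> K"
    "\<And>m m'. m \<in> K \<Longrightarrow> m' \<in> K \<Longrightarrow> \<phi> m' \<le> \<phi> m \<Longrightarrow>
       h (Poly_Mapping.lookup m' j) \<le> h (Poly_Mapping.lookup m j)"
proof -
  define D where "D = (\<lambda>(m, m') i. h (Poly_Mapping.lookup m i) - h (Poly_Mapping.lookup m' i)) ` (K \<times> K)"
  obtain S c where S: "\<forall>d\<in>D. (d \<noteq> (\<lambda>_. 0) \<longrightarrow> (\<Sum>i\<in>S. c i * d i) \<noteq> 0) \<and>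
     (d j > 0 \<longrightarrow> (\<Sum>i\<in>S. c i * d i) > 0)"
    using separating_functional_dominated[of D j] assms(1) unfolding D_def by blast
  define \<phi> where "\<phi> m = (\<Sum>i\<in>S. c i * h (Poly_Mapping.lookup m i))" for m
  have d: "(\<Sum>i\<in>S. c i * (h (Poly_Mapping.lookup m i) - h (Poly_Mapping.lookup m' i))) = \<phi> m - \<phi> m'" for m m'
    by (simp add: \<phi>_def algebra_simps sum_subtractf)
  have D: "(\<lambda>i. h (Poly_Mapping.lookup m i) - h (Poly_Mapping.lookup m' i)) \<in> D" if "m \<in> K" "m' \<in> K" for m m'
    using that by (force simp: D_def)
  show ?thesis
  proof (rule that[of \<phi>])
    show "\<phi> (a + b) = \<phi> a + \<phi> b" for a b
      by (simp add: \<phi>_def lookup_add assms(3) distrib_left sum.distrib)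
    show "inj_on \<phi> K"
    proof (rule inj_onI)
      fix m m' assume m: "m \<in> K" "m' \<in> K" "\<phi> m = \<phi> m'"
      have "(\<lambda>i. h (Poly_Mapping.lookup m i) - h (Poly_Mapping.lookup m' i)) = (\<lambda>_. 0)"
        using bspec[OF S D[OF m(1,2)]] d[of m m'] m(3) by auto
      then have "h (Poly_Mapping.lookup m i) = h (Poly_Mapping.lookup m' i)" for i
        by (auto dest: fun_cong[of _ _ i])
      then show "m = m'" using assms(2) by (auto simp: poly_mapping_eq_iff fun_eq_iff dest: injD)
    qed
    show "h (Poly_Mapping.lookup m' j) \<le> h (Poly_Mapping.lookup m j)"
      if "m \<in> K" "m' \<in> K" "\<phi> m' \<le> \<phi> m" for m m'
      using bspec[OF S D[OF that(2,1)]] d[of m' m] that(3) by auto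
  qed
qed

lemma laurent_no_zero_divisors:
  fixes f g :: "('i, 'k::idom) laurent"
  assumes "f * g = 0"
  shows "f = 0 \<or> g = 0"
proof (rule ccontr)
  assume *: "\<not> (f = 0 \<or> g = 0)"
  obtain \<phi> :: "('i \<Rightarrow>\<^sub>0 int) \<Rightarrow> int" where \<phi>: "\<And>a b. \<phi> (a + b) = \<phi> a + \<phi> b"
    "inj_on \<phi> (Poly_Mapping.keys f \<union> Poly_Mapping.keys g)"
    by (rule exponent_functional[of "Poly_Mapping.keys f \<union> Poly_Mapping.keys g" "\<lambda>x. x"])
      (auto simp: inj_def)
  show False
    by (rule leading_monomial_mult[of \<phi> f g]) (use \<phi> * assms in \<open>auto intro: inj_on_subset\<close>)
qed

text \<open>For each variable \<open>j\<close> a functional dominated by \<open>j\<close> is used: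
  the leading monomial of \<open>f\<close> then attains the largest exponent of \<open>j\<close> and
  survives, times a monomial, in the product. Hence no variable can disappear through
  cancellation.\<close>

lemma supp_subset_mult:
  fixes f g :: "('j, 'k::idom) polynomial"
  assumes "f \<noteq> 0" "g \<noteq> 0"
  shows "f * g \<noteq> 0" "supp f \<subseteq> supp (f * g)"
proof -
  have *: "\<exists>m\<in>Poly_Mapping.keys f. \<exists>n. m + n \<in> Poly_Mapping.keys (f * g) \<and>
      (\<forall>m'\<in>Poly_Mapping.keys f. Poly_Mapping.lookup m' j \<le> Poly_Mapping.lookup m j)" for j
  proof -
    obtain \<phi> :: "('j \<Rightarrow>\<^sub>0 nat) \<Rightarrow> int" where \<phi>: "\<And>a b. \<phi> (a + b) = \<phi> a + \<phi> b"
      "inj_on \<phi> (Poly_Mapping.keys f \<union> Poly_Mapping.keys g)"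
      "\<And>m m'. m \<in> Poly_Mapping.keys f \<union> Poly_Mapping.keys g \<Longrightarrow> m' \<in> Poly_Mapping.keys f \<union> Poly_Mapping.keys g \<Longrightarrow>
         \<phi> m' \<le> \<phi> m \<Longrightarrow> int (Poly_Mapping.lookup m' j) \<le> int (Poly_Mapping.lookup m j)"
      by (rule exponent_functional[of "Poly_Mapping.keys f \<union> Poly_Mapping.keys g" int]) (auto simp: inj_def)
    show ?thesis
      by (rule leading_monomial_mult[of \<phi> f g]) (use \<phi> assms in \<open>auto intro: inj_on_subset; blast\<close>)+
  qed
  then show "f * g \<noteq> 0" by fastforce
  show "supp f \<subseteq> supp (f * g)"
  proof
    fix j assume "j \<in> supp f"
    then obtain m' where m': "m' \<in> Poly_Mapping.keys f" "Poly_Mapping.lookup m' j > 0"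
      by (auto simp: supp_def in_keys_iff)
    obtain m n where "m + n \<in> Poly_Mapping.keys (f * g)" "Poly_Mapping.lookup m' j \<le> Poly_Mapping.lookup m j"
      using *[of j] m'(1) by blast
    then show "j \<in> supp (f * g)"
      using m'(2) by (auto simp: supp_def in_keys_iff lookup_add intro!: bexI[of _ "m + n"])
  qed
qed

lemma polynomial_mult_left_cancel:
  fixes f g h :: "('j, 'k::idom) polynomial"
  assumes "f * g = f * h" "f \<noteq> 0"
  shows "g = h"
  using supp_subset_mult(1)[of f "g - h"] assms by (auto simp: right_diff_distrib)

section \<open>Toric ideals\<close>

text \<open>The matrix applied to the exponent vector, which is the exponent of the image Laurent
  monomial. It grades the polynomial ring, and its level sets are the fibres.\<close>

definition lexp :: "('j \<Rightarrow> 'i \<Rightarrow>\<^sub>0 int) \<Rightarrow> 'j monomial \<Rightarrow> 'i \<Rightarrow>\<^sub>0 int" where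
  "lexp a m = (\<Sum>j\<in>Poly_Mapping.keys m. frag_cmul (int (Poly_Mapping.lookup m j)) (a j))"

lemma lexp_superset:
  assumes "finite S" "Poly_Mapping.keys m \<subseteq> S"
  shows "lexp a m = (\<Sum>j\<in>S. frag_cmul (int (Poly_Mapping.lookup m j)) (a j))"
  unfolding lexp_def using assms by (intro sum.mono_neutral_left) (auto simp: in_keys_iff)

lemma single_eq_zero_iff [simp]: "Poly_Mapping.single w c = 0 \<longleftrightarrow> c = 0"
  by (auto simp: poly_mapping_eq_iff fun_eq_iff lookup_single when_def)

lemma single_eq_single_iff: "c \<noteq> 0 \<Longrightarrow> Poly_Mapping.single w c = Poly_Mapping.single w' c \<longleftrightarrow> w = w'"
  by (metis keys_single singleton_inject)

lemma keys_monomial_add: "Poly_Mapping.keys (x + y) = Poly_Mapping.keys x \<union> Poly_Mapping.keys (y :: 'j monomial)"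
  by (auto simp: in_keys_iff lookup_add)

lemma lexp_zero [simp]: "lexp a 0 = 0"
  by (simp add: lexp_def)

lemma lexp_single [simp]: "lexp a (Poly_Mapping.single j n) = frag_cmul (int n) (a j)"
  by (simp add: lexp_def)

lemma lexp_add: "lexp a (m + n) = lexp a m + lexp a n"
proof -
  let ?S = "Poly_Mapping.keys m \<union> Poly_Mapping.keys n"
  have "Poly_Mapping.keys (m + n) \<subseteq> ?S" by (rule Poly_Mapping.keys_add)
  then show ?thesis
    using lexp_superset[of ?S m a] lexp_superset[of ?S n a] lexp_superset[of ?S "m + n" a]
    by (simp add: lookup_add frag_cmul_distrib sum.distrib)
qed

lemma single_one_power:
  "Poly_Mapping.single w (1::'k::comm_ring_1) ^ n = Poly_Mapping.single (frag_cmul (int n) w) 1"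
  by (induction n) (auto simp: mult_single frag_cmul_distrib)

lemma prod_single_one:
  "(\<Prod>j\<in>S. Poly_Mapping.single (w j) (1::'k::comm_ring_1)) = Poly_Mapping.single (\<Sum>j\<in>S. w j) 1"
  by (induction S rule: infinite_finite_induct) (auto simp: mult_single)

lemma toric_map_altdef:
  "toric_map a f = (\<Sum>m\<in>Poly_Mapping.keys f. Poly_Mapping.single (lexp a m) (Poly_Mapping.lookup f m))"
  by (simp add: toric_map_def single_one_power prod_single_one mult_single lexp_def)

lemma toric_map_superset:
  assumes "finite S" "Poly_Mapping.keys f \<subseteq> S"
  shows "toric_map a f = (\<Sum>m\<in>S. Poly_Mapping.single (lexp a m) (Poly_Mapping.lookup f m))"
  unfolding toric_map_altdef using assms by (intro sum.mono_neutral_left) (auto simp: in_keys_iff)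

lemma toric_map_zero [simp]: "toric_map a 0 = 0"
  by (simp add: toric_map_altdef)

lemma toric_map_single [simp]: "toric_map a (Poly_Mapping.single m c) = Poly_Mapping.single (lexp a m) c"
  by (cases "c = 0") (simp_all add: toric_map_altdef)

lemma toric_map_add: "toric_map a (f + g) = toric_map a f + toric_map a g"
proof -
  let ?S = "Poly_Mapping.keys f \<union> Poly_Mapping.keys g"
  have "Poly_Mapping.keys (f + g) \<subseteq> ?S" by (rule Poly_Mapping.keys_add)
  then show ?thesis
    using toric_map_superset[of ?S f a] toric_map_superset[of ?S g a] toric_map_superset[of ?S "f + g" a]
    by (simp add: lookup_add single_add sum.distrib)
qed

lemma toric_map_uminus: "toric_map a (- f) = - toric_map a f"
  using toric_map_add[of a f "- f"] by (simp add: eq_neg_iff_add_eq_0 add.commute)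

lemma toric_map_diff: "toric_map a (f - g) = toric_map a f - toric_map a g"
  using toric_map_add[of a f "- g"] by (simp add: toric_map_uminus)

lemma toric_map_sum: "toric_map a (\<Sum>x\<in>S. f x) = (\<Sum>x\<in>S. toric_map a (f x))"
  by (induction S rule: infinite_finite_induct) (auto simp: toric_map_add)

lemma toric_map_mult: "toric_map a (f * g) = toric_map a f * toric_map a g"
  by (subst poly_mapping_decompose[of f], subst poly_mapping_decompose[of g])
    (simp add: sum_product mult_single toric_map_sum toric_map_altdef[of a f] toric_map_altdef[of a g] lexp_add)

lemma lookup_toric_map:
  "Poly_Mapping.lookup (toric_map a f) w =
     (\<Sum>m\<in>{m \<in> Poly_Mapping.keys f. lexp a m = w}. Poly_Mapping.lookup f m)"
  unfolding toric_map_altdef lookup_sum lookup_single when_def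
  by (rule sum.inter_filter[symmetric]) simp

lemma toric_ideal_iff: "f \<in> toric_ideal J a \<longleftrightarrow> supp f \<subseteq> J \<and> toric_map a f = 0"
  by (simp add: toric_ideal_def)

lemma ideal_toric_ideal: "ideal (toric_ideal J a) (poly_ring J)"
proof (rule poly_idealI)
  show "f + g \<in> toric_ideal J a" if "f \<in> toric_ideal J a" "g \<in> toric_ideal J a" for f g
    using that supp_add_subset[of f g] by (auto simp: toric_ideal_iff toric_map_add)
  show "k * f \<in> toric_ideal J a" if "supp k \<subseteq> J" "f \<in> toric_ideal J a" for k f
    using that supp_mult_subset[of k f] by (auto simp: toric_ideal_iff toric_map_mult)
qed (auto simp: toric_ideal_iff supp_zero)

section \<open>Binomials and circuits of a toric ideal\<close>

abbreviation binom :: "'j monomial \<Rightarrow> 'j monomial \<Rightarrow> ('j, 'k::comm_ring_1) polynomial" where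
  "binom u v \<equiv> Poly_Mapping.single u 1 - Poly_Mapping.single v 1"

lemma keys_binom:
  assumes "u \<noteq> v"
  shows "Poly_Mapping.keys (binom u v :: ('j, 'k::comm_ring_1) polynomial) = {u, v}"
  using assms by (auto simp: in_keys_iff lookup_minus lookup_single when_def split: if_splits)

lemma supp_binom:
  assumes "u \<noteq> v"
  shows "supp (binom u v :: ('j, 'k::comm_ring_1) polynomial) = Poly_Mapping.keys u \<union> Poly_Mapping.keys v"
  by (simp add: supp_def keys_binom assms)

lemma is_binomial_binom: "is_binomial (binom u v :: ('j, 'k::comm_ring_1) polynomial) \<longleftrightarrow> u \<noteq> v"
proof -
  have "Poly_Mapping.single u' 1 \<noteq> (Poly_Mapping.single v' 1 :: ('j, 'k) polynomial)" if "u' \<noteq> v'" for u' v' :: "'j monomial"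
    using that by (simp add: single_eq_single_iff)
  then show ?thesis by (auto simp: is_binomial_def is_difference_def)
qed

lemma is_difference_binom:
  assumes "is_difference (binom u v :: ('j, 'k::comm_ring_1) polynomial) u' v'" "u \<noteq> v"
  shows "{u', v'} = {u, v}"
  using assms keys_binom[OF assms(2), where 'k='k] keys_binom[of u' v', where 'k='k] by (auto simp: is_difference_def)

lemma binom_in_toric_ideal_iff:
  fixes J :: "'j set" and a :: "'j \<Rightarrow> 'i \<Rightarrow>\<^sub>0 int"
  assumes "u \<noteq> v"
  shows "(binom u v :: ('j, 'k::comm_ring_1) polynomial) \<in> toric_ideal J a \<longleftrightarrow>
    Poly_Mapping.keys u \<subseteq> J \<and> Poly_Mapping.keys v \<subseteq> J \<and> lexp a u = lexp a v"
proof -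
  have "toric_map a (binom u v) = (0 :: ('i, 'k) laurent) \<longleftrightarrow> lexp a u = lexp a v"
    by (simp add: toric_map_diff single_eq_single_iff)
  then show ?thesis using assms by (auto simp: toric_ideal_iff supp_binom)
qed

text \<open>The coefficients of \<open>f\<close> sum to zero on every fibre, so a monomial
  \<open>m\<close> of \<open>f\<close> has a partner \<open>n\<close> of \<open>f\<close> in its
  fibre. Subtracting a multiple of \<open>binom m n\<close> removes \<open>m\<close> and brings in
  no new monomial.\<close>

lemma toric_ideal_subset_by_binomials:
  fixes H :: "('j, 'k::comm_ring_1) polynomial set"
  assumes H: "ideal H (poly_ring J)"
    and bin: "\<And>u v. Poly_Mapping.keys u \<subseteq> J \<Longrightarrow> Poly_Mapping.keys v \<subseteq> J \<Longrightarrow> lexp a u = lexp a v \<Longrightarrow> binom u v \<in> H"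
  shows "toric_ideal J a \<subseteq> H"
proof -
  have "f \<in> H" if "f \<in> toric_ideal J a" for f
    using that
  proof (induction "card (Poly_Mapping.keys f)" arbitrary: f rule: less_induct)
    case less
    show ?case
    proof (cases "f = 0")
      case True
      then show ?thesis using poly_idealD(2)[OF H] by simp
    next
      case False
      then obtain m where m: "m \<in> Poly_Mapping.keys f" by (auto simp: poly_mapping_eq_iff fun_eq_iff in_keys_iff)
      let ?K = "{n \<in> Poly_Mapping.keys f. lexp a n = lexp a m}"
      have "(\<Sum>n\<in>?K. Poly_Mapping.lookup f n) = 0"
        using less.prems lookup_toric_map[of a f "lexp a m"] by (simp add: toric_ideal_iff)
      moreover have "(\<Sum>n\<in>{m}. Poly_Mapping.lookup f n) \<noteq> 0" using m by (simp add: in_keys_iff)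
      ultimately have "?K \<noteq> {m}" by metis
      then obtain n where n: "n \<in> Poly_Mapping.keys f" "lexp a n = lexp a m" "n \<noteq> m" using m by blast
      let ?c = "Poly_Mapping.single 0 (Poly_Mapping.lookup f m) :: ('j, 'k) polynomial"
      have mn: "Poly_Mapping.keys m \<subseteq> J" "Poly_Mapping.keys n \<subseteq> J"
        using less.prems m n(1) by (auto simp: toric_ideal_iff supp_subset_iff)
      define g where "g = f - ?c * binom m n"
      have "binom m n \<in> (toric_ideal J a :: ('j, 'k) polynomial set)"
        using binom_in_toric_ideal_iff[of m n J a, where 'k='k] mn n(2,3) by auto
      then have "?c * binom m n \<in> toric_ideal J a"
        by (intro poly_idealD(4)[OF ideal_toric_ideal]) auto
      with less.prems have g: "g \<in> toric_ideal J a"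
        unfolding g_def by (rule poly_idealD(6)[OF ideal_toric_ideal])
      have "?c * binom m n = Poly_Mapping.single m (Poly_Mapping.lookup f m) - Poly_Mapping.single n (Poly_Mapping.lookup f m)"
        by (simp add: right_diff_distrib mult_single)
      then have "Poly_Mapping.keys g \<subseteq> Poly_Mapping.keys f - {m}"
        using n(1,3) by (auto simp: g_def in_keys_iff lookup_minus lookup_single when_def split: if_splits)
      then have "card (Poly_Mapping.keys g) < card (Poly_Mapping.keys f)"
        using m by (intro psubset_card_mono) auto
      then have "g \<in> H" using less.hyps g by blast
      moreover have "?c * binom m n \<in> H"
        by (rule poly_idealD(4)[OF H _ bin]) (use mn n(2) in auto)
      ultimately have "g + ?c * binom m n \<in> H" by (rule poly_idealD(3)[OF H])
      then show ?thesis by (simp add: g_def)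
    qed
  qed
  then show ?thesis by blast
qed

text \<open>The kernel of \<open>toric_map\<close> is prime, so one factor of \<open>f\<close> lies
  in the toric ideal; its variables are among those of \<open>f\<close>, so it is a multiple of
  \<open>f\<close> and the other factor is a unit. Minimality of the support follows since a nonzero
  multiple of \<open>f\<close> keeps all variables of \<open>f\<close>.\<close>

lemma circuitI:
  fixes f :: "('j, 'k::field) polynomial"
  assumes f: "f \<in> toric_ideal J a" "is_binomial f"
    and principal: "\<And>g. g \<in> toric_ideal J a \<Longrightarrow> supp g \<subseteq> supp f \<Longrightarrow> \<exists>k. g = f * k"
  shows "f \<in> circuits J a"
proof -
  have f0: "f \<noteq> 0" using f(2) by (auto simp: is_binomial_def is_difference_def single_eq_single_iff)
  have unit: "x \<in> Units (poly_ring J)" if "x * y = 1" for x y :: "('j, 'k) polynomial"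
  proof -
    have "x \<noteq> 0" "y \<noteq> 0" using that by auto
    then have "supp x \<subseteq> supp (x * y)" "supp y \<subseteq> supp (x * y)"
      using supp_subset_mult(2)[of x y] supp_subset_mult(2)[of y x] by (simp_all add: mult.commute)
    then have "supp x \<subseteq> J" "supp y \<subseteq> J" by (auto simp: that supp_one)
    then show ?thesis using that unfolding Units_def by (auto simp: mult.commute intro!: exI[of _ y])
  qed
  have nounit: "f \<notin> Units (poly_ring J)"
  proof
    assume "f \<in> Units (poly_ring J)"
    then obtain g where "f * g = 1" by (auto simp: Units_def mult.commute)
    then have "toric_map a f * toric_map a g = toric_map a (1 :: ('j, 'k) polynomial)" by (simp flip: toric_map_mult)
    then have "toric_map a (1 :: ('j, 'k) polynomial) = 0" using f(1) by (simp add: toric_ideal_iff)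
    then show False using toric_map_single[of a 0 "1::'k"] by simp
  qed
  have "x \<in> Units (poly_ring J)" if x: "supp x \<subseteq> J" "properfactor (poly_ring J) x f" for x
  proof -
    obtain y where y: "f = x * y" "supp y \<subseteq> J" using x(2) by (auto simp: properfactor_def factor_def)
    have nz: "x \<noteq> 0" "y \<noteq> 0" using f0 y(1) by auto
    have "supp x \<subseteq> supp f" "supp y \<subseteq> supp f"
      using supp_subset_mult(2)[of x y] supp_subset_mult(2)[of y x] nz by (simp_all add: y(1) mult.commute)
    have "toric_map a x * toric_map a y = 0" using f(1) y(1) by (simp add: toric_ideal_iff toric_map_mult)
    then consider "toric_map a x = 0" | "toric_map a y = 0" using laurent_no_zero_divisors by blast
    then show ?thesis
    proof cases
      case 1
      then obtain k where k: "x = f * k"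
        using principal[of x] x(1) \<open>supp x \<subseteq> supp f\<close> by (auto simp: toric_ideal_iff)
      moreover from k have "k \<noteq> 0" using nz by auto
      then have "supp k \<subseteq> J" using supp_subset_mult(2)[of k f] f0 k x(1) by (auto simp: mult.commute)
      ultimately have "f divides\<^bsub>poly_ring J\<^esub> x" by (auto simp: factor_def)
      then show ?thesis using x(2) by (simp add: properfactor_def)
    next
      case 2
      then obtain k where k: "y = f * k"
        using principal[of y] y(2) \<open>supp y \<subseteq> supp f\<close> by (auto simp: toric_ideal_iff)
      then have "f * (x * k) = f * 1" using y(1) by (simp add: algebra_simps)
      then have "x * k = 1" using f0 by (rule polynomial_mult_left_cancel)
      then show ?thesis by (rule unit)
    qed
  qed
  then have "ring_irreducible\<^bsub>poly_ring J\<^esub> f"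
    using f0 nounit by (auto simp: ring_irreducible_def irreducible_def)
  moreover have False if g: "g \<in> toric_ideal J a" "is_binomial g" "supp g \<subset> supp f" for g :: "('j, 'k) polynomial"
  proof -
    obtain k where k: "g = f * k" using principal g by blast
    then have "k \<noteq> 0" using g(2) by (auto simp: is_binomial_def is_difference_def single_eq_single_iff)
    then have "supp f \<subseteq> supp g" using supp_subset_mult(2)[of f k] k f0 by auto
    then show False using g(3) by blast
  qed
  ultimately show ?thesis using f by (auto simp: circuits_def)
qed

lemma lookup_single_mult_add:
  fixes h :: "('j, 'k::comm_ring_1) polynomial"
  shows "Poly_Mapping.lookup (Poly_Mapping.single c x * h) (c + m) = x * Poly_Mapping.lookup h m"
    and lookup_single_mult_eq_0: "(\<And>n. w \<noteq> c + n) \<Longrightarrow> Poly_Mapping.lookup (Poly_Mapping.single c x * h) w = 0"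
proof -
  have eq: "Poly_Mapping.single c x * h =
      (\<Sum>n\<in>Poly_Mapping.keys h. Poly_Mapping.single (c + n) (x * Poly_Mapping.lookup h n))"
    by (subst poly_mapping_decompose[of h]) (simp add: sum_distrib_left mult_single)
  show "Poly_Mapping.lookup (Poly_Mapping.single c x * h) (c + m) = x * Poly_Mapping.lookup h m"
    by (auto simp: eq lookup_sum lookup_single when_def in_keys_iff)
  show "Poly_Mapping.lookup (Poly_Mapping.single c x * h) w = 0" if "\<And>n. w \<noteq> c + n"
    using that unfolding eq lookup_sum lookup_single when_def by (intro sum.neutral) auto
qed

text \<open>A common monomial divides the irreducible binomial, and properly so: its image is a
  nonzero Laurent monomial, while the binomial and its multiples map to zero. It would have to be a
  unit.\<close>

lemma circuit_coprime:
  fixes J :: "'j set" and a :: "'j \<Rightarrow> 'i \<Rightarrow>\<^sub>0 int"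
  assumes "(binom u v :: ('j, 'k::field) polynomial) \<in> circuits J a" "u \<noteq> v" "u = c + u'" "v = c + v'"
  shows "c = 0"
proof (rule ccontr)
  assume c: "c \<noteq> 0"
  let ?f = "binom u v :: ('j, 'k) polynomial" and ?c = "Poly_Mapping.single c 1 :: ('j, 'k) polynomial"
  have f: "?f \<in> toric_ideal J a" "ring_irreducible\<^bsub>poly_ring J\<^esub> ?f" using assms(1) by (auto simp: circuits_def)
  have K: "Poly_Mapping.keys c \<subseteq> J" "Poly_Mapping.keys u' \<subseteq> J" "Poly_Mapping.keys v' \<subseteq> J"
    using f(1) assms(2) unfolding binom_in_toric_ideal_iff[OF assms(2)] by (auto simp: assms(3,4) keys_monomial_add)
  have "?f = ?c * binom u' v'" by (simp add: right_diff_distrib mult_single assms(3,4))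
  moreover have "supp (binom u' v' :: ('j, 'k) polynomial) \<subseteq> J"
    using K assms by (subst supp_binom) auto
  ultimately have "?c divides\<^bsub>poly_ring J\<^esub> ?f" unfolding factor_def by auto
  moreover have "\<not> ?f divides\<^bsub>poly_ring J\<^esub> ?c"
  proof
    assume "?f divides\<^bsub>poly_ring J\<^esub> ?c"
    then obtain k where "?c = ?f * k" by (auto simp: factor_def)
    then have "toric_map a ?c = toric_map a ?f * toric_map a k" by (metis toric_map_mult)
    then show False using f(1) by (simp add: toric_ideal_iff)
  qed
  ultimately have "?c \<in> Units (poly_ring J)"
    using f(2) K(1) by (auto simp: ring_irreducible_def irreducible_def properfactor_def)
  then obtain k :: "('j, 'k) polynomial" where k: "?c * k = 1" by (auto simp: Units_def)
  have "0 \<noteq> c + n" for n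
    using c keys_monomial_add[of c n] by (metis Un_empty keys_eq_empty keys_zero)
  then have "Poly_Mapping.lookup (?c * k) 0 = 0" by (rule lookup_single_mult_eq_0)
  then show False by (simp add: k)
qed


section \<open>Homogeneous configurations\<close>

definition tdeg :: "'j monomial \<Rightarrow> nat" where
  "tdeg m = (\<Sum>j\<in>Poly_Mapping.keys m. Poly_Mapping.lookup m j)"

lemma tdeg_superset:
  assumes "finite S" "Poly_Mapping.keys m \<subseteq> S"
  shows "tdeg m = (\<Sum>j\<in>S. Poly_Mapping.lookup m j)"
  unfolding tdeg_def using assms by (intro sum.mono_neutral_left) (auto simp: in_keys_iff)

lemma tdeg_add: "tdeg (m + n) = tdeg m + tdeg n"
  using tdeg_superset[of "Poly_Mapping.keys m \<union> Poly_Mapping.keys n"]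
  by (simp add: keys_monomial_add lookup_add sum.distrib)

lemma tdeg_single [simp]: "tdeg (Poly_Mapping.single j n) = n"
  by (simp add: tdeg_def)

lemma tdeg_zero [simp]: "tdeg 0 = 0"
  by (simp add: tdeg_def)

lemma tdeg_eq_0_iff: "tdeg m = 0 \<longleftrightarrow> m = 0"
proof
  assume "tdeg m = 0"
  then have "\<forall>j\<in>Poly_Mapping.keys m. Poly_Mapping.lookup m j = 0" by (simp add: tdeg_def)
  then have "Poly_Mapping.keys m = {}" by blast
  then show "m = 0" by simp
qed simp

lemma lookup_le_tdeg: "Poly_Mapping.lookup m j \<le> tdeg m"
  by (cases "j \<in> Poly_Mapping.keys m") (auto simp: tdeg_def in_keys_iff intro: member_le_sum)

lemma monomial_split_off:
  assumes "j \<in> Poly_Mapping.keys (m :: 'j monomial)"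
  obtains m' where "m = Poly_Mapping.single j 1 + m'"
proof
  show "m = Poly_Mapping.single j 1 + (m - Poly_Mapping.single j 1)"
    using assms by (intro poly_mapping_eqI) (auto simp: lookup_add lookup_minus lookup_single when_def in_keys_iff)
qed

text \<open>Monomials of the same fibre that share a variable differ by a multiple of a binomial of
  lower degree; the reflexive transitive closure therefore collects the binomials which are
  consequences of binomials of lower degree.\<close>

definition fibre_step :: "'j set \<Rightarrow> ('j \<Rightarrow> 'i \<Rightarrow>\<^sub>0 int) \<Rightarrow> 'j monomial \<Rightarrow> 'j monomial \<Rightarrow> bool" where
  "fibre_step J a u v \<longleftrightarrow> Poly_Mapping.keys u \<subseteq> J \<and> Poly_Mapping.keys v \<subseteq> J \<and> lexp a u = lexp a v \<and>
     Poly_Mapping.keys u \<inter> Poly_Mapping.keys v \<noteq> {}"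

abbreviation fibre_conn :: "'j set \<Rightarrow> ('j \<Rightarrow> 'i \<Rightarrow>\<^sub>0 int) \<Rightarrow> 'j monomial \<Rightarrow> 'j monomial \<Rightarrow> bool" where
  "fibre_conn J a \<equiv> (fibre_step J a)\<^sup>*\<^sup>*"

text \<open>\<open>binom u v\<close> telescopes along the chain, and each step is a variable times a
  binomial of smaller weight. Phrasing \<open>low\<close> by weights serves both the induction on
  the degree and the removal of a generator.\<close>

lemma fibre_conn_binomial:
  fixes H :: "('j, 'k::comm_ring_1) polynomial set"
  assumes "fibre_conn J a u v" and H: "ideal H (poly_ring J)"
    and low: "\<And>j u' v'. j \<in> J \<Longrightarrow> Poly_Mapping.keys u' \<subseteq> J \<Longrightarrow> Poly_Mapping.keys v' \<subseteq> J \<Longrightarrow> lexp a u' = lexp a v' \<Longrightarrow>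
      lexp a (Poly_Mapping.single j 1 + u') = lexp a u \<Longrightarrow> binom u' v' \<in> H"
  shows "binom u v \<in> H \<and> lexp a v = lexp a u"
  using assms(1)
proof (induction rule: rtranclp_induct)
  case base
  then show ?case using poly_idealD(2)[OF H] by simp
next
  case (step v w)
  then obtain j where j: "j \<in> Poly_Mapping.keys v" "j \<in> Poly_Mapping.keys w" by (auto simp: fibre_step_def)
  obtain v' where v': "v = Poly_Mapping.single j 1 + v'" using monomial_split_off[OF j(1)] .
  obtain w' where w': "w = Poly_Mapping.single j 1 + w'" using monomial_split_off[OF j(2)] .
  have K: "Poly_Mapping.keys v \<subseteq> J" "Poly_Mapping.keys w \<subseteq> J" "lexp a v = lexp a w" and jJ: "j \<in> J"
    using step.hyps(2) j by (auto simp: fibre_step_def)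
  have "binom v' w' \<in> H"
    using K step.IH jJ by (intro low[of j]) (auto simp: v' w' lexp_add keys_monomial_add)
  then have "Poly_Mapping.single (Poly_Mapping.single j 1) 1 * binom v' w' \<in> H"
    using jJ by (intro poly_idealD(4)[OF H]) auto
  moreover have "Poly_Mapping.single (Poly_Mapping.single j 1) 1 * binom v' w' = (binom v w :: ('j, 'k) polynomial)"
    by (simp add: v' w' right_diff_distrib mult_single)
  ultimately have "binom u v + binom v w \<in> H" using step.IH by (intro poly_idealD(3)[OF H]) auto
  then show ?case using step.IH K(3) by simp
qed

locale homogeneous_configuration =
  fixes J :: "'j set" and a :: "'j \<Rightarrow> 'i \<Rightarrow>\<^sub>0 int"
  assumes finite_columns: "finite J"
    and nonneg: "j \<in> J \<Longrightarrow> Poly_Mapping.lookup (a j) i \<ge> 0"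
    and homogeneous: "Poly_Mapping.keys u \<subseteq> J \<Longrightarrow> Poly_Mapping.keys v \<subseteq> J \<Longrightarrow> lexp a u = lexp a v \<Longrightarrow> tdeg u = tdeg v"
begin

lemma lexp_eq_zeroD: "Poly_Mapping.keys m \<subseteq> J \<Longrightarrow> lexp a m = 0 \<Longrightarrow> m = 0"
  using homogeneous[of m 0] by (simp add: tdeg_eq_0_iff)

text \<open>Induction on the degree: a linked pair reduces to pairs of smaller degree, so only
  unlinked pairs have to be supplied.\<close>

lemma toric_ideal_subsetI:
  fixes H :: "('j, 'k::comm_ring_1) polynomial set"
  assumes H: "ideal H (poly_ring J)"
    and bin: "\<And>u v. Poly_Mapping.keys u \<subseteq> J \<Longrightarrow> Poly_Mapping.keys v \<subseteq> J \<Longrightarrow> lexp a u = lexp a v \<Longrightarrow>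
      \<not> fibre_conn J a u v \<Longrightarrow> binom u v \<in> H"
  shows "toric_ideal J a \<subseteq> H"
proof (rule toric_ideal_subset_by_binomials[OF H])
  fix u v assume "Poly_Mapping.keys u \<subseteq> J" "Poly_Mapping.keys v \<subseteq> J" "lexp a u = lexp a v"
  then show "binom u v \<in> H"
  proof (induction "tdeg u" arbitrary: u v rule: less_induct)
    case less
    show ?case
    proof (cases "fibre_conn J a u v")
      case True
      have "binom u v \<in> H \<and> lexp a v = lexp a u"
      proof (rule fibre_conn_binomial[OF True H])
        fix j u' v' assume j: "j \<in> J" "Poly_Mapping.keys u' \<subseteq> J" "Poly_Mapping.keys v' \<subseteq> J"
          "lexp a u' = lexp a v'" "lexp a (Poly_Mapping.single j 1 + u') = lexp a u"
        have "tdeg (Poly_Mapping.single j 1 + u') = tdeg u"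
          using j less.prems by (intro homogeneous) (auto simp: keys_monomial_add)
        then show "binom u' v' \<in> H" using j by (intro less.hyps) (auto simp: tdeg_add)
      qed
      then show ?thesis by simp
    qed (rule bin[OF less.prems])
  qed
qed

lemma finite_monomials: "finite {m. Poly_Mapping.keys m \<subseteq> J \<and> tdeg m \<le> N}"
proof -
  have "Poly_Mapping.lookup ` {m. Poly_Mapping.keys m \<subseteq> J \<and> tdeg m \<le> N}
      \<subseteq> {f. \<forall>j. (j \<in> J \<longrightarrow> f j \<in> {..N}) \<and> (j \<notin> J \<longrightarrow> f j = 0)}"
  proof (clarsimp)
    fix m :: "'j monomial" and j
    assume "Poly_Mapping.keys m \<subseteq> J" "tdeg m \<le> N"
    then show "(j \<in> J \<longrightarrow> Poly_Mapping.lookup m j \<le> N) \<and> (j \<notin> J \<longrightarrow> Poly_Mapping.lookup m j = 0)"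
      using lookup_le_tdeg[of m j] by (auto simp: in_keys_iff)
  qed
  moreover have "finite \<dots>" by (intro finite_set_of_finite_funs finite_columns) simp
  ultimately have "finite (Poly_Mapping.lookup ` {m. Poly_Mapping.keys m \<subseteq> J \<and> tdeg m \<le> N})"
    by (rule finite_subset)
  then show ?thesis by (rule finite_imageD) (auto simp: inj_on_def)
qed

text \<open>What matters is that the set is finite: a generating set of least cardinality is then
  minimal under inclusion.\<close>

lemma finite_binomial_generators:
  assumes "\<And>u v. Poly_Mapping.keys u \<subseteq> J \<Longrightarrow> Poly_Mapping.keys v \<subseteq> J \<Longrightarrow> lexp a u = lexp a v \<Longrightarrow>
      \<not> fibre_conn J a u v \<Longrightarrow> tdeg u \<le> N"
  obtains F :: "('j, 'k::comm_ring_1) polynomial set" where "finite F" "binomial_generators J a F"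
proof
  let ?M = "{m. Poly_Mapping.keys m \<subseteq> J \<and> tdeg m \<le> N}"
  define F :: "('j, 'k) polynomial set" where
    "F = (\<lambda>(u, v). binom u v) ` {(u, v). u \<in> ?M \<and> v \<in> ?M \<and> u \<noteq> v \<and> lexp a u = lexp a v}"
  show "finite F" unfolding F_def
    by (intro finite_imageI finite_subset[OF _ finite_cartesian_product[OF finite_monomials finite_monomials]]) auto
  have sub: "F \<subseteq> toric_ideal J a"
    by (auto simp: F_def binom_in_toric_ideal_iff)
  then have carr: "F \<subseteq> carrier (poly_ring J)" by (simp add: toric_ideal_def subset_iff)
  have "toric_ideal J a \<subseteq> Idl\<^bsub>poly_ring J\<^esub> F"
  proof (rule toric_ideal_subsetI[OF Idl_ideal[OF carr]])
    fix u v assume uv: "Poly_Mapping.keys u \<subseteq> J" "Poly_Mapping.keys v \<subseteq> J" "lexp a u = lexp a v"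
      "\<not> fibre_conn J a u v"
    then have "u \<noteq> v" by auto
    then have "binom u v \<in> F" using assms[OF uv] homogeneous[OF uv(1-3)] uv unfolding F_def by force
    then show "binom u v \<in> Idl\<^bsub>poly_ring J\<^esub> F" using Idl_superset[OF carr] by blast
  qed
  moreover have "Idl\<^bsub>poly_ring J\<^esub> F \<subseteq> toric_ideal J a"
    by (rule Idl_least[OF carr ideal_toric_ideal sub])
  moreover have "is_binomial f" if "f \<in> F" for f using that by (auto simp: F_def is_binomial_binom)
  ultimately show "binomial_generators J a F" using carr by (auto simp: binomial_generators_def)
qed

text \<open>Columns are nonnegative, so every monomial \<open>m\<close> of the fibre uses only
  columns selected by the binomial, and \<open>binom m u\<close> is a multiple of it. Comparing
  weights, \<open>m\<close> can only arise from a cofactor monomial of weight zero, which is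
  trivial.\<close>

lemma fundamental_fibre:
  fixes u v :: "'j monomial"
  assumes "fundamental J a (binom u v :: ('j, 'k::field) polynomial)" "u \<noteq> v"
    and "Poly_Mapping.keys m \<subseteq> J" "lexp a m = lexp a u" "lexp a u = lexp a v"
  shows "m \<in> {u, v}"
proof (rule ccontr)
  assume m: "m \<notin> {u, v}"
  let ?f = "binom u v :: ('j, 'k) polynomial"
  define T where "T = torus_columns J a ?f"
  have f: "supp ?f \<subseteq> T" "toric_ideal T a = Idl\<^bsub>poly_ring T\<^esub> {?f}"
    using assms(1) by (auto simp: fundamental_def T_def)
  have "Poly_Mapping.keys m \<subseteq> T"
  proof
    fix j assume j: "j \<in> Poly_Mapping.keys m"
    have "i \<in> torus_vars a ?f" if "i \<in> Poly_Mapping.keys (a j)" for i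
    proof -
      have "0 < int (Poly_Mapping.lookup m j) * Poly_Mapping.lookup (a j) i"
        using j that nonneg[of j i] subsetD[OF assms(3) j]
        by (intro mult_pos_pos) (auto simp: in_keys_iff)
      also have "\<dots> \<le> (\<Sum>j\<in>Poly_Mapping.keys m. int (Poly_Mapping.lookup m j) * Poly_Mapping.lookup (a j) i)"
        using j assms(3) nonneg by (intro member_le_sum) auto
      also have "\<dots> = Poly_Mapping.lookup (lexp a u) i"
        unfolding assms(4)[symmetric] by (simp add: lexp_def lookup_sum)
      finally show ?thesis
        unfolding torus_vars_def using assms(2) by (auto simp: keys_binom)
    qed
    then show "j \<in> T" using j assms(3) nonneg
      by (auto simp: T_def torus_columns_def poly_in_laurent_def)
  qed
  then have "binom m u \<in> (toric_ideal T a :: ('j, 'k) polynomial set)"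
    using m f(1) assms(2,4) by (subst binom_in_toric_ideal_iff) (auto simp: supp_binom)
  then obtain k :: "('j, 'k) polynomial" where k: "binom m u = k * ?f" "supp k \<subseteq> T"
    unfolding f(2) Idl_singleton[OF f(1)] by auto
  have KT: "Poly_Mapping.keys n \<subseteq> J" if "Poly_Mapping.keys n \<subseteq> T" for n :: "'j monomial"
    using that by (auto simp: T_def torus_columns_def)
  have *: "Poly_Mapping.lookup (k * Poly_Mapping.single w 1) m = 0" if "w \<in> {u, v}" for w
  proof -
    have eq: "k * Poly_Mapping.single w 1 = (\<Sum>n\<in>Poly_Mapping.keys k. Poly_Mapping.single (n + w) (Poly_Mapping.lookup k n))"
      by (subst poly_mapping_decompose[of k]) (simp add: sum_distrib_right mult_single)
    have ne: "m \<noteq> n + w" if n: "n \<in> Poly_Mapping.keys k" for n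
    proof
      assume eq: "m = n + w"
      then have "lexp a n = 0" using assms(4,5) \<open>w \<in> {u, v}\<close> by (auto simp: lexp_add)
      moreover have "Poly_Mapping.keys n \<subseteq> J" using k(2) n by (intro KT) (auto simp: supp_subset_iff)
      ultimately have "n = 0" using lexp_eq_zeroD by blast
      then show False using eq m \<open>w \<in> {u, v}\<close> by auto
    qed
    show ?thesis unfolding eq lookup_sum lookup_single when_def by (rule sum.neutral) (use ne in metis)
  qed
  have "Poly_Mapping.lookup (binom m u :: ('j, 'k) polynomial) m = 0"
    unfolding k(1) right_diff_distrib lookup_minus using *[of u] *[of v] by simp
  then show False using m by (auto simp: lookup_minus lookup_single when_def split: if_splits)
qed

text \<open>The polynomials with no monomial dividing \<open>u\<close> form an ideal
  \<open>H\<close>. A binomial of the toric ideal outside \<open>H\<close> has a side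
  \<open>x\<close> with \<open>u = c + x\<close>; its other side \<open>y\<close> gives a monomial
  \<open>c + y\<close> in the fibre, which must be \<open>v\<close>, and coprimality forces
  \<open>c = 0\<close>. So a generating set avoiding \<open>f\<close> and \<open>- f\<close> lies in
  \<open>H\<close>, whereas \<open>f\<close> does not.\<close>

lemma fundamental_circuit_indispensable:
  fixes f :: "('j, 'k::field) polynomial"
  assumes "f \<in> circuits J a" "fundamental J a f"
  shows "indispensable J a f"
proof -
  obtain u v where uv: "f = binom u v" "u \<noteq> v"
    using assms(1) by (auto simp: circuits_def is_binomial_def is_difference_def)
  have f: "binom u v \<in> (toric_ideal J a :: ('j, 'k) polynomial set)"
    using assms(1) by (simp add: circuits_def uv)
  then have K: "Poly_Mapping.keys u \<subseteq> J" "Poly_Mapping.keys v \<subseteq> J" "lexp a u = lexp a v"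
    unfolding binom_in_toric_ideal_iff[OF uv(2)] by auto
  have fibre: "m \<in> {u, v}" if "Poly_Mapping.keys m \<subseteq> J" "lexp a m = lexp a u" for m
    using fundamental_fibre[of u v, OF _ uv(2) that K(3)] assms(2) uv(1) by blast
  have coprime: "c = 0" if "u = c + u'" "v = c + v'" for c u' v'
    using circuit_coprime[of u v J a, OF _ uv(2) that] assms(1) uv(1) by blast
  have "f \<in> F \<or> - f \<in> F" if F: "binomial_generators J a F" for F
  proof (rule ccontr)
    assume nF: "\<not> (f \<in> F \<or> - f \<in> F)"
    define H where "H = {h :: ('j, 'k) polynomial. supp h \<subseteq> J \<and> (\<forall>c w. u = c + w \<longrightarrow> Poly_Mapping.lookup h w = 0)}"
    have carr: "F \<subseteq> carrier (poly_ring J)" "Idl\<^bsub>poly_ring J\<^esub> F = toric_ideal J a"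
      using F by (auto simp: binomial_generators_def)
    have "Idl\<^bsub>poly_ring J\<^esub> F \<subseteq> H"
    proof (rule Idl_subsetI)
      show "F \<subseteq> H"
      proof
        fix g assume g: "g \<in> F"
        then obtain u' v' where uv': "g = binom u' v'" "u' \<noteq> v'"
          using F by (auto simp: binomial_generators_def is_binomial_def is_difference_def)
        have "g \<in> toric_ideal J a" using g Idl_superset[OF carr(1)] carr(2) by auto
        then have K': "Poly_Mapping.keys u' \<subseteq> J" "Poly_Mapping.keys v' \<subseteq> J" "lexp a u' = lexp a v'"
          unfolding uv'(1) binom_in_toric_ideal_iff[OF uv'(2)] by auto
        have *: "x = u \<and> y = v" if "u = c + x" "x \<noteq> y" "Poly_Mapping.keys y \<subseteq> J" "lexp a x = lexp a y" for c x y
        proof -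
          have "c + y \<in> {u, v}"
            using that K(1) by (intro fibre) (auto simp: keys_monomial_add lexp_add)
          then have "v = c + y" using that by auto
          then show ?thesis using coprime[OF that(1)] that(1) by auto
        qed
        have "Poly_Mapping.lookup g w = 0" if w: "u = c + w" for c w
        proof (rule ccontr)
          assume "Poly_Mapping.lookup g w \<noteq> 0"
          then have "w = u' \<or> w = v'" by (auto simp: uv'(1) lookup_minus lookup_single when_def split: if_splits)
          then have "g = f \<or> g = - f"
            using *[of c u' v'] *[of c v' u'] w uv' K' uv by auto
          then show False using nF g by auto
        qed
        then show "g \<in> H" using g carr(1) by (auto simp: H_def)
      qed
      show "h + h' \<in> H" if "h \<in> H" "h' \<in> H" for h h'
        using that supp_add_subset[of h h'] by (auto simp: H_def lookup_add)
      show "Poly_Mapping.single m x * h \<in> H" if m: "Poly_Mapping.keys m \<subseteq> J" and h: "h \<in> H" for m x h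
      proof -
        have "Poly_Mapping.lookup (Poly_Mapping.single m x * h) w = 0" if "u = c + w" for c w
        proof (cases "\<exists>n. w = m + n")
          case True
          then obtain n where n: "w = m + n" by blast
          then have "Poly_Mapping.lookup h n = 0" using h that by (auto simp: H_def simp flip: add.assoc)
          then show ?thesis by (simp add: n lookup_single_mult_add)
        qed (auto intro: lookup_single_mult_eq_0)
        moreover have "supp (Poly_Mapping.single m x * h) \<subseteq> J"
          using supp_mult_subset[of "Poly_Mapping.single m x" h] m h by (auto simp: H_def split: if_splits)
        ultimately show ?thesis by (auto simp: H_def)
      qed
    qed (auto simp: H_def supp_zero)
    then have "f \<in> H" using f carr(2) uv(1) by auto
    then have "Poly_Mapping.lookup f u = 0" by (simp add: H_def)
    then show False using uv by (simp add: lookup_minus lookup_single when_def)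
  qed
  then show ?thesis by (auto simp: indispensable_def)
qed

text \<open>Exchanging \<open>- f\<close> for \<open>f\<close> preserves the generated ideal and
  does not enlarge the set, so a generating set of least size may be taken to contain
  \<open>f\<close>; none of its proper subsets can generate.\<close>

lemma indispensable_not_redundant:
  fixes f :: "('j, 'k::comm_ring_1) polynomial" and F\<^sub>0 :: "('j, 'k) polynomial set"
  assumes "indispensable J a f" "finite F\<^sub>0" "binomial_generators J a F\<^sub>0"
  shows "\<not> redundant J a f"
proof -
  define P where "P F \<longleftrightarrow> finite F \<and> binomial_generators J a F \<and> f \<in> F" for F :: "('j, 'k) polynomial set"
  have swap: "binomial_generators J a (insert f (F - {- f}))" if F: "binomial_generators J a F" "- f \<in> F" for F :: "('j, 'k) polynomial set"
  proof -
    let ?F = "insert f (F - {- f})"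
    have carr: "F \<subseteq> carrier (poly_ring J)" using F by (simp add: binomial_generators_def)
    then have f: "supp f \<subseteq> J" using F(2) by (metis mem_Collect_eq poly_ring_simps(1) subsetD supp_uminus)
    then have carr': "?F \<subseteq> carrier (poly_ring J)" using carr by auto
    have bin: "is_binomial f" using F by (auto simp: binomial_generators_def is_binomial_def is_difference_def)
      (metis minus_diff_eq minus_minus)
    have "Idl\<^bsub>poly_ring J\<^esub> ?F \<subseteq> Idl\<^bsub>poly_ring J\<^esub> F"
    proof (rule Idl_least[OF carr' Idl_ideal[OF carr]])
      show "?F \<subseteq> Idl\<^bsub>poly_ring J\<^esub> F"
        using Idl_superset[OF carr] poly_idealD(5)[OF Idl_ideal[OF carr], of "- f"] F(2) by auto
    qed
    moreover have "Idl\<^bsub>poly_ring J\<^esub> F \<subseteq> Idl\<^bsub>poly_ring J\<^esub> ?F"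
    proof (rule Idl_least[OF carr Idl_ideal[OF carr']])
      show "F \<subseteq> Idl\<^bsub>poly_ring J\<^esub> ?F"
        using Idl_superset[OF carr'] poly_idealD(5)[OF Idl_ideal[OF carr'], of f] by auto
    qed
    ultimately show ?thesis using F(1) carr' bin by (auto simp: binomial_generators_def)
  qed
  have ex: "\<exists>F'. P F' \<and> card F' \<le> card F" if F: "finite F" "binomial_generators J a F" for F :: "('j, 'k) polynomial set"
  proof (cases "f \<in> F")
    case False
    then have "- f \<in> F" using assms(1) F(2) by (auto simp: indispensable_def)
    then have "card (insert f (F - {- f})) \<le> card F"
      using card.remove[OF F(1) \<open>- f \<in> F\<close>] F(1) False by (simp add: card_insert_if)
    moreover have "P (insert f (F - {- f}))"
      using swap[OF F(2) \<open>- f \<in> F\<close>] F by (auto simp: P_def)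
    ultimately show ?thesis by blast
  qed (use F in \<open>auto simp: P_def\<close>)
  obtain F where F: "P F" "\<And>F'. P F' \<Longrightarrow> card F \<le> card F'"
    using ex_has_least_nat[of P _ card] ex[OF assms(2,3)] by metis
  have "\<not> binomial_generators J a F'" if "F' \<subset> F" for F'
  proof
    assume F': "binomial_generators J a F'"
    have "finite F'" "card F' < card F" using that F(1) psubset_card_mono finite_subset by (auto simp: P_def)
    then show False using ex[OF _ F'] F(2) by fastforce
  qed
  then show ?thesis using F(1) by (auto simp: redundant_def P_def)
qed

text \<open>The homogeneous component for the grading by \<open>lexp\<close>.\<close>

definition component :: "('i \<Rightarrow>\<^sub>0 int) \<Rightarrow> ('j, 'k::comm_ring_1) polynomial \<Rightarrow> ('j, 'k) polynomial" where
  "component \<beta> h = (\<Sum>m\<in>{m \<in> Poly_Mapping.keys h. lexp a m = \<beta>}. Poly_Mapping.single m (Poly_Mapping.lookup h m))"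

lemma lookup_component: "Poly_Mapping.lookup (component \<beta> h) m = (Poly_Mapping.lookup h m when lexp a m = \<beta>)"
proof -
  have "Poly_Mapping.lookup (component \<beta> h) m =
      (\<Sum>n\<in>{n \<in> Poly_Mapping.keys h. lexp a n = \<beta>}. if n = m then Poly_Mapping.lookup h n else 0)"
    unfolding component_def lookup_sum lookup_single when_def ..
  also have "\<dots> = (if m \<in> {n \<in> Poly_Mapping.keys h. lexp a n = \<beta>} then Poly_Mapping.lookup h m else 0)"
    by (rule sum.delta) simp
  finally show ?thesis by (auto simp: when_def in_keys_iff)
qed

lemma component_binom:
  fixes u v :: "'j monomial"
  assumes "lexp a u = lexp a v"
  shows "component \<beta> (binom u v) = (if lexp a u = \<beta> then binom u v else (0 :: ('j, 'b::comm_ring_1) polynomial))"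
proof (rule poly_mapping_eqI)
  fix m
  have *: "Poly_Mapping.lookup (binom u v) m = (0 :: 'b)" if "lexp a m \<noteq> lexp a u"
    using that assms by (metis diff_self lookup_minus lookup_single_not_eq)
  show "Poly_Mapping.lookup (component \<beta> (binom u v)) m =
      Poly_Mapping.lookup (if lexp a u = \<beta> then binom u v else 0 :: ('j, 'b) polynomial) m"
  proof (cases "lexp a m = lexp a u")
    case True
    then show ?thesis unfolding lookup_component True by (cases "lexp a u = \<beta>") simp_all
  next
    case False
    then show ?thesis unfolding lookup_component *[OF False] by (cases "lexp a u = \<beta>") (simp_all add: *)
  qed
qed

text \<open>The components of weight properly below \<open>lexp a u\<close> of the ideal generated by \<open>F\<close> do not
  involve the generator \<open>binom u v\<close>.\<close>

lemma lower_binomials_without_generator: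
  fixes F :: "('j, 'k::comm_ring_1) polynomial set"
  assumes F: "binomial_generators J a F" and uv: "u \<noteq> v" "lexp a u = lexp a v"
    and c: "c \<noteq> 0" "Poly_Mapping.keys c \<subseteq> J"
    and uv': "Poly_Mapping.keys u' \<subseteq> J" "Poly_Mapping.keys v' \<subseteq> J" "lexp a u' = lexp a v'"
      "lexp a (c + u') = lexp a u"
  shows "binom u' v' \<in> Idl\<^bsub>poly_ring J\<^esub> (F - {binom u v})"
proof -
  define G where "G = Idl\<^bsub>poly_ring J\<^esub> (F - {binom u v :: ('j, 'k) polynomial})"
  have carr: "F \<subseteq> carrier (poly_ring J)" "Idl\<^bsub>poly_ring J\<^esub> F = toric_ideal J a"
    using F by (auto simp: binomial_generators_def)
  have carr': "F - {binom u v} \<subseteq> carrier (poly_ring J)" using carr(1) by blast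
  have G: "ideal G (poly_ring J)" unfolding G_def by (rule Idl_ideal[OF carr'])
  \<comment> \<open>Lowering a weight further keeps it below that of \<open>u\<close>; this makes
    \<open>H\<close> stable under multiplication by terms.\<close>
  define below where "below \<beta> \<longleftrightarrow> (\<exists>c. c \<noteq> 0 \<and> Poly_Mapping.keys c \<subseteq> J \<and> lexp a c + \<beta> = lexp a u)" for \<beta>
  define H where "H = {h :: ('j, 'k) polynomial. supp h \<subseteq> J \<and> (\<forall>\<beta>. below \<beta> \<longrightarrow> component \<beta> h \<in> G)}"
  have "Idl\<^bsub>poly_ring J\<^esub> F \<subseteq> H"
  proof (rule Idl_subsetI)
    show "F \<subseteq> H"
    proof
      fix g assume g: "g \<in> F"
      then obtain x y where xy: "g = binom x y" "x \<noteq> y"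
        using F by (auto simp: binomial_generators_def is_binomial_def is_difference_def)
      have "g \<in> toric_ideal J a" using g Idl_superset[OF carr(1)] carr(2) by auto
      then have "lexp a x = lexp a y" unfolding xy(1) binom_in_toric_ideal_iff[OF xy(2)] by auto
      note comp = component_binom[OF this]
      have "component \<beta> g \<in> G" if \<beta>: "below \<beta>" for \<beta>
      proof (cases "g = binom u v")
        case True
        \<comment> \<open>A nontrivial monomial has nonzero weight, so the weight of
          \<open>u\<close> is not below itself and the excluded generator contributes
          nothing.\<close>
        have "lexp a u \<noteq> \<beta>" using \<beta> lexp_eq_zeroD by (auto simp: below_def)
        then show ?thesis using poly_idealD(2)[OF G] True by (simp add: component_binom[OF uv(2)])
      next
        case False
        then have "g \<in> G" using g Idl_superset[OF carr'] by (auto simp: G_def)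
        then show ?thesis using poly_idealD(2)[OF G] xy(1) by (simp add: comp)
      qed
      then show "g \<in> H" using g carr(1) by (auto simp: H_def)
    qed
    show "h + h' \<in> H" if "h \<in> H" "h' \<in> H" for h h'
    proof -
      have "component \<beta> (h + h') = component \<beta> h + component \<beta> h'" for \<beta>
        by (intro poly_mapping_eqI) (simp add: lookup_component lookup_add when_def)
      then show ?thesis using that supp_add_subset[of h h'] poly_idealD(3)[OF G] by (auto simp: H_def)
    qed
    show "Poly_Mapping.single m x * h \<in> H" if m: "Poly_Mapping.keys m \<subseteq> J" and h: "h \<in> H" for m x h
    proof -
      have "component \<beta> (Poly_Mapping.single m x * h) \<in> G" if \<beta>: "below \<beta>" for \<beta>
      proof -
        have "component \<beta> (Poly_Mapping.single m x * h) = Poly_Mapping.single m x * component (\<beta> - lexp a m) h"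
        proof (rule poly_mapping_eqI)
          fix w
          show "Poly_Mapping.lookup (component \<beta> (Poly_Mapping.single m x * h)) w =
            Poly_Mapping.lookup (Poly_Mapping.single m x * component (\<beta> - lexp a m) h) w"
          proof (cases "\<exists>n. w = m + n")
            case True
            then obtain n where n: "w = m + n" by blast
            show ?thesis
              by (auto simp: n lookup_component lookup_single_mult_add lexp_add when_def)
          qed (simp add: lookup_component lookup_single_mult_eq_0)
        qed
        moreover have "below (\<beta> - lexp a m)"
        proof -
          obtain d where d: "d \<noteq> 0" "Poly_Mapping.keys d \<subseteq> J" "lexp a d + \<beta> = lexp a u"
            using \<beta> by (auto simp: below_def)
          have "d + m \<noteq> 0" using d(1) keys_monomial_add[of d m] by (metis Un_empty keys_eq_empty)
          moreover have "Poly_Mapping.keys (d + m) \<subseteq> J" using d(2) m by (simp add: keys_monomial_add)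
          moreover have "lexp a (d + m) + (\<beta> - lexp a m) = lexp a u" using d(3) by (simp add: lexp_add algebra_simps)
          ultimately show ?thesis unfolding below_def by blast
        qed
        then have "component (\<beta> - lexp a m) h \<in> G" using h by (simp add: H_def)
        ultimately show ?thesis using m by (simp add: poly_idealD(4)[OF G])
      qed
      moreover have "supp (Poly_Mapping.single m x * h) \<subseteq> J"
        using supp_mult_subset[of "Poly_Mapping.single m x" h] m h by (auto simp: H_def split: if_splits)
      ultimately show ?thesis by (auto simp: H_def)
    qed
  qed (auto simp: H_def supp_zero component_def poly_idealD(2)[OF G])
  moreover have "binom u' v' \<in> (toric_ideal J a :: ('j, 'k) polynomial set)"
    using binom_in_toric_ideal_iff[of u' v' J a, where 'k='k] uv' poly_idealD(2)[OF ideal_toric_ideal[of J a]]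
    by (cases "u' = v'") auto
  moreover have "below (lexp a u')" using c uv'(4) by (auto simp: below_def lexp_add)
  ultimately have "component (lexp a u') (binom u' v' :: ('j, 'k) polynomial) \<in> G"
    using carr(2) by (auto simp: H_def)
  then show ?thesis by (simp add: G_def component_binom[OF uv'(3)])
qed

text \<open>The chain from \<open>u\<close> to \<open>v\<close> uses only binomials of weight
  properly below that of \<open>u\<close>, and these are generated by \<open>F\<close> without
  \<open>binom u v\<close>.\<close>

lemma redundantI:
  fixes u v :: "'j monomial"
  assumes "fibre_conn J a u v" "u \<noteq> v" "lexp a u = lexp a v"
  shows "redundant J a (binom u v :: ('j, 'k::comm_ring_1) polynomial)"
proof -
  let ?f = "binom u v :: ('j, 'k) polynomial"
  have False if F: "binomial_generators J a F" "\<And>F'. F' \<subset> F \<Longrightarrow> \<not> binomial_generators J a F'" "?f \<in> F" for F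
  proof -
    have carr: "F \<subseteq> carrier (poly_ring J)" "F - {?f} \<subseteq> carrier (poly_ring J)"
      using F(1) by (auto simp: binomial_generators_def)
    have "?f \<in> Idl\<^bsub>poly_ring J\<^esub> (F - {?f}) \<and> lexp a v = lexp a u"
      by (rule fibre_conn_binomial[OF assms(1) Idl_ideal[OF carr(2)]],
          rule lower_binomials_without_generator[OF F(1) assms(2,3)])
        auto
    then have "F \<subseteq> Idl\<^bsub>poly_ring J\<^esub> (F - {?f})" using Idl_superset[OF carr(2)] by auto
    then have "Idl\<^bsub>poly_ring J\<^esub> F \<subseteq> Idl\<^bsub>poly_ring J\<^esub> (F - {?f})"
      by (rule Idl_least[OF carr(1) Idl_ideal[OF carr(2)]])
    moreover have "Idl\<^bsub>poly_ring J\<^esub> (F - {?f}) \<subseteq> Idl\<^bsub>poly_ring J\<^esub> F"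
      using Idl_superset[OF carr(1)] by (intro Idl_least[OF carr(2) Idl_ideal[OF carr(1)]]) blast
    ultimately have "binomial_generators J a (F - {?f})"
      using F(1) by (auto simp: binomial_generators_def)
    then show False using F(2,3) by blast
  qed
  then show ?thesis unfolding redundant_def by blast
qed

end

section \<open>Alternating closed walks\<close>

text \<open>For an even closed walk the two values of \<open>b\<close> give the two sides of its
  binomial. Parity refers to the absolute position, so segments add up without tracking
  offsets.\<close>

definition alt :: "(nat \<Rightarrow> 'v) \<Rightarrow> bool \<Rightarrow> nat \<Rightarrow> nat \<Rightarrow> 'v set monomial" where
  "alt w b i j = (\<Sum>t\<in>{t \<in> {i..<j}. even t = b}. Poly_Mapping.single {w t, w (Suc t)} 1)"

lemma lookup_alt: "Poly_Mapping.lookup (alt w b i j) e = card {t \<in> {i..<j}. even t = b \<and> {w t, w (Suc t)} = e}"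
proof -
  have "Poly_Mapping.lookup (alt w b i j) e = (\<Sum>t\<in>{t \<in> {i..<j}. even t = b}. if {w t, w (Suc t)} = e then 1 else 0)"
    unfolding alt_def lookup_sum lookup_single when_def ..
  also have "\<dots> = card {t \<in> {t \<in> {i..<j}. even t = b}. {w t, w (Suc t)} = e}"
    by (simp add: sum.If_cases Int_def)
  also have "{t \<in> {t \<in> {i..<j}. even t = b}. {w t, w (Suc t)} = e} = {t \<in> {i..<j}. even t = b \<and> {w t, w (Suc t)} = e}"
    by auto
  finally show ?thesis .
qed

lemma keys_alt: "Poly_Mapping.keys (alt w b i j) = {{w t, w (Suc t)} |t. i \<le> t \<and> t < j \<and> even t = b}"
proof -
  have "e \<in> Poly_Mapping.keys (alt w b i j) \<longleftrightarrow> (\<exists>t. i \<le> t \<and> t < j \<and> even t = b \<and> {w t, w (Suc t)} = e)" for e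
    by (auto simp: in_keys_iff lookup_alt card_eq_0_iff)
  then show ?thesis by blast
qed

lemma alt_split:
  assumes "i \<le> m" "m \<le> j"
  shows "alt w b i j = alt w b i m + alt w b m j"
proof -
  have eq: "{t \<in> {i..<j}. even t = b} = {t \<in> {i..<m}. even t = b} \<union> {t \<in> {m..<j}. even t = b}"
    using assms by auto
  show ?thesis unfolding alt_def eq by (rule sum.union_disjoint) auto
qed

lemma alt_empty [simp]: "alt w b i i = 0"
  by (simp add: alt_def)

lemma alt_one [simp]: "alt w b i (Suc i) = (if even i = b then Poly_Mapping.single {w i, w (Suc i)} 1 else 0)"
proof -
  have "{t \<in> {i..<Suc i}. even t = b} = (if even i = b then {i} else {})" by auto
  then show ?thesis by (simp add: alt_def)
qed

lemma alt_Suc: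
  assumes "i \<le> j"
  shows "alt w b i (Suc j) = alt w b i j + (if even j = b then Poly_Mapping.single {w j, w (Suc j)} 1 else 0)"
  using alt_split[of i j "Suc j" w b] assms by simp

lemma alt_cong:
  assumes "\<And>t. i \<le> t \<Longrightarrow> t \<le> j \<Longrightarrow> w t = w' t"
  shows "alt w b i j = alt w' b i j"
  unfolding alt_def using assms by (intro sum.cong) auto

lemma alt_shift: "alt (\<lambda>t. w (t + n)) b i j = alt w (b = even n) (i + n) (j + n)"
  unfolding alt_def
  by (rule sum.reindex_bij_witness[of _ "\<lambda>t. t - n" "\<lambda>t. t + n"]) (auto simp: Suc_diff_le)

lemma alt_nonempty:
  assumes "i + 2 \<le> j"
  shows "Poly_Mapping.keys (alt w b i j) \<noteq> {}"
proof -
  have "{w i, w (Suc i)} \<in> Poly_Mapping.keys (alt w b i j) \<or> {w (Suc i), w (Suc (Suc i))} \<in> Poly_Mapping.keys (alt w b i j)"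
    unfolding keys_alt using assms by (cases "even i = b") (auto 4 4)
  then show ?thesis by blast
qed

lemma tdeg_alt: "tdeg (alt w b i j) = card {t \<in> {i..<j}. even t = b}"
proof -
  have *: "tdeg (\<Sum>x\<in>S. f x) = (\<Sum>x\<in>S. tdeg (f x))" for S and f :: "nat \<Rightarrow> 'a set monomial"
    by (induction S rule: infinite_finite_induct) (auto simp: tdeg_add)
  show ?thesis by (simp add: alt_def *)
qed

lemma lookup_le_imp_add:
  assumes "\<And>e. Poly_Mapping.lookup n e \<le> Poly_Mapping.lookup (m :: 'j monomial) e"
  shows "m = n + (m - n)"
  using assms by (intro poly_mapping_eqI) (simp add: lookup_add lookup_minus)

lemma tdeg_mono:
  assumes "\<And>e. Poly_Mapping.lookup n e \<le> Poly_Mapping.lookup (m :: 'j monomial) e"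
  shows "tdeg n \<le> tdeg m"
  by (subst lookup_le_imp_add[OF assms]) (simp_all add: tdeg_add)

section \<open>Vertex degrees and alternating trails\<close>

locale finite_graph =
  fixes V :: "'v set" and E :: "'v set set"
  assumes graph: "finite_simple_graph V E"
begin

lemma finite_V: "finite V"
  using graph by (simp add: finite_simple_graph_def)

lemma edgeD: "{x, y} \<in> E \<Longrightarrow> x \<in> V \<and> y \<in> V \<and> x \<noteq> y"
  using graph by (fastforce simp: finite_simple_graph_def)

lemma edgeE:
  assumes "e \<in> E"
  obtains x y where "e = {x, y}" "x \<noteq> y" "x \<in> V" "y \<in> V"
  using assms graph by (auto simp: finite_simple_graph_def card_2_iff)

lemma lookup_rho:
  assumes "e \<in> E"
  shows "Poly_Mapping.lookup (rho e) x = of_bool (x \<in> e)"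
proof -
  have "finite e" using assms by (elim edgeE) auto
  then show ?thesis by (simp add: rho_def lookup_sum lookup_single when_def of_bool_def)
qed

text \<open>The degree of \<open>x\<close> in the multigraph with edge multiplicities
  \<open>m\<close>; a fibre consists of the multigraphs with a prescribed degree sequence.\<close>

definition dg :: "'v set monomial \<Rightarrow> 'v \<Rightarrow> int" where
  "dg m x = Poly_Mapping.lookup (lexp rho m) x"

lemma dg_add: "dg (m + n) x = dg m x + dg n x"
  by (simp add: dg_def lexp_add lookup_add)

lemma dg_zero [simp]: "dg 0 x = 0"
  by (simp add: dg_def)

lemma dg_edge: "{p, q} \<in> E \<Longrightarrow> dg (Poly_Mapping.single {p, q} (Suc 0)) x = of_bool (x = p) + of_bool (x = q)"
  using edgeD[of p q] by (auto simp: dg_def lookup_rho)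

lemma dg_altdef:
  assumes "Poly_Mapping.keys m \<subseteq> E"
  shows "dg m x = (\<Sum>e\<in>{e \<in> Poly_Mapping.keys m. x \<in> e}. int (Poly_Mapping.lookup m e))"
proof -
  have "dg m x = (\<Sum>e\<in>Poly_Mapping.keys m. if x \<in> e then int (Poly_Mapping.lookup m e) else 0)"
    unfolding dg_def lexp_def lookup_sum using assms by (intro sum.cong refl) (auto simp: lookup_rho)
  then show ?thesis by (simp add: sum.inter_filter)
qed

lemma dg_nonneg: "Poly_Mapping.keys m \<subseteq> E \<Longrightarrow> dg m x \<ge> 0"
  by (auto simp: dg_altdef intro: sum_nonneg)

lemma lexp_eq_iff: "lexp rho m = lexp rho n \<longleftrightarrow> (\<forall>x. dg m x = dg n x)"
  unfolding dg_def poly_mapping_eq_iff fun_eq_iff ..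

text \<open>The handshake count, which makes the configuration homogeneous.\<close>

lemma sum_dg:
  assumes "Poly_Mapping.keys m \<subseteq> E"
  shows "(\<Sum>x\<in>V. dg m x) = 2 * int (tdeg m)"
proof -
  have "(\<Sum>x\<in>V. dg m x) = (\<Sum>x\<in>V. \<Sum>e\<in>Poly_Mapping.keys m. int (Poly_Mapping.lookup m e) * of_bool (x \<in> e))"
    unfolding dg_def lexp_def lookup_sum using assms by (intro sum.cong refl) (auto simp: lookup_rho)
  also have "\<dots> = (\<Sum>e\<in>Poly_Mapping.keys m. \<Sum>x\<in>V. int (Poly_Mapping.lookup m e) * of_bool (x \<in> e))"
    by (rule sum.swap)
  also have "\<dots> = (\<Sum>e\<in>Poly_Mapping.keys m. 2 * int (Poly_Mapping.lookup m e))"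
  proof (rule sum.cong[OF refl])
    fix e assume "e \<in> Poly_Mapping.keys m"
    then have "e \<in> E" using assms by blast
    then have "e \<subseteq> V" "card e = 2" using graph by (auto simp: finite_simple_graph_def)
    then have "(\<Sum>x\<in>V. of_bool (x \<in> e) :: int) = 2"
      using finite_V by (simp add: of_bool_def Int_absorb1 flip: sum.inter_restrict)
    then show "(\<Sum>x\<in>V. int (Poly_Mapping.lookup m e) * of_bool (x \<in> e)) = 2 * int (Poly_Mapping.lookup m e)"
      by (simp flip: sum_distrib_left)
  qed
  finally show ?thesis by (simp add: tdeg_def sum_distrib_left)
qed

sublocale homogeneous_configuration E rho
proof
  show "finite E" using graph finite_subset[of E "Pow V"] by (auto simp: finite_simple_graph_def)
  show "Poly_Mapping.lookup (rho e) x \<ge> 0" if "e \<in> E" for e x using that by (simp add: lookup_rho)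
  show "tdeg u = tdeg v" if "Poly_Mapping.keys u \<subseteq> E" "Poly_Mapping.keys v \<subseteq> E" "lexp rho u = lexp rho v" for u v
    using sum_dg[of u] sum_dg[of v] that by (simp add: lexp_eq_iff)
qed

lemma keys_alt_subset:
  assumes "\<And>t. i \<le> t \<Longrightarrow> t < j \<Longrightarrow> {w t, w (Suc t)} \<in> E"
  shows "Poly_Mapping.keys (alt w b i j) \<subseteq> E"
  using assms by (auto simp: keys_alt)

text \<open>Each inner visit of a walk meets one edge of either parity, so the contributions cancel
  except at the two ends.\<close>

lemma dg_alt_diff:
  assumes "i \<le> j" "\<And>t. i \<le> t \<Longrightarrow> t < j \<Longrightarrow> {w t, w (Suc t)} \<in> E"
  shows "dg (alt w True i j) x - dg (alt w False i j) x = (-1) ^ i * of_bool (x = w i) - (-1) ^ j * of_bool (x = w j)"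
  using assms
proof (induction j rule: dec_induct)
  case (step j)
  have "{w j, w (Suc j)} \<in> E" using step by auto
  then show ?case using step by (auto simp: alt_Suc dg_add dg_edge)
qed simp

lemma extend_trail:
  assumes m: "Poly_Mapping.keys m \<subseteq> E" and n: "Poly_Mapping.keys n \<subseteq> E"
    and le: "\<And>e. Poly_Mapping.lookup n e \<le> Poly_Mapping.lookup m e" and less: "dg n x < dg m x"
  shows "\<exists>y. {x, y} \<in> E \<and> (\<forall>e. Poly_Mapping.lookup (n + Poly_Mapping.single {x, y} 1) e \<le> Poly_Mapping.lookup m e)"
proof -
  have "\<exists>e\<in>E. x \<in> e \<and> Poly_Mapping.lookup n e < Poly_Mapping.lookup m e"
  proof (rule ccontr)
    assume *: "\<not> ?thesis"
    have "m = n + (m - n)" using le by (rule lookup_le_imp_add)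
    then have "dg m x = dg n x + dg (m - n) x" by (metis dg_add)
    moreover have "Poly_Mapping.keys (m - n) \<subseteq> E" using m by (auto simp: in_keys_iff lookup_minus)
    then have "dg (m - n) x = 0" using * by (force simp: dg_altdef in_keys_iff lookup_minus intro!: sum.neutral)
    ultimately show False using less by simp
  qed
  then obtain e where e: "e \<in> E" "x \<in> e" "Poly_Mapping.lookup n e < Poly_Mapping.lookup m e" by blast
  then obtain y where y: "e = {x, y}" by (elim edgeE) auto
  show ?thesis
    by (rule exI[of _ y]) (use e y le in \<open>auto simp: lookup_add lookup_single when_def Suc_le_eq\<close>)
qed

text \<open>A longest alternating trail of unused edges must close up with even length, because the
  degrees of the two monomials agree at its end.\<close>

lemma closed_trail_exists:
  assumes u: "Poly_Mapping.keys u \<subseteq> E" and v: "Poly_Mapping.keys v \<subseteq> E" and uv: "\<And>x. dg u x = dg v x" and "u \<noteq> 0"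
  obtains w l where "even l" "l > 0" "w l = w 0" "\<And>t. t < l \<Longrightarrow> {w t, w (Suc t)} \<in> E"
    "\<And>e. Poly_Mapping.lookup (alt w True 0 l) e \<le> Poly_Mapping.lookup u e"
    "\<And>e. Poly_Mapping.lookup (alt w False 0 l) e \<le> Poly_Mapping.lookup v e"
proof (rule ccontr)
  assume none: "\<not> thesis"
  note closed = that
  define trail where "trail w l \<longleftrightarrow> (\<forall>t<l. {w t, w (Suc t)} \<in> E) \<and>
    (\<forall>e. Poly_Mapping.lookup (alt w True 0 l) e \<le> Poly_Mapping.lookup u e) \<and>
    (\<forall>e. Poly_Mapping.lookup (alt w False 0 l) e \<le> Poly_Mapping.lookup v e)" for w l
  have open_trail: "w l \<noteq> w 0" if "trail w l" "even l" "l > 0" for w l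
    using none closed[of l w] that unfolding trail_def by blast
  \<comment> \<open>If no trail closes up with even length, every trail can be prolonged, which
    contradicts the degree of \<open>u\<close> in the end.\<close>
  have "\<exists>w. trail w l" if "l > 0" for l
    using that
  proof (induction l rule: nat_induct_non_zero)
    case 1
    obtain e where e: "e \<in> Poly_Mapping.keys u" using \<open>u \<noteq> 0\<close> keys_eq_empty[of u] by blast
    then obtain x y where xy: "e = {x, y}" "x \<noteq> y" using u by (blast elim: edgeE)
    let ?w = "(\<lambda>t. if t = 0 then x else y)"
    have "trail ?w 1"
      using e u xy by (auto simp: trail_def lookup_single when_def in_keys_iff)
    then show ?case by blast
  next
    case (Suc l)
    then obtain w where w: "trail w l" by blast
    then have edges: "\<And>t. 0 \<le> t \<Longrightarrow> t < l \<Longrightarrow> {w t, w (Suc t)} \<in> E" by (auto simp: trail_def)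
    have d: "dg (alt w True 0 l) (w l) - dg (alt w False 0 l) (w l) = of_bool (w l = w 0) - (-1) ^ l"
      using dg_alt_diff[of 0 l w "w l"] edges by simp
    have K: "Poly_Mapping.keys (alt w b 0 l) \<subseteq> E" for b
      by (rule keys_alt_subset) (rule edges)
    have le_dg: "dg n x \<le> dg m x" if "Poly_Mapping.keys m \<subseteq> E" "\<And>e. Poly_Mapping.lookup n e \<le> Poly_Mapping.lookup m e" for m n x
    proof -
      have "m = n + (m - n)" using that(2) by (rule lookup_le_imp_add)
      then have "dg m x = dg n x + dg (m - n) x" by (metis dg_add)
      moreover have "Poly_Mapping.keys (m - n) \<subseteq> E" using that(1) by (auto simp: in_keys_iff lookup_minus)
      then have "dg (m - n) x \<ge> 0" by (rule dg_nonneg)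
      ultimately show ?thesis by simp
    qed
    have ex: "\<exists>y. {w l, y} \<in> E \<and> (\<forall>e. Poly_Mapping.lookup (alt w (even l) 0 l + Poly_Mapping.single {w l, y} 1) e
        \<le> Poly_Mapping.lookup (if even l then u else v) e)"
    proof (cases "even l")
      case True
      then have "dg (alt w True 0 l) (w l) < dg (alt w False 0 l) (w l)"
        using d open_trail[OF w] Suc.hyps by simp
      also have "\<dots> \<le> dg u (w l)" unfolding uv using w v by (intro le_dg) (auto simp: trail_def)
      finally show ?thesis
        using extend_trail[OF u K[of True], of "w l"] w True by (simp add: trail_def)
    next
      case False
      then have "dg (alt w False 0 l) (w l) < dg (alt w True 0 l) (w l)"
        using d by (cases "w l = w 0") auto
      also have "\<dots> \<le> dg v (w l)" unfolding uv[symmetric] using w u by (intro le_dg) (auto simp: trail_def)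
      finally show ?thesis
        using extend_trail[OF v K[of False], of "w l"] w False by (simp add: trail_def)
    qed
    then obtain y where y: "{w l, y} \<in> E" "\<And>e. Poly_Mapping.lookup (alt w (even l) 0 l + Poly_Mapping.single {w l, y} 1) e
        \<le> Poly_Mapping.lookup (if even l then u else v) e" by blast
    let ?w = "w(Suc l := y)"
    have "alt ?w b 0 l = alt w b 0 l" for b by (rule alt_cong) auto
    then have alt': "alt ?w b 0 (Suc l) = alt w b 0 l + (if even l = b then Poly_Mapping.single {w l, y} 1 else 0)" for b
      by (simp add: alt_Suc)
    have "trail ?w (Suc l)"
      using w y unfolding trail_def alt' by (cases "even l") (auto simp: less_Suc_eq)
    then show ?case by blast
  qed
  \<comment> \<open>A trail of this length would use \<open>tdeg u + 1\<close> edges of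
    \<open>u\<close>.\<close>
  then obtain w where w: "trail w (Suc (2 * tdeg u))" by blast
  then have "tdeg (alt w True 0 (Suc (2 * tdeg u))) \<le> tdeg u"
    by (intro tdeg_mono) (simp add: trail_def)
  moreover have "(\<lambda>n. 2 * n) ` {..tdeg u} \<subseteq> {t \<in> {0..<Suc (2 * tdeg u)}. even t = True}" by auto
  then have "card ((\<lambda>n::nat. 2 * n) ` {..tdeg u}) \<le> tdeg (alt w True 0 (Suc (2 * tdeg u)))"
    unfolding tdeg_alt by (intro card_mono) auto
  moreover have "card ((\<lambda>n::nat. 2 * n) ` {..tdeg u}) = Suc (tdeg u)"
    by (subst card_image) (auto simp: inj_on_def)
  ultimately show False by simp
qed

end

section \<open>Induced paths and lollipops\<close>

lemma path_edges_map: "path_edges (map z [a..<b]) = {{z t, z (Suc t)} |t. a \<le> t \<and> Suc t < b}"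
proof -
  have "path_edges (map z [a..<b]) = {{z (a + i), z (a + Suc i)} |i. Suc i < b - a}"
    unfolding path_edges_def by (intro Collect_cong ex_cong1) auto
  also have "\<dots> = {{z t, z (Suc t)} |t. a \<le> t \<and> Suc t < b}"
  proof (intro equalityI subsetI; clarify)
    fix i assume "Suc i < b - a"
    then show "\<exists>t. {z (a + i), z (a + Suc i)} = {z t, z (Suc t)} \<and> a \<le> t \<and> Suc t < b"
      by (intro exI[of _ "a + i"]) auto
  next
    fix t assume "a \<le> t" "Suc t < b"
    then show "\<exists>i. {z t, z (Suc t)} = {z (a + i), z (a + Suc i)} \<and> Suc i < b - a"
      by (intro exI[of _ "t - a"]) auto
  qed
  finally show ?thesis .
qed

lemma cycle_edges_map:
  assumes "a < b"
  shows "cycle_edges (map z [a..<b]) = insert {z (b - 1), z a} {{z t, z (Suc t)} |t. a \<le> t \<and> Suc t < b}"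
proof -
  have eq: "{map z [a..<b] ! i, map z [a..<b] ! (Suc i mod length (map z [a..<b]))} =
      (if Suc i < b - a then {z (a + i), z (Suc (a + i))} else {z (b - 1), z a})" if "i < b - a" for i
  proof (cases "Suc i < b - a")
    case False
    then have i: "Suc i = b - a" "a + i = b - 1" using that by auto
    then have "[a..<b] ! i = b - 1" using that by simp
    then show ?thesis using that assms False i(1) by simp
  qed (use that in auto)
  have "cycle_edges (map z [a..<b]) =
      (\<lambda>i. {map z [a..<b] ! i, map z [a..<b] ! (Suc i mod length (map z [a..<b]))}) ` {..<b - a}"
    unfolding cycle_edges_def by (force simp only: length_map length_upt lessThan_iff image_iff mem_Collect_eq)
  also have "\<dots> = (\<lambda>i. if Suc i < b - a then {z (a + i), z (Suc (a + i))} else {z (b - 1), z a}) ` {..<b - a}"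
    by (intro image_cong refl eq) simp
  also have "\<dots> = insert {z (b - 1), z a} {{z t, z (Suc t)} |t. a \<le> t \<and> Suc t < b}"
  proof (intro equalityI subsetI)
    fix e assume "e \<in> insert {z (b - 1), z a} {{z t, z (Suc t)} |t. a \<le> t \<and> Suc t < b}"
    then consider "e = {z (b - 1), z a}" | t where "e = {z t, z (Suc t)}" "a \<le> t" "Suc t < b" by blast
    then show "e \<in> (\<lambda>i. if Suc i < b - a then {z (a + i), z (Suc (a + i))} else {z (b - 1), z a}) ` {..<b - a}"
    proof cases
      case 1
      then show ?thesis using assms by (intro image_eqI[of _ _ "b - a - 1"]) auto
    next
      case 2
      then show ?thesis by (intro image_eqI[of _ _ "t - a"]) auto
    qed
  qed (auto split: if_splits)
  finally show ?thesis .
qed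

lemma path_edges_append:
  assumes "p \<noteq> []" "q \<noteq> []" "last p = hd q"
  shows "path_edges (p @ tl q) = path_edges p \<union> path_edges q"
proof -
  obtain n where n: "length p = Suc n" using assms(1) by (cases p) auto
  have nth: "(p @ tl q) ! (n + i) = q ! i" if "i < length q" for i
    using that assms n by (cases i) (auto simp: nth_append last_conv_nth hd_conv_nth nth_tl)
  have len: "length (p @ tl q) = n + length q" using n assms(2) by (cases q) auto
  have "e \<in> path_edges (p @ tl q) \<longleftrightarrow> e \<in> path_edges p \<union> path_edges q" for e
  proof
    assume "e \<in> path_edges (p @ tl q)"
    then obtain i where i: "e = {(p @ tl q) ! i, (p @ tl q) ! Suc i}" "Suc i < n + length q"
      unfolding path_edges_def len by blast
    show "e \<in> path_edges p \<union> path_edges q"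
    proof (cases "i < n")
      case True
      then show ?thesis using i n by (auto simp: path_edges_def nth_append)
    next
      case False
      then have "e = {q ! (i - n), q ! Suc (i - n)}" "Suc (i - n) < length q"
        using i nth[of "i - n"] nth[of "Suc (i - n)"] by auto
      then show ?thesis by (auto simp: path_edges_def)
    qed
  next
    assume "e \<in> path_edges p \<union> path_edges q"
    then consider i where "e = {p ! i, p ! Suc i}" "Suc i < length p" | i where "e = {q ! i, q ! Suc i}" "Suc i < length q"
      by (auto simp: path_edges_def)
    then show "e \<in> path_edges (p @ tl q)"
    proof cases
      case 1
      moreover have "length q > 0" using assms(2) by simp
      then have "Suc i < n + length q" using 1 n by linarith
      ultimately show ?thesis unfolding path_edges_def len by (intro CollectI exI[of _ i]) (auto simp: nth_append n)
    next
      case 2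
      then show ?thesis
        unfolding path_edges_def len using nth[of i] nth[of "Suc i"] by (intro CollectI exI[of _ "n + i"]) auto
    qed
  qed
  then show ?thesis by blast
qed

lemma path_edges_rev: "path_edges (rev p) = path_edges p"
proof -
  have "path_edges (rev p) \<subseteq> path_edges p" for p :: "'v list"
  proof
    fix e assume "e \<in> path_edges (rev p)"
    then obtain i where i: "e = {rev p ! i, rev p ! Suc i}" "Suc i < length p" by (auto simp: path_edges_def)
    then show "e \<in> path_edges p"
      unfolding path_edges_def by (intro CollectI exI[of _ "length p - Suc (Suc i)"]) (auto simp: rev_nth Suc_diff_Suc)
  qed
  from this[of p] this[of "rev p"] show ?thesis by simp
qed

lemma path_edges_subset: "e \<in> path_edges p \<Longrightarrow> e \<subseteq> set p"
  by (auto simp: path_edges_def)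

lemma cycle_edges_subset: "e \<in> cycle_edges c \<Longrightarrow> e \<subseteq> set c"
proof -
  assume "e \<in> cycle_edges c"
  then obtain i where "i < length c" "e = {c ! i, c ! (Suc i mod length c)}" by (auto simp: cycle_edges_def)
  moreover from this have "Suc i mod length c < length c" by (intro mod_less_divisor) auto
  ultimately show ?thesis by simp
qed

section \<open>Shortest walks inside a vertex set\<close>

context finite_graph
begin

lemma no_loop [simp]: "{x} \<notin> E"
  using edgeD[of x x] by auto

definition walk_in :: "'v set \<Rightarrow> nat \<Rightarrow> (nat \<Rightarrow> 'v) \<Rightarrow> bool" where
  "walk_in S n z \<longleftrightarrow> (\<forall>t<n. {z t, z (Suc t)} \<in> E) \<and> (\<forall>t\<le>n. z t \<in> S)"

text \<open>Only the existence of a walk of a given length is recorded; the shortest-walk arguments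
  glue segments and compare lengths and parities.\<close>

definition joined :: "'v set \<Rightarrow> nat \<Rightarrow> 'v \<Rightarrow> 'v \<Rightarrow> bool" where
  "joined S n x y \<longleftrightarrow> (\<exists>z. walk_in S n z \<and> z 0 = x \<and> z n = y)"

lemma joined_segment:
  assumes "walk_in S n z" "i \<le> j" "j \<le> n"
  shows "joined S (j - i) (z i) (z j)"
  unfolding joined_def
  by (rule exI[of _ "\<lambda>t. z (i + t)"]) (use assms in \<open>auto simp: walk_in_def\<close>)

lemma joined_sym:
  assumes "joined S n x y"
  shows "joined S n y x"
proof -
  obtain z where z: "walk_in S n z" "z 0 = x" "z n = y" using assms by (auto simp: joined_def)
  have "{z (n - t), z (n - Suc t)} \<in> E" if "t < n" for t
  proof -
    have "{z (n - Suc t), z (Suc (n - Suc t))} \<in> E" using z(1) that by (auto simp: walk_in_def)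
    then show ?thesis using that by (simp add: Suc_diff_Suc insert_commute)
  qed
  then show ?thesis
    using z unfolding joined_def by (intro exI[of _ "\<lambda>t. z (n - t)"]) (auto simp: walk_in_def)
qed

lemma joined_trans:
  assumes "joined S m x y" "joined S n y v"
  shows "joined S (m + n) x v"
proof -
  obtain z where z: "walk_in S m z" "z 0 = x" "z m = y" using assms(1) by (auto simp: joined_def)
  obtain z' where z': "walk_in S n z'" "z' 0 = y" "z' n = v" using assms(2) by (auto simp: joined_def)
  let ?z = "\<lambda>t. if t \<le> m then z t else z' (t - m)"
  have "{?z t, ?z (Suc t)} \<in> E" if "t < m + n" for t
  proof -
    consider "t < m" | "t = m" "0 < n" | "t > m" using \<open>t < m + n\<close> by (cases t m rule: linorder_cases) auto
    then show ?thesis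
    proof cases
      case 2
      then have "{z' 0, z' (Suc 0)} \<in> E" using z'(1) by (auto simp: walk_in_def)
      then show ?thesis using 2 z(3) z'(2) by simp
    next
      case 3
      then have "{z' (t - m), z' (Suc (t - m))} \<in> E" using z'(1) that by (auto simp: walk_in_def)
      then show ?thesis using 3 by (simp add: Suc_diff_le)
    qed (use z(1) in \<open>auto simp: walk_in_def\<close>)
  qed
  then have "walk_in S (m + n) ?z" using z(1) z'(1) by (auto simp: walk_in_def)
  then show ?thesis
    unfolding joined_def using z z' by (intro exI[of _ ?z]) auto
qed

lemma joined_edge:
  assumes "{x, y} \<in> E" "x \<in> S" "y \<in> S"
  shows "joined S 1 x y"
  unfolding joined_def
  by (rule exI[of _ "\<lambda>t. if t = 0 then x else y"]) (use assms in \<open>auto simp: walk_in_def\<close>)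

lemma walk_in_vertices: "walk_in S n z \<Longrightarrow> n > 0 \<Longrightarrow> t \<le> n \<Longrightarrow> z t \<in> V"
  unfolding walk_in_def using edgeD by (metis Suc_pred not_gr0 order_le_less zero_less_Suc lessI)

text \<open>On a shortest walk a repeated vertex or a chord would give a shorter walk.\<close>

lemma induced_path:
  assumes "joined S n x y" "x \<noteq> y"
  obtains r where "is_path V E r" "hd r = x" "last r = y" "set r \<subseteq> S" "induced_edges E (set r) = path_edges r"
proof -
  obtain n where n: "joined S n x y" "\<And>n'. joined S n' x y \<Longrightarrow> n \<le> n'"
    using assms(1) ex_has_least_nat[of "\<lambda>n. joined S n x y" n "\<lambda>n. n"] by blast
  then obtain z where z: "walk_in S n z" "z 0 = x" "z n = y" by (auto simp: joined_def)
  have "n > 0" using z assms(2) by (cases n) auto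
  have edges: "{z t, z (Suc t)} \<in> E" if "t < n" for t using z(1) that by (simp add: walk_in_def)
  have seg: "joined S i x (z i)" "joined S (n - i) (z i) y" if "i \<le> n" for i
    using joined_segment[OF z(1), of 0 i] joined_segment[OF z(1), of i n] that z by auto
  have neq: "z i \<noteq> z j" if "i < j" "j \<le> n" for i j
  proof
    assume "z i = z j"
    then have "joined S (i + (n - j)) x y" using seg(1)[of i] seg(2)[of j] that \<open>z i = z j\<close>
      by (intro joined_trans[of S i x "z i"]) auto
    then show False using n(2) that by fastforce
  qed
  have chord: "j = Suc i" if "i < j" "j \<le> n" "{z i, z j} \<in> E" for i j
  proof -
    have "joined S 1 (z i) (z j)"
      using z(1) that by (intro joined_edge) (auto simp: walk_in_def)
    then have "joined S (i + 1 + (n - j)) x y"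
      using seg(1)[of i] seg(2)[of j] that(1,2) by (intro joined_trans[of S "i + 1" x "z j"] joined_trans[of S i x "z i"]) auto
    then show ?thesis using n(2) that by fastforce
  qed
  define r where "r = map z [0..<Suc n]"
  have set_r: "set r = z ` {..n}" by (simp add: r_def atLeast0LessThan lessThan_Suc_atMost del: upt_Suc)
  have pe: "path_edges r = {{z t, z (Suc t)} |t. t < n}" unfolding r_def path_edges_map by auto
  have "distinct r" unfolding r_def distinct_map using neq by (auto intro!: linorder_inj_onI' simp del: upt_Suc)
  show ?thesis
  proof
    show "is_path V E r" using \<open>distinct r\<close> walk_in_vertices[OF z(1) \<open>n > 0\<close>] edges
      unfolding is_path_def pe set_r by (auto simp: r_def)
    show "hd r = x" "last r = y" using z by (auto simp: r_def hd_map last_map simp del: upt_Suc)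
    show "set r \<subseteq> S" using z(1) by (auto simp: set_r walk_in_def)
    show "induced_edges E (set r) = path_edges r"
    proof (intro equalityI subsetI)
      fix e assume "e \<in> induced_edges E (set r)"
      then have e: "e \<in> E" "e \<subseteq> z ` {..n}" by (auto simp: induced_edges_def set_r)
      then obtain a b where ab: "e = {a, b}" "a \<noteq> b" by (elim edgeE)
      then obtain i j where ij: "a = z i" "b = z j" "i \<le> n" "j \<le> n" using e(2) by auto
      then have "i \<noteq> j" using ab by auto
      then show "e \<in> path_edges r"
        using chord[of i j] chord[of j i] e(1) ij unfolding ab pe
        by (cases i j rule: linorder_cases) (auto simp: insert_commute)
    qed (use edges in \<open>auto simp: induced_edges_def pe set_r\<close>)
  qed
qed

text \<open>A shortest odd closed walk at \<open>x\<close> that runs back along its own beginning for as long as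
  possible consists of a path to an odd cycle, and has no further chords.\<close>

lemma induced_lollipop:
  assumes "joined S n x x" "odd n"
  obtains c q where "odd_cycle V E c" "is_path V E q" "hd q = x" "set q \<inter> set c = {last q}"
    "set c \<union> set q \<subseteq> S" "induced_edges E (set c \<union> set q) = cycle_edges c \<union> path_edges q"
proof -
  obtain n where n: "joined S n x x" "odd n" "\<And>n'. joined S n' x x \<Longrightarrow> odd n' \<Longrightarrow> n \<le> n'"
    using assms ex_has_least_nat[of "\<lambda>n. joined S n x x \<and> odd n" n "\<lambda>n. n"] by blast
  then obtain m where m: "n = 2 * m + 1" by (auto elim: oddE)
  \<comment> \<open>The last \<open>r\<close> steps retrace the first \<open>r\<close> backwards;
    the largest such \<open>r\<close> becomes the length of the stick.\<close>
  define P where "P z r \<longleftrightarrow> walk_in S n z \<and> z 0 = x \<and> z n = x \<and> r \<le> m \<and> (\<forall>i\<le>r. z (n - i) = z i)" for z r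
  obtain z0 where "P z0 0" using n(1) by (auto simp: joined_def P_def)
  then have ex: "\<exists>r z. P z r" by blast
  have bnd: "\<forall>r. (\<exists>z. P z r) \<longrightarrow> r \<le> m" by (auto simp: P_def)
  obtain r where "\<exists>z. P z r" and rmax: "\<And>z' r'. P z' r' \<Longrightarrow> r' \<le> r"
    using Greatest_le_nat[of "\<lambda>r. \<exists>z. P z r" _ m] GreatestI_ex_nat[of "\<lambda>r. \<exists>z. P z r" m] ex bnd by blast
  then obtain z where Pz: "P z r" by blast
  then have z: "walk_in S n z" "z 0 = x" "z n = x" "r \<le> m" "\<And>i. i \<le> r \<Longrightarrow> z (n - i) = z i"
    by (auto simp: P_def)
  have edges: "{z t, z (Suc t)} \<in> E" if "t < n" for t using z(1) that by (simp add: walk_in_def)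
  have inS: "z t \<in> S" if "t \<le> n" for t using z(1) that by (simp add: walk_in_def)
  have seg: "joined S i x (z i)" "joined S i (z i) x" "joined S (n - i) (z i) x" "joined S (n - i) x (z i)" if "i \<le> n" for i
    using joined_segment[OF z(1), of 0 i] joined_segment[OF z(1), of i n] that z by (auto intro: joined_sym)
  \<comment> \<open>For \<open>i + j\<close> even, cutting out the segment leaves a shorter odd
    closed walk at \<open>x\<close>. For \<open>i + j\<close> odd, the two initial segments and the
    two final segments both form odd closed walks at \<open>x\<close>, of total length
    \<open>2 * n\<close>, so both have length exactly \<open>n\<close>.\<close>
  have eq: "i + j = n" if "i < j" "j \<le> n" "z i = z j" "(i, j) \<noteq> (0, n)" for i j
  proof -
    note s = seg[of i] seg[of j, folded that(3)]
    have "joined S (i + (n - j)) x x"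
      by (rule joined_trans[OF s(1) s(7)]) (use that in auto)
    moreover have "joined S (i + j) x x"
      by (rule joined_trans[OF s(1) s(6)]) (use that in auto)
    moreover have "joined S ((n - i) + (n - j)) x x"
      by (rule joined_trans[OF s(4) s(7)]) (use that in auto)
    ultimately have "odd (i + (n - j)) \<longrightarrow> n \<le> i + (n - j)" "odd (i + j) \<longrightarrow> n \<le> i + j"
      "odd ((n - i) + (n - j)) \<longrightarrow> n \<le> (n - i) + (n - j)"
      using n(3) by blast+
    moreover have "even (i + j) \<Longrightarrow> odd (i + (n - j))" "odd (i + j) \<Longrightarrow> odd ((n - i) + (n - j))"
      using that(1,2) n(2) by auto
    ultimately show ?thesis using that(1,2) by (cases "even (i + j)") auto
  qed
  \<comment> \<open>The same three closed walks, each with the chord inserted; the parity of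
    \<open>i + j\<close> leaves only the two even values next to \<open>n\<close>.\<close>
  have chord: "j = Suc i \<or> i + j = 2 * m \<or> i + j = 2 * m + 2" if "i < j" "j \<le> n" "{z i, z j} \<in> E" for i j
  proof -
    note s = seg[of i] seg[of j]
    have e: "joined S 1 (z i) (z j)" using that by (intro joined_edge inS) auto
    have "joined S (i + 1 + (n - j)) x x"
      by (rule joined_trans[OF joined_trans[OF s(1) e] s(7)]) (use that in auto)
    moreover have "joined S (i + 1 + j) x x"
      by (rule joined_trans[OF joined_trans[OF s(1) e] s(6)]) (use that in auto)
    moreover have "joined S ((n - i) + 1 + (n - j)) x x"
      by (rule joined_trans[OF joined_trans[OF s(4) e] s(7)]) (use that in auto)
    ultimately have "odd (i + 1 + (n - j)) \<longrightarrow> n \<le> i + 1 + (n - j)" "odd (i + 1 + j) \<longrightarrow> n \<le> i + 1 + j"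
      "odd ((n - i) + 1 + (n - j)) \<longrightarrow> n \<le> (n - i) + 1 + (n - j)"
      using n(3) by blast+
    moreover have "odd (i + j) \<Longrightarrow> odd (i + 1 + (n - j))" "even (i + j) \<Longrightarrow> odd ((n - i) + 1 + (n - j))"
      using that(1,2) n(2) by auto
    ultimately have "j = Suc i \<or> even (i + j) \<and> n \<le> i + 1 + j \<and> i + j \<le> n + 1"
      using that(1,2) by (cases "even (i + j)") auto
    moreover have "i + j = 2 * m \<or> i + j = 2 * m + 1 \<or> i + j = 2 * m + 2" if "n \<le> i + 1 + j" "i + j \<le> n + 1"
      using that unfolding m by linarith
    ultimately show ?thesis by (metis even_plus_one_iff dvd_triv_left)
  qed
  \<comment> \<open>If position \<open>2 * m - i\<close> is adjacent to the vertex at position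
    \<open>i\<close>, the walk may step there and return along its own beginning. The length stays
    \<open>n\<close> and \<open>i\<close> steps are retraced, so maximality of \<open>r\<close>
    applies.\<close>
  have sym: "i \<le> r" if "P z' r" "i < m" "{z' (2 * m - i), z' i} \<in> E" for z' i
  proof (rule rmax)
    let ?z = "\<lambda>t. if t \<le> 2 * m - i then z' t else z' (n - t)"
    have w: "walk_in S n z'" "z' 0 = x" "z' n = x" using that(1) by (auto simp: P_def)
    have e: "{?z t, ?z (Suc t)} \<in> E" if "t < n" for t
    proof -
      consider "t < 2 * m - i" | "t = 2 * m - i" | "t > 2 * m - i" by (cases t "2 * m - i" rule: linorder_cases) auto
      then show ?thesis
      proof cases
        case 2
        then show ?thesis using \<open>i < m\<close> \<open>{z' (2 * m - i), z' i} \<in> E\<close> by (simp add: m Suc_diff_le)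
      next
        case 3
        have "{z' (n - Suc t), z' (Suc (n - Suc t))} \<in> E" using w(1) that by (auto simp: walk_in_def)
        then show ?thesis using 3 that by (simp add: Suc_diff_Suc insert_commute)
      qed (use w(1) that in \<open>auto simp: walk_in_def\<close>)
    qed
    show "P ?z i" unfolding P_def
      using w that(2) e by (auto simp: walk_in_def m)
  qed
  have rm: "r < m"
  proof (rule ccontr)
    assume "\<not> r < m"
    then have "r = m" using z(4) by simp
    then have "z (n - m) = z m" using z(5) by blast
    moreover have "{z m, z (Suc m)} \<in> E" by (rule edges) (simp add: m)
    ultimately show False by (auto simp: m)
  qed
  \<comment> \<open>The part that is not retraced is the cycle, of odd length
    \<open>n - 2 * r\<close>, hooked to the stick at position \<open>r\<close>.\<close>
  define c where "c = map z [r..<n - r]"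
  define q where "q = map z [0..<Suc r]"
  have set_c: "set c = z ` {r..<n - r}" and set_q: "set q = z ` {..r}"
    by (simp_all add: c_def q_def atLeast0LessThan lessThan_Suc_atMost del: upt_Suc)
  have closing: "{z (n - r - 1), z r} \<in> E"
    using edges[of "n - r - 1"] z(5)[of r] rm m by (simp add: Suc_diff_le)
  have ce: "cycle_edges c = insert {z (n - r - 1), z r} {{z t, z (Suc t)} |t. r \<le> t \<and> Suc t < n - r}"
    unfolding c_def by (rule cycle_edges_map) (use rm m in simp)
  have pe: "path_edges q = {{z t, z (Suc t)} |t. t < r}" unfolding q_def path_edges_map by auto
  have neq: "z i \<noteq> z j" if "i < j" "j < n - r" for i j
  proof
    assume "z i = z j"
    moreover have "j < n" using that by simp
    ultimately have ij: "i + j = n" using eq[of i j] that by simp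
    then have "i > r" "i \<le> m" "j = n - i" using that m by auto
    moreover have "i < m"
    proof (rule ccontr)
      assume "\<not> i < m"
      then have "i = m" "j = Suc m" using \<open>i \<le> m\<close> ij m by auto
      then show False using edges[of m] \<open>z i = z j\<close> m by auto
    qed
    moreover have "{z (2 * m - i), z i} \<in> E"
      using edges[of "2 * m - i"] \<open>z i = z j\<close> \<open>j = n - i\<close> \<open>i < m\<close> m by (simp add: Suc_diff_le)
    ultimately show False using sym[OF Pz] by fastforce
  qed
  have zV: "z t \<in> V" if "t \<le> n" for t using walk_in_vertices[OF z(1)] that m by simp
  \<comment> \<open>Reversing the walk turns chords with \<open>i + j = 2 * m + 2\<close> into
    chords with sum \<open>2 * m\<close>, to which \<open>sym\<close> applies.\<close>
  have Prev: "P (\<lambda>t. z (n - t)) r"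
  proof -
    have "{z (n - t), z (n - Suc t)} \<in> E" if "t < n" for t
      using edges[of "n - Suc t"] that by (simp add: Suc_diff_Suc insert_commute)
    then show ?thesis using z rm inS unfolding P_def walk_in_def by (auto simp: m)
  qed
  have inj: "inj_on z {..<n - r}" using neq by (auto intro!: linorder_inj_onI')
  show ?thesis
  proof
    have "distinct c" unfolding c_def distinct_map by (auto intro: inj_on_subset[OF inj])
    moreover have "cycle_edges c \<subseteq> E" unfolding ce using closing edges by auto
    ultimately show "odd_cycle V E c" using rm zV unfolding odd_cycle_def is_cycle_def set_c
      by (auto simp: c_def m)
    have "distinct q" unfolding q_def distinct_map using rm m
      by (intro conjI inj_on_subset[OF inj]) auto
    moreover have "path_edges q \<subseteq> E" unfolding pe using edges rm m by auto
    ultimately show "is_path V E q" using rm zV unfolding is_path_def set_q by (auto simp: q_def m)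
    show "hd q = x" using z by (simp add: q_def hd_map del: upt_Suc)
    have "last q = z r" by (simp add: q_def)
    moreover have "i = r" if "i \<le> r" "r \<le> j" "j < n - r" "z i = z j" for i j
      using neq[of i j] that by (cases "i = j") auto
    ultimately show "set q \<inter> set c = {last q}"
      unfolding set_q set_c using rm m by fastforce
    show "set c \<union> set q \<subseteq> S" using inS rm m by (auto simp: set_c set_q)
    have "{r..<n - r} \<union> {..r} = {..<n - r}" using rm m by auto
    then have un: "set c \<union> set q = z ` {..<n - r}" unfolding set_c set_q by (simp flip: image_Un)
    show "induced_edges E (set c \<union> set q) = cycle_edges c \<union> path_edges q"
    proof (intro equalityI subsetI)
      fix e assume "e \<in> induced_edges E (set c \<union> set q)"
      then have e: "e \<in> E" "e \<subseteq> z ` {..<n - r}" by (auto simp: induced_edges_def un)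
      have main: "{z i, z j} \<in> cycle_edges c \<union> path_edges q" if "i < j" "j < n - r" "{z i, z j} \<in> E" for i j
      proof -
        have "j = Suc i \<or> i + j = 2 * m \<or> i + j = 2 * m + 2" using chord[of i j] that by simp
        then consider "j = Suc i" | "i + j = 2 * m" | "i + j = 2 * m + 2" by blast
        then show ?thesis
        proof cases
          case 1
          then show ?thesis unfolding ce pe using that by (cases "i < r") auto
        next
          case 2
          then have "2 * m - i = j" "i < m" using that by auto
          then have "i \<le> r" using sym[OF Pz, of i] that by (simp add: insert_commute)
          then have "i = r" "j = n - r - 1" using 2 that m by auto
          then show ?thesis unfolding ce by (auto simp: insert_commute)
        next
          case 3
          then have "i > 0" using that m by linarith
          then have "n - (2 * m - (i - 1)) = i" "n - (i - 1) = j" "i - 1 < m" using 3 that m by auto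
          then have "i - 1 \<le> r" using sym[OF Prev, of "i - 1"] that by simp
          then show ?thesis using 3 that m by auto
        qed
      qed
      obtain a b where ab: "e = {a, b}" "a \<noteq> b" using e(1) by (elim edgeE)
      then obtain i j where ij: "a = z i" "b = z j" "i < n - r" "j < n - r" using e(2) by auto
      then have "i \<noteq> j" using ab by auto
      then show "e \<in> cycle_edges c \<union> path_edges q"
        using main[of i j] main[of j i] e(1) ij unfolding ab
        by (cases i j rule: linorder_cases) (auto simp: insert_commute)
    next
      fix e assume "e \<in> cycle_edges c \<union> path_edges q"
      then show "e \<in> induced_edges E (set c \<union> set q)"
        unfolding induced_edges_def un ce pe using closing edges rm m by auto
    qed
  qed
qed

end

context finite_graph
begin

text \<open>By \<open>sep\<close> the induced edges of the union are those of the three pieces,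
  which are known. The stick \<open>q\<close> starts at the junction with \<open>r\<close>, so it is
  reversed to let the joined path start on the cycle \<open>c\<close>.\<close>

lemma glue_lollipops:
  assumes c: "odd_cycle V E c" "odd_cycle V E c'" and p: "is_path V E q" "is_path V E r" "is_path V E q'"
    and hooks: "set q \<inter> set c = {last q}" "set q' \<inter> set c' = {last q'}" "hd r = hd q" "last r = hd q'"
    and ind: "induced_edges E (set c \<union> set q) = cycle_edges c \<union> path_edges q"
      "induced_edges E (set r) = path_edges r"
      "induced_edges E (set c' \<union> set q') = cycle_edges c' \<union> path_edges q'"
    and disj: "(set c \<union> set q) \<inter> set r = {hd q}" "(set c' \<union> set q') \<inter> set r = {hd q'}"
      "(set c \<union> set q) \<inter> (set c' \<union> set q') = {}"
    and sep: "\<And>e. e \<in> E \<Longrightarrow> e \<subseteq> (set c \<union> set q) \<union> set r \<union> (set c' \<union> set q') \<Longrightarrow>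
      e \<subseteq> set c \<union> set q \<or> e \<subseteq> set r \<or> e \<subseteq> set c' \<union> set q'"
    and len: "3 \<le> length r"
  shows "induced_cycles_joined_by_path V E c c' ((rev q @ tl r) @ tl q')"
proof -
  define p where "p = (rev q @ tl r) @ tl q'"
  have ne: "q \<noteq> []" "r \<noteq> []" "q' \<noteq> []" and dist: "distinct q" "distinct r" "distinct q'"
    using p by (auto simp: is_path_def)
  have tl: "set (tl xs) = set xs - {hd xs}" "set xs = insert (hd xs) (set (tl xs))" if "xs \<noteq> []" "distinct xs" for xs :: "'v list"
    using that by (cases xs; auto)+
  have tl_r: "tl r \<noteq> []" using len by (cases r) auto
  have last_qr: "last (rev q @ tl r) = hd q'" using tl_r hooks(4) by (simp add: last_tl)
  have pe: "path_edges p = path_edges q \<union> path_edges r \<union> path_edges q'"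
    unfolding p_def using ne last_qr hooks(3) path_edges_append[of "rev q @ tl r" q'] path_edges_append[of "rev q" r]
    by (simp add: path_edges_rev last_rev)
  have hds: "hd q \<in> set q" "hd r \<in> set r" "last r \<in> set r" "hd q' \<in> set q'" using ne by auto
  have set_p: "set p = set q \<union> set r \<union> set q'"
    using hds ne dist hooks(3,4) unfolding p_def by (auto simp: tl(1))
  have "distinct p"
    using dist ne hds disj unfolding p_def by (auto simp: tl(1) distinct_tl hooks(3))
  moreover have "set p \<subseteq> V" "path_edges p \<subseteq> E" "p \<noteq> []"
    using p unfolding set_p pe by (auto simp: is_path_def p_def)
  ultimately have "is_path V E p" by (simp add: is_path_def)
  moreover have "3 \<le> length p" using len ne by (cases q) (auto simp: p_def)
  moreover have "hd p = last q" unfolding p_def using ne by (simp add: hd_rev)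
  moreover have "set p \<inter> set c = {last q}"
  proof -
    have "set r \<inter> set c \<subseteq> (set c \<union> set q) \<inter> set r" by blast
    then have "set r \<inter> set c \<subseteq> set q" unfolding disj(1) using hds by blast
    moreover have "set q' \<inter> set c = {}" using disj(3) by blast
    ultimately have "set p \<inter> set c = set q \<inter> set c" unfolding set_p by blast
    then show ?thesis using hooks(1) by simp
  qed
  moreover have "last p = last q'"
  proof (cases "tl q' = []")
    case True
    then have "q' = [hd q']" using ne(3) by (cases q') auto
    then have "last q' = hd q'" by (metis last.simps)
    then show ?thesis using True last_qr by (simp add: p_def)
  qed (simp add: p_def last_tl)
  moreover have "set p \<inter> set c' = {last q'}"
  proof -
    have "set r \<inter> set c' \<subseteq> (set c' \<union> set q') \<inter> set r" by blast
    then have "set r \<inter> set c' \<subseteq> set q'" unfolding disj(2) using hds by blast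
    moreover have "set q \<inter> set c' = {}" using disj(3) by blast
    ultimately have "set p \<inter> set c' = set q' \<inter> set c'" unfolding set_p by blast
    then show ?thesis using hooks(2) by simp
  qed
  moreover have "induced_edges E (set c \<union> set c' \<union> set p) = cycle_edges c \<union> cycle_edges c' \<union> path_edges p"
  proof -
    have "set c \<union> set c' \<union> set p = (set c \<union> set q) \<union> set r \<union> (set c' \<union> set q')" unfolding set_p by auto
    then have "induced_edges E (set c \<union> set c' \<union> set p) =
        induced_edges E (set c \<union> set q) \<union> induced_edges E (set r) \<union> induced_edges E (set c' \<union> set q')"
      using sep by (auto simp: induced_edges_def)
    then show ?thesis unfolding pe ind by auto
  qed
  ultimately show ?thesis
    using c disj(3) unfolding induced_cycles_joined_by_path_def p_def[symmetric] by (simp add: Int_Un_distrib Int_Un_distrib2)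
qed

text \<open>Two odd closed walks of lengths \<open>a\<close> and \<open>b\<close>, joined by a path of length \<open>l\<close> that is
  traversed in both directions.\<close>

definition dumbbell :: "(nat \<Rightarrow> 'v) \<Rightarrow> nat \<Rightarrow> nat \<Rightarrow> nat \<Rightarrow> bool" where
  "dumbbell w a l b \<longleftrightarrow> odd a \<and> odd b \<and> 3 \<le> a \<and> 3 \<le> b \<and> (\<forall>t<a + l + b. {w t, w (Suc t)} \<in> E) \<and>
     w a = w 0 \<and> inj_on w {1..<a + l + b} \<and> (\<forall>t\<le>l. w (a + l + b + t) = w (a + l - t))"

end

section \<open>Walks without a shortcut\<close>

text \<open>The walk is periodic on all natural numbers, so any position may serve as its start. All
  restrictions on returns and chords are drawn from \<open>not_conn\<close>.\<close>

locale rigid_walk = finite_graph V E for V :: "'v set" and E +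
  fixes w :: "nat \<Rightarrow> 'v" and k :: nat
  assumes edge: "{w t, w (Suc t)} \<in> E" and period: "w (t + 2 * k) = w t" and k_pos: "k > 0"
    and not_conn: "\<not> fibre_conn E rho (alt w True 0 (2 * k)) (alt w False 0 (2 * k))"
begin

lemma alt_period: "alt w b i (i + 2 * k) = alt w b 0 (2 * k)"
proof (induction i)
  case (Suc i)
  have "alt w b i (Suc i) + alt w b (Suc i) (Suc i + 2 * k) = alt w b i (i + 2 * k) + alt w b (i + 2 * k) (Suc (i + 2 * k))"
    using alt_split[of i "Suc i" "Suc (i + 2 * k)" w b] alt_split[of i "i + 2 * k" "Suc (i + 2 * k)" w b]
    by (simp del: alt_one)
  moreover have "alt w b (i + 2 * k) (Suc (i + 2 * k)) = alt w b i (Suc i)"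
    using period[of "Suc i"] by (simp add: period)
  ultimately have "alt w b (Suc i) (Suc i + 2 * k) = alt w b i (i + 2 * k)"
    by (metis add.commute add_left_cancel)
  then show ?case using Suc by simp
qed simp

lemma alt_halves:
  assumes "i \<le> j" "j \<le> i + 2 * k"
  shows "alt w b 0 (2 * k) = alt w b i j + alt w b j (i + 2 * k)"
  using alt_split[OF assms, of w b] alt_period[of b i] by simp

lemma keys_alt_period:
  assumes "i \<le> j" "j \<le> i + 2 * k"
  shows "Poly_Mapping.keys (alt w b i j) \<subseteq> Poly_Mapping.keys (alt w b 0 (2 * k))"
    "Poly_Mapping.keys (alt w b j (i + 2 * k)) \<subseteq> Poly_Mapping.keys (alt w b 0 (2 * k))"
  using alt_halves[OF assms, of b] by (simp_all add: keys_monomial_add)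

lemma keys_alt_E: "Poly_Mapping.keys (alt w b i j) \<subseteq> E"
  by (rule keys_alt_subset) (rule edge)

lemma dg_diff:
  "i \<le> j \<Longrightarrow> dg (alt w True i j) x - dg (alt w False i j) x = (-1) ^ i * of_bool (x = w i) - (-1) ^ j * of_bool (x = w j)"
  by (rule dg_alt_diff) (auto intro: edge)

lemma dg_balanced: "dg (alt w True 0 (2 * k)) x = dg (alt w False 0 (2 * k)) x"
  using dg_diff[of 0 "2 * k" x] period[of 0] by simp

text \<open>The exclusions below each construct such a monomial \<open>m\<close>, which would link
  the two sides in two steps.\<close>

lemma no_bridge:
  assumes "Poly_Mapping.keys m \<subseteq> E" "\<And>x. dg m x = dg (alt w True 0 (2 * k)) x"
    and "Poly_Mapping.keys (alt w True 0 (2 * k)) \<inter> Poly_Mapping.keys m \<noteq> {}"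
    and "Poly_Mapping.keys (alt w False 0 (2 * k)) \<inter> Poly_Mapping.keys m \<noteq> {}"
  shows False
proof -
  have "fibre_step E rho (alt w True 0 (2 * k)) m"
    using assms keys_alt_E by (auto simp: fibre_step_def lexp_eq_iff)
  moreover have "fibre_step E rho m (alt w False 0 (2 * k))"
    using assms keys_alt_E dg_balanced unfolding fibre_step_def lexp_eq_iff by auto
  ultimately show False using not_conn by (meson converse_rtranclp_into_rtranclp r_into_rtranclp)
qed

text \<open>An even return cuts the walk into two even closed walks; exchanging the sides on just
  one of them gives a monomial that shares an edge with either side.\<close>

lemma no_even_return:
  assumes "i < j" "j < i + 2 * k" "even (j - i)"
  shows "w i \<noteq> w j"
proof
  assume eq: "w i = w j"
  have par: "even i \<longleftrightarrow> even j" using assms by auto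
  then have len: "i + 2 \<le> j" "j + 2 \<le> i + 2 * k" using assms by presburger+
  have d: "dg (alt w True i j) x = dg (alt w False i j) x" for x
    using dg_diff[of i j x] assms(1) eq par by (cases "even i") auto
  show False
  proof (rule no_bridge)
    let ?m = "alt w False i j + alt w True j (i + 2 * k)"
    show "Poly_Mapping.keys ?m \<subseteq> E" using keys_alt_E by (simp add: keys_monomial_add)
    show "dg ?m x = dg (alt w True 0 (2 * k)) x" for x
      using assms d by (simp add: alt_halves[of i j] dg_add)
    show "Poly_Mapping.keys (alt w True 0 (2 * k)) \<inter> Poly_Mapping.keys ?m \<noteq> {}"
      using keys_alt_period(2)[OF less_imp_le[OF assms(1)] less_imp_le[OF assms(2)], of True] alt_nonempty[OF len(2), of w True]
      unfolding keys_monomial_add by blast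
    show "Poly_Mapping.keys (alt w False 0 (2 * k)) \<inter> Poly_Mapping.keys ?m \<noteq> {}"
      using keys_alt_period(1)[OF less_imp_le[OF assms(1)] less_imp_le[OF assms(2)], of False] alt_nonempty[OF len(1), of w False]
      unfolding keys_monomial_add by blast
  qed
qed

text \<open>On the arc from \<open>i\<close> to \<open>j\<close> the edges of the parity of
  \<open>i\<close> cover the same vertex visits as those of the other parity together with the
  chord. Replacing the former by the latter on this arc alone yields a bridge, provided neither arc
  is a single edge.\<close>

lemma no_odd_chord:
  assumes "i < j" "j < i + 2 * k" "odd (j - i)" "{w i, w j} \<in> E"
  shows "j = i + 1 \<or> j + 1 = i + 2 * k"
proof (rule ccontr)
  assume "\<not> ?thesis"
  then have len: "i + 2 \<le> j" "j + 2 \<le> i + 2 * k" using assms by auto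
  have par: "even i \<longleftrightarrow> odd j" using assms by auto
  let ?e = "Poly_Mapping.single {w i, w j} (Suc 0)"
  let ?m = "alt w (odd i) i j + ?e + alt w (even i) j (i + 2 * k)"
  show False
  proof (rule no_bridge)
    show "Poly_Mapping.keys ?m \<subseteq> E" using keys_alt_E assms(4) by (simp add: keys_monomial_add)
    have d: "dg (alt w (even i) i j) x = dg (alt w (odd i) i j + ?e) x" for x
      using dg_diff[of i j x] assms(1) par by (cases "even i") (auto simp: dg_add dg_edge[OF assms(4)])
    have "dg ?m x = dg (alt w (even i) 0 (2 * k)) x" for x
      using assms d[of x] by (simp add: alt_halves[of i j] dg_add)
    then show "dg ?m x = dg (alt w True 0 (2 * k)) x" for x
      using dg_balanced by (cases "even i") auto
    have "Poly_Mapping.keys (alt w (even i) 0 (2 * k)) \<inter> Poly_Mapping.keys ?m \<noteq> {}"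
      using keys_alt_period(2)[OF less_imp_le[OF assms(1)] less_imp_le[OF assms(2)], of "even i"] alt_nonempty[OF len(2), of w "even i"]
      unfolding keys_monomial_add by blast
    moreover have "Poly_Mapping.keys (alt w (odd i) 0 (2 * k)) \<inter> Poly_Mapping.keys ?m \<noteq> {}"
      using keys_alt_period(1)[OF less_imp_le[OF assms(1)] less_imp_le[OF assms(2)], of "odd i"] alt_nonempty[OF len(1), of w "odd i"]
      unfolding keys_monomial_add by blast
    ultimately show "Poly_Mapping.keys (alt w True 0 (2 * k)) \<inter> Poly_Mapping.keys ?m \<noteq> {}"
      "Poly_Mapping.keys (alt w False 0 (2 * k)) \<inter> Poly_Mapping.keys ?m \<noteq> {}"
      by (cases "even i"; simp)+
  qed
qed

text \<open>The alternating matching of an odd closed walk with one of its vertices removed.\<close>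

lemma odd_closed_walk_matching:
  assumes "w i = w j" "odd (j - i)" "i < s" "s < j"
  defines "m \<equiv> alt w (even s) i s + alt w (odd s) s j"
  shows "2 * dg m x + 2 * of_bool (x = w s) = dg (alt w True i j) x + dg (alt w False i j) x"
    and "Poly_Mapping.keys m \<inter> Poly_Mapping.keys (alt w (even i) i j) \<noteq> {}"
proof -
  have par: "even i \<longleftrightarrow> odd j" using assms by auto
  have split: "alt w b i j = alt w b i s + alt w b s j" for b
    using assms by (intro alt_split) auto
  show "2 * dg m x + 2 * of_bool (x = w s) = dg (alt w True i j) x + dg (alt w False i j) x"
    using dg_diff[of i s x] dg_diff[of s j x] assms(1,3,4) par unfolding m_def split dg_add
    by (cases "even s"; cases "even i") auto
  show "Poly_Mapping.keys m \<inter> Poly_Mapping.keys (alt w (even i) i j) \<noteq> {}"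
  proof (cases "even i = even s")
    case True
    then have "{w i, w (Suc i)} \<in> Poly_Mapping.keys (alt w (even s) i s)"
      unfolding keys_alt using assms by blast
    then show ?thesis using True unfolding split m_def keys_monomial_add by auto
  next
    case False
    have "{w (j - 1), w (Suc (j - 1))} \<in> Poly_Mapping.keys (alt w (odd s) s j)"
      unfolding keys_alt using assms par False by (intro CollectI exI[of _ "j - 1"]) auto
    moreover have "odd s = even i" using False by auto
    ultimately show ?thesis unfolding split m_def keys_monomial_add by auto
  qed
qed

text \<open>Both halves are odd closed walks. Omitting \<open>w s\<close> from one and
  \<open>w t\<close> from the other, matching the remaining visits alternately and adding the edge
  between \<open>w s\<close> and \<open>w t\<close> covers every visit once, as each side does. The
  two halves start with different parities, so the result meets both sides.\<close>

lemma no_cross_edge: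
  assumes "w i = w j" "odd (j - i)" "i < s" "s < j" "j < t" "t < i + 2 * k"
  shows "{w s, w t} \<notin> E"
proof
  assume e: "{w s, w t} \<in> E"
  have par: "even i \<longleftrightarrow> odd j" using assms by auto
  define m where "m = alt w (even s) i s + alt w (odd s) s j"
  define m' where "m' = alt w (even t) j t + alt w (odd t) t (i + 2 * k)"
  have j: "w j = w (i + 2 * k)" "odd (i + 2 * k - j)" using assms period[of i] by auto
  note m = odd_closed_walk_matching[OF assms(1-4), folded m_def]
  note m' = odd_closed_walk_matching[OF j assms(5,6), folded m'_def]
  have halves: "alt w b 0 (2 * k) = alt w b i j + alt w b j (i + 2 * k)" for b
    using assms by (intro alt_halves) auto
  let ?m = "Poly_Mapping.single {w s, w t} (Suc 0) + (m + m')"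
  show False
  proof (rule no_bridge)
    show "Poly_Mapping.keys ?m \<subseteq> E" using keys_alt_E e by (simp add: keys_monomial_add m_def m'_def)
    have "2 * dg ?m x = dg (alt w True 0 (2 * k)) x + dg (alt w False 0 (2 * k)) x" for x
      using m(1)[of x] m'(1)[of x] unfolding halves dg_add by (simp add: dg_edge[OF e])
    then show "dg ?m x = dg (alt w True 0 (2 * k)) x" for x
      using dg_balanced[of x] by (metis mult_2 mult_cancel_left zero_neq_numeral)
    have "Poly_Mapping.keys (alt w (even i) 0 (2 * k)) \<inter> Poly_Mapping.keys ?m \<noteq> {}"
      using m(2) unfolding halves keys_monomial_add by blast
    moreover have "Poly_Mapping.keys (alt w (odd i) 0 (2 * k)) \<inter> Poly_Mapping.keys ?m \<noteq> {}"
      using m'(2) par unfolding halves keys_monomial_add by simp blast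
    ultimately show "Poly_Mapping.keys (alt w True 0 (2 * k)) \<inter> Poly_Mapping.keys ?m \<noteq> {}"
      "Poly_Mapping.keys (alt w False 0 (2 * k)) \<inter> Poly_Mapping.keys ?m \<noteq> {}"
      by (cases "even i"; simp)+
  qed
qed

text \<open>A common vertex would be adjacent to its own neighbours in the second half, giving a
  cross edge. That half has odd length, so the successor or the predecessor of \<open>t\<close> lies
  strictly inside it.\<close>

lemma no_cross_vertex:
  assumes "w i = w j" "odd (j - i)" "i < s" "s < j" "j < t" "t < i + 2 * k"
  shows "w s \<noteq> w t"
proof
  assume eq: "w s = w t"
  show False
  proof (cases "Suc t < i + 2 * k")
    case True
    then show False using no_cross_edge[of i j s "Suc t"] assms edge[of t] eq by auto
  next
    case False
    have "j < t - 1" using False assms by presburger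
    then show False using no_cross_edge[of i j s "t - 1"] assms edge[of "t - 1"] eq by (auto simp: insert_commute)
  qed
qed

end

text \<open>A closed alternating trail supplies parts \<open>U\<close> of \<open>u\<close> and
  \<open>R\<close> of \<open>v\<close> with equal degrees. If a rest \<open>u'\<close> of
  \<open>u\<close> remained, then \<open>R + u'\<close> would share \<open>u'\<close> with
  \<open>u\<close> and \<open>R\<close> with \<open>v\<close> and link them; hence the trail
  exhausts both monomials.\<close>

lemma (in finite_graph) rigid_walk_exists:
  assumes uv: "Poly_Mapping.keys u \<subseteq> E" "Poly_Mapping.keys v \<subseteq> E" "lexp rho u = lexp rho v"
    and nconn: "\<not> fibre_conn E rho u v"
  obtains w k where "rigid_walk V E w k" "u = alt w True 0 (2 * k)" "v = alt w False 0 (2 * k)"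
proof -
  have "u \<noteq> 0" using nconn uv lexp_eq_zeroD[of v] by auto
  have "dg u x = dg v x" for x using uv(3) by (simp add: lexp_eq_iff)
  then obtain w l where w: "even l" "l > 0" "w l = w 0" "\<And>t. t < l \<Longrightarrow> {w t, w (Suc t)} \<in> E"
    and le: "\<And>e. Poly_Mapping.lookup (alt w True 0 l) e \<le> Poly_Mapping.lookup u e"
      "\<And>e. Poly_Mapping.lookup (alt w False 0 l) e \<le> Poly_Mapping.lookup v e"
    using closed_trail_exists[OF uv(1,2) _ \<open>u \<noteq> 0\<close>] by (smt (verit))
  obtain k where k: "l = 2 * k" using w(1) by blast
  define U where "U = alt w True 0 l"
  define R where "R = alt w False 0 l"
  have KE: "Poly_Mapping.keys U \<subseteq> E" "Poly_Mapping.keys R \<subseteq> E"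
    unfolding U_def R_def using w(4) by (auto intro!: keys_alt_subset)
  have "2 \<le> l" using w(1,2) by presburger
  then have ne: "Poly_Mapping.keys R \<noteq> {}" "Poly_Mapping.keys U \<noteq> {}"
    using alt_nonempty[of 0 l w] by (auto simp: U_def R_def)
  have dg: "dg U x = dg R x" for x
    using dg_alt_diff[of 0 l w x] w by (simp add: U_def R_def)
  define u' where "u' = u - U"
  define v' where "v' = v - R"
  have u: "u = U + u'" and v: "v = R + v'"
    using lookup_le_imp_add[OF le(1)] lookup_le_imp_add[OF le(2)] by (simp_all add: U_def R_def u'_def v'_def)
  have dg': "dg u' x = dg v' x" for x using uv(3) dg[of x] unfolding u v lexp_eq_iff dg_add by (metis add_left_cancel)
  have KE': "Poly_Mapping.keys u' \<subseteq> E" "Poly_Mapping.keys v' \<subseteq> E" using uv by (auto simp: u v keys_monomial_add)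
  have "u' = 0"
  proof (rule ccontr)
    assume "u' \<noteq> 0"
    then have "Poly_Mapping.keys u' \<noteq> {}" by simp
    have K: "Poly_Mapping.keys (R + u') \<subseteq> E" using KE KE' by (simp add: keys_monomial_add)
    have "Poly_Mapping.keys u \<inter> Poly_Mapping.keys (R + u') \<noteq> {}"
      using \<open>Poly_Mapping.keys u' \<noteq> {}\<close> unfolding u keys_monomial_add by blast
    moreover have "dg u x = dg (R + u') x" for x by (simp add: u dg_add dg)
    ultimately have "fibre_step E rho u (R + u')"
      using uv(1) K unfolding fibre_step_def lexp_eq_iff by blast
    moreover have "Poly_Mapping.keys (R + u') \<inter> Poly_Mapping.keys v \<noteq> {}"
      using ne(1) unfolding v keys_monomial_add by blast
    moreover have "dg (R + u') x = dg v x" for x by (simp add: v dg_add dg')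
    ultimately have "fibre_step E rho u (R + u')" "fibre_step E rho (R + u') v"
      using uv(2) K unfolding fibre_step_def lexp_eq_iff by blast+
    then show False using nconn by (meson converse_rtranclp_into_rtranclp r_into_rtranclp)
  qed
  moreover from this have "v' = 0"
    using lexp_eq_zeroD[OF KE'(2)] dg' lexp_eq_iff[of v' 0] by simp
  ultimately have uv': "u = U" "v = R" by (simp_all add: u v)
  define z where "z t = w (t mod l)" for t
  have zw: "z t = w t" if "t \<le> l" for t using that w(2,3) by (cases "t = l") (auto simp: z_def)
  have alt: "alt z b 0 l = alt w b 0 l" for b by (rule alt_cong) (simp add: zw)
  have "{z t, z (Suc t)} \<in> E" for t
    using w(2) w(3) w(4)[of "t mod l"] by (auto simp: z_def mod_Suc)
  then have "rigid_walk V E z k"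
    using nconn w(2) alt uv' by unfold_locales (auto simp: z_def k U_def R_def)
  then show ?thesis using that[of z k] alt uv' by (simp add: k U_def R_def)
qed

section \<open>Length and shape of rigid walks\<close>

context rigid_walk
begin

text \<open>An even return is excluded, so the \<open>k\<close> even positions carry distinct
  vertices.\<close>

lemma length_bound: "tdeg (alt w True 0 (2 * k)) \<le> card V"
proof -
  have "{t \<in> {0..<2 * k}. even t = True} = (\<lambda>n. 2 * n) ` {..<k}" by auto
  then have "tdeg (alt w True 0 (2 * k)) = k" by (simp add: tdeg_alt card_image inj_on_def)
  moreover have "inj_on (\<lambda>t. w (2 * t)) {..<k}"
    using no_even_return[of "2 * s" "2 * t" for s t] by (intro linorder_inj_onI') auto
  then have "card ((\<lambda>t. w (2 * t)) ` {..<k}) = k" by (simp add: card_image)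
  moreover have "(\<lambda>t. w (2 * t)) ` {..<k} \<subseteq> V" using edge edgeD by blast
  ultimately show ?thesis using card_mono[OF finite_V] by metis
qed

text \<open>A repetition splits the walk into two odd closed walks. A shortest return is taken, then
  a shortest one in the complementary arc; minimality frees both from inner repetitions. They are
  connected by two arcs of lengths \<open>l\<close> and \<open>l'\<close>. If the base vertices
  coincide or are adjacent, both arcs have the same length 0 or 1; otherwise the configuration
  arises.\<close>

theorem cycle_or_dumbbell:
  assumes noconf: "\<not> (\<exists>c c' p. induced_cycles_joined_by_path V E c c' p)"
  shows "inj_on w {..<2 * k} \<or> (\<exists>i a l b. l \<le> 1 \<and> 2 * k = a + 2 * l + b \<and> dumbbell (\<lambda>t. w (i + t)) a l b)"
proof (unfold disj_imp, rule impI)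
  assume "\<not> inj_on w {..<2 * k}"
  then obtain i\<^sub>0 j\<^sub>0 where ij\<^sub>0: "i\<^sub>0 < j\<^sub>0" "j\<^sub>0 < 2 * k" "w i\<^sub>0 = w j\<^sub>0"
    using linorder_inj_onI'[of "{..<2 * k}" w] by auto
  \<comment> \<open>\<open>D\<close> ranges over all returns of the periodic walk, \<open>D'\<close>
    below only over those in the complementary arc from \<open>j\<close> to
    \<open>i + 2 * k\<close>.\<close>
  define D where "D d \<longleftrightarrow> 0 < d \<and> (\<exists>i. w i = w (i + d))" for d
  have D0: "D (j\<^sub>0 - i\<^sub>0)" using ij\<^sub>0 by (auto simp: D_def intro: exI[of _ i\<^sub>0])
  define a where "a = (LEAST d. D d)"
  have "D a" unfolding a_def by (rule LeastI[of D, OF D0])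
  then obtain i where i: "0 < a" "w i = w (i + a)" by (auto simp: D_def)
  have amin: "a \<le> d" if "0 < d" "w s = w (s + d)" for s d
    unfolding a_def by (rule Least_le) (use that in \<open>auto simp: D_def\<close>)
  have "a < 2 * k" using Least_le[of D, OF D0] ij\<^sub>0 unfolding a_def[symmetric] by simp
  define j where "j = i + a"
  have wj: "w j = w i" using i by (simp add: j_def)
  have odd_a: "odd a" using no_even_return[of i j] i \<open>a < 2 * k\<close> by (auto simp: j_def)
  have "a \<noteq> 1" using edge[of i] i(2) by auto
  then have a3: "3 \<le> a" using odd_a i(1) by presburger
  define D' where "D' d \<longleftrightarrow> 0 < d \<and> (\<exists>s\<ge>j. s + d \<le> i + 2 * k \<and> w s = w (s + d))" for d
  have D'0: "D' (i + 2 * k - j)"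
    using wj period[of i] \<open>a < 2 * k\<close> unfolding D'_def by (intro conjI exI[of _ j]) (auto simp: j_def)
  define b where "b = (LEAST d. D' d)"
  have "D' b" unfolding b_def by (rule LeastI[of D', OF D'0])
  then obtain i' where i': "0 < b" "j \<le> i'" "i' + b \<le> i + 2 * k" "w i' = w (i' + b)" by (auto simp: D'_def)
  have bmin: "b \<le> d" if "0 < d" "j \<le> s" "s + d \<le> i + 2 * k" "w s = w (s + d)" for s d
    unfolding b_def by (rule Least_le) (use that in \<open>auto simp: D'_def\<close>)
  have odd_b: "odd b" using no_even_return[of i' "i' + b"] i' i(1) by (auto simp: j_def)
  have "b \<noteq> 1" using edge[of i'] i'(4) by auto
  then have b3: "3 \<le> b" using odd_b i'(1) by presburger
  define l where "l = i' - j"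
  define l' where "l' = i + 2 * k - (i' + b)"
  have i'_eq: "i' = i + a + l" using i'(2) by (simp add: l_def j_def)
  have len: "a + l + b + l' = 2 * k" using i'(3) i'_eq by (simp add: l'_def)
  then have par: "even l \<longleftrightarrow> even l'" using odd_a odd_b by presburger
  \<comment> \<open>As \<open>j - i\<close> is odd, a further visit would be at even distance from
    \<open>i\<close> or from \<open>j\<close>.\<close>
  have no_x: "w t \<noteq> w i" if "j < t" "t < i + 2 * k" for t
  proof (cases "even (t - i)")
    case True
    then show ?thesis using no_even_return[of i t] that by (auto simp: j_def)
  next
    case False
    then have "even (t - j)" using that odd_a by (auto simp: j_def)
    then show ?thesis using no_even_return[of j t] that wj i(1) by (auto simp: j_def)
  qed
  have cross: "w s \<noteq> w t" "{w s, w t} \<notin> E" if "i < s" "s < j" "j < t" "t < i + 2 * k" for s t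
    using no_cross_vertex[of i j s t] no_cross_edge[of i j s t] that wj odd_a by (auto simp: j_def)
  have dumb: "dumbbell (\<lambda>t. w (i + t)) a l b"
    if l1: "l \<le> 1" and mirror: "\<And>t. t \<le> l \<Longrightarrow> w (i + (a + l + b + t)) = w (i + (a + l - t))"
    unfolding dumbbell_def
  proof (intro conjI odd_a odd_b a3 b3 allI impI)
    show "inj_on (\<lambda>t. w (i + t)) {1..<a + l + b}"
    proof (rule linorder_inj_onI')
      fix s t assume st: "s \<in> {1..<a + l + b}" "t \<in> {1..<a + l + b}" "s < t"
      consider "t \<le> a" | "s < a" "a < t" | "s = a" | "a + l \<le> s" using st l1 by (cases "t \<le> a"; cases "s < a"; cases "s = a") auto
      then show "w (i + s) \<noteq> w (i + t)"
      proof cases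
        case 1
        then show ?thesis using amin[of "t - s" "i + s"] st by auto
      next
        case 2
        then show ?thesis using cross(1)[of "i + s" "i + t"] st len by (auto simp: j_def)
      next
        case 3
        then show ?thesis using no_x[of "i + t"] st len wj by (auto simp: j_def)
      next
        case 4
        then show ?thesis using bmin[of "t - s" "i + s"] st len i'_eq by (auto simp: j_def)
      qed
    qed
  qed (use edge i(2) mirror in auto)
  show "\<exists>i a l b. l \<le> 1 \<and> 2 * k = a + 2 * l + b \<and> dumbbell (\<lambda>t. w (i + t)) a l b"
  proof (cases "w i = w i'")
    case True
    then have "l = 0" using no_x[of i'] i' b3 by (fastforce simp: l_def)
    moreover have "l' = 0" using no_x[of "i' + b"] i' b3 True by (fastforce simp: l'_def)
    moreover have "w (i + (a + b)) = w (i + a)" using period[of i] len i(2) \<open>l = 0\<close> \<open>l' = 0\<close> by simp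
    ultimately show ?thesis using dumb len by (intro exI[of _ i] exI[of _ a] exI[of _ 0] exI[of _ b]) auto
  next
    case ne: False
    have "l > 0" using ne wj i'(2) by (cases "i' = j") (auto simp: l_def)
    have "l' > 0"
    proof (rule ccontr)
      assume "\<not> l' > 0"
      then have "i' + b = i + 2 * k" using i'(3) by (simp add: l'_def)
      then show False using period[of i] i'(4) ne by simp
    qed
    show ?thesis
    proof (cases "{w i, w i'} \<in> E")
      case True
      \<comment> \<open>For even \<open>l\<close> the edge is a forbidden odd chord between
        positions \<open>i\<close> and \<open>i'\<close>. For odd \<open>l\<close> it is an odd
        chord between \<open>j\<close> and \<open>i'\<close>, admissible only as an edge of the walk
        itself; this gives \<open>l = 1\<close>.\<close>
      have "odd l"
      proof
        assume "even l"
        then have "odd (i' - i)" using odd_a i'_eq by simp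
        then show False using no_odd_chord[of i i'] True i'_eq a3 b3 len by auto
      qed
      then have "l = 1"
        using no_odd_chord[of j i'] True wj i'_eq \<open>l > 0\<close> b3 len by (auto simp: j_def)
      moreover have "l' = 1"
      proof -
        have "{w (i' + b), w (i + 2 * k)} \<in> E" using True i'(4) period[of i] by (simp add: insert_commute)
        moreover have "odd (i + 2 * k - (i' + b))" using \<open>odd l\<close> par by (simp add: l'_def)
        ultimately show ?thesis
          using no_odd_chord[of "i' + b" "i + 2 * k"] \<open>l' > 0\<close> i'_eq a3 by (auto simp: l'_def)
      qed
      moreover have "w (i + (a + 1 + b + t)) = w (i + (a + 1 - t))" if "t \<le> 1" for t
      proof (cases "t = 0")
        case True
        then show ?thesis using i'(4) i'_eq \<open>l = 1\<close> by (simp add: add_ac)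
      next
        case False
        then have "t = 1" using that by simp
        moreover have "i + (a + 1 + b + 1) = i + 2 * k" using len \<open>l = 1\<close> \<open>l' = 1\<close> by simp
        ultimately show ?thesis using period[of i] i(2) by simp
      qed
      ultimately show ?thesis using dumb len by (intro exI[of _ i] exI[of _ a] exI[of _ 1] exI[of _ b]) auto
    next
      case noedge: False
      \<comment> \<open>Only one of the two connecting arcs is used. The lollipops and the path are
        chosen inside the vertex sets of these walks, so exclusions for the walk carry over to
        them.\<close>
      define S1 where "S1 = w ` {i..j}"
      define S2 where "S2 = w ` {j..i'}"
      define S3 where "S3 = w ` {i'..i' + b}"
      have walk: "joined (w ` {s..s + n}) n (w s) (w (s + n))" for s n
        unfolding joined_def by (rule exI[of _ "\<lambda>t. w (s + t)"]) (auto simp: walk_in_def edge)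
      obtain c q where c: "odd_cycle V E c" "is_path V E q" "hd q = w i" "set q \<inter> set c = {last q}"
        "set c \<union> set q \<subseteq> S1" "induced_edges E (set c \<union> set q) = cycle_edges c \<union> path_edges q"
        using induced_lollipop[of S1 a "w i"] walk[of i a] odd_a wj by (auto simp: S1_def j_def)
      obtain c' q' where c': "odd_cycle V E c'" "is_path V E q'" "hd q' = w i'" "set q' \<inter> set c' = {last q'}"
        "set c' \<union> set q' \<subseteq> S3" "induced_edges E (set c' \<union> set q') = cycle_edges c' \<union> path_edges q'"
        using induced_lollipop[of S3 b "w i'"] walk[of i' b] odd_b i'(4) by (auto simp: S3_def)
      obtain r where r: "is_path V E r" "hd r = w i" "last r = w i'" "set r \<subseteq> S2"
        "induced_edges E (set r) = path_edges r"
        using induced_path[of S2 l "w i" "w i'"] walk[of j l] ne wj i'(2) by (auto simp: S2_def l_def)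
      have x2: "w i \<in> S2" using wj i'(2) by (auto simp: S2_def intro: image_eqI[of _ _ j])
      \<comment> \<open>The walk is now split at \<open>i'\<close> and \<open>i' + b\<close>;
        positions before \<open>i'\<close> are moved one period ahead to lie in the second
        half.\<close>
      have cross': "w s \<noteq> w t" "{w s, w t} \<notin> E" if "i' < s" "s < i' + b" "j \<le> t" "t < i'" for s t
        using no_cross_vertex[of i' "i' + b" s "t + 2 * k"] no_cross_edge[of i' "i' + b" s "t + 2 * k"]
          that i'(3,4) odd_b period[of t] i(1) by (auto simp: j_def)
      \<comment> \<open>Equality and adjacency are treated together: \<open>m12\<close>,
        \<open>m23\<close> and \<open>m13\<close> supply the disjointness of the pieces as well as
        the absence of edges between them.\<close>
      have m12: "u = w i \<or> u' = w i" if uu: "u \<in> S1" "u' \<in> S2" "u = u' \<or> {u, u'} \<in> E" for u u'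
      proof (rule ccontr)
        assume *: "\<not> ?thesis"
        obtain s t where st: "u = w s" "i \<le> s" "s \<le> j" "u' = w t" "j \<le> t" "t \<le> i'"
          using uu(1,2) by (auto simp: S1_def S2_def)
        then have "i < s" "s < j" "j < t" using * wj by (auto simp: le_less)
        then show False using cross[of s t] uu(3) st i' by auto
      qed
      have m23: "u = w i' \<or> u' = w i'" if uu: "u \<in> S2" "u' \<in> S3" "u = u' \<or> {u, u'} \<in> E" for u u'
      proof (rule ccontr)
        assume *: "\<not> ?thesis"
        obtain s t where st: "u = w t" "j \<le> t" "t \<le> i'" "u' = w s" "i' \<le> s" "s \<le> i' + b"
          using uu(1,2) by (auto simp: S2_def S3_def)
        then have "i' < s" "s < i' + b" "t < i'" using * i'(4) by (auto simp: le_less)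
        then show False using cross'[of s t] uu(3) st by (auto simp: insert_commute)
      qed
      have m13: False if uu: "u \<in> S1" "u' \<in> S3" "u = u' \<or> {u, u'} \<in> E" for u u'
      proof (cases "u = w i")
        case True
        then show False using m23[OF x2 uu(2)] uu(3) ne noedge by auto
      next
        case False
        obtain s t where st: "u = w s" "i \<le> s" "s \<le> j" "u' = w t" "i' \<le> t" "t \<le> i' + b"
          using uu(1,2) by (auto simp: S1_def S3_def)
        then have "i < s" "s < j" using False wj by (auto simp: le_less)
        moreover have "j < t" "t < i + 2 * k" using st(5,6) \<open>l > 0\<close> \<open>l' > 0\<close> by (auto simp: l_def l'_def)
        ultimately show False using cross[of s t] uu(3) st by auto
      qed
      have nonempty: "q \<noteq> []" "r \<noteq> []" "q' \<noteq> []" using c(2) r(1) c'(2) by (auto simp: is_path_def)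
      have ends: "w i \<in> set q" "w i \<in> set r" "w i' \<in> set r" "w i' \<in> set q'"
        using nonempty c(3) r(2,3) c'(3) by (metis hd_in_set, metis hd_in_set, metis last_in_set, metis hd_in_set)
      \<comment> \<open>A shorter path would make the two base vertices equal or adjacent.\<close>
      have "3 \<le> length r"
      proof (rule ccontr)
        assume "\<not> 3 \<le> length r"
        then have "length r = 1 \<or> length r = 2" using nonempty(2) length_0_conv[of r] by linarith
        then show False
        proof
          assume "length r = 1"
          then obtain v where "r = [v]" by (auto simp: length_Suc_conv)
          then show False using r(2,3) ne by simp
        next
          assume "length r = 2"
          then obtain v v' where rv: "r = [v, v']" by (auto simp: length_Suc_conv numeral_2_eq_2)
          then have "{v, v'} \<in> path_edges r" by (auto simp: path_edges_def)
          then show False using r(1-3) rv noedge by (auto simp: is_path_def)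
        qed
      qed
      have "induced_cycles_joined_by_path V E c c' ((rev q @ tl r) @ tl q')"
      proof (rule glue_lollipops[OF c(1) c'(1) c(2) r(1) c'(2) c(4) c'(4)])
        show "hd r = hd q" "last r = hd q'" using r(2,3) c(3) c'(3) by simp_all
        show "(set c \<union> set q) \<inter> set r = {hd q}"
        proof (intro equalityI subsetI)
          fix v assume "v \<in> (set c \<union> set q) \<inter> set r"
          then show "v \<in> {hd q}" using m12[of v v] c(3,5) r(4) by auto
        qed (use ends c(3) in auto)
        show "(set c' \<union> set q') \<inter> set r = {hd q'}"
        proof (intro equalityI subsetI)
          fix v assume "v \<in> (set c' \<union> set q') \<inter> set r"
          then show "v \<in> {hd q'}" using m23[of v v] c'(3,5) r(4) by auto
        qed (use ends c'(3) in auto)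
        show "(set c \<union> set q) \<inter> (set c' \<union> set q') = {}"
          using m13 c(5) c'(5) by blast
        fix e assume e: "e \<in> E" "e \<subseteq> (set c \<union> set q) \<union> set r \<union> (set c' \<union> set q')"
        have ok: "e \<subseteq> set c \<union> set q \<or> e \<subseteq> set r \<or> e \<subseteq> set c' \<union> set q'" if uv: "e = {u, v}"
          "u \<in> set c \<union> set q \<and> v \<in> set r \<or> u \<in> set r \<and> v \<in> set c' \<union> set q' \<or> u \<in> set c \<union> set q \<and> v \<in> set c' \<union> set q'" for u v
          using uv(2)
        proof (elim disjE)
          assume *: "u \<in> set c \<union> set q \<and> v \<in> set r"
          then have "u = w i \<or> v = w i" using m12[of u v] c(5) r(4) e(1) uv(1) by blast
          then show ?thesis using * ends uv(1) by auto
        next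
          assume *: "u \<in> set r \<and> v \<in> set c' \<union> set q'"
          then have "u = w i' \<or> v = w i'" using m23[of u v] c'(5) r(4) e(1) uv(1) by blast
          then show ?thesis using * ends uv(1) by auto
        next
          assume *: "u \<in> set c \<union> set q \<and> v \<in> set c' \<union> set q'"
          then show ?thesis using m13[of u v] c(5) c'(5) e(1) uv(1) by blast
        qed
        obtain u v where uv: "e = {u, v}" using e(1) by (elim edgeE)
        then have uv': "e = {v, u}" by auto
        have "u \<in> (set c \<union> set q) \<union> set r \<union> (set c' \<union> set q')" "v \<in> (set c \<union> set q) \<union> set r \<union> (set c' \<union> set q')"
          using e(2) uv by auto
        then show "e \<subseteq> set c \<union> set q \<or> e \<subseteq> set r \<or> e \<subseteq> set c' \<union> set q'"
          using ok[OF uv] ok[OF uv'] uv by auto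
      qed (use c(6) r(5) c'(6) \<open>3 \<le> length r\<close> in auto)
      then show ?thesis using noconf by blast
    qed
  qed
qed

end

section \<open>Circuits of even cycles and dumbbells\<close>

text \<open>The divisibility of \<open>u^n - v^n\<close> by \<open>u - v\<close>, times a monomial
  \<open>c\<close>, in additive notation for monomials.\<close>

lemma binomial_multiple:
  fixes H :: "('j, 'k::comm_ring_1) polynomial set" and n :: nat
  assumes H: "ideal H (poly_ring J)" and uv: "binom u v \<in> H"
    and K: "Poly_Mapping.keys u \<subseteq> J" "Poly_Mapping.keys v \<subseteq> J" "Poly_Mapping.keys c \<subseteq> J"
  shows "binom (c + (\<Sum>i<n. u)) (c + (\<Sum>i<n. v)) \<in> H"
proof (induction n)
  case 0
  then show ?case using poly_idealD(2)[OF H] by simp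
next
  case (Suc n)
  let ?s = "\<Sum>i<n. u" and ?r = "\<Sum>i<n. v"
  have "Poly_Mapping.keys (\<Sum>i<m. u) \<subseteq> J" for m :: nat
    using K(1) by (induction m) (auto simp: keys_monomial_add)
  then have "Poly_Mapping.single (c + ?s) 1 * binom u v \<in> H"
    using K uv by (intro poly_idealD(4)[OF H]) (auto simp: keys_monomial_add)
  moreover have "Poly_Mapping.single v 1 * binom (c + ?s) (c + ?r) \<in> H"
    using K(2) Suc by (intro poly_idealD(4)[OF H]) auto
  ultimately have "Poly_Mapping.single (c + ?s) 1 * binom u v + Poly_Mapping.single v 1 * binom (c + ?s) (c + ?r) \<in> H"
    by (rule poly_idealD(3)[OF H])
  moreover have "Poly_Mapping.single (c + ?s) 1 * binom u v + Poly_Mapping.single v 1 * binom (c + ?s) (c + ?r)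
      = (binom (c + (\<Sum>i<Suc n. u)) (c + (\<Sum>i<Suc n. v)) :: ('j, 'k) polynomial)"
    by (simp add: right_diff_distrib mult_single add_ac)
  ultimately show ?case by simp
qed

lemma sum_lessThan_cong:
  "inj_on f {..<M} \<Longrightarrow> (\<Sum>e\<in>{e \<in> f ` {..<M}. P e}. g e) = (\<Sum>t\<in>{t \<in> {..<M}. P (f t)}. g (f (t::nat)))"
proof -
  assume "inj_on f {..<M}"
  moreover have "{e \<in> f ` {..<M}. P e} = f ` {t \<in> {..<M}. P (f t)}" by auto
  ultimately show ?thesis by (simp add: sum.reindex inj_on_def)
qed

lemma lookup_alt_inj:
  assumes inj: "inj_on (\<lambda>t. {w t, w (Suc t)}) {..<M}" and "j \<le> M" "t < M"
  shows "Poly_Mapping.lookup (alt w b i j) {w t, w (Suc t)} = (if i \<le> t \<and> t < j \<and> even t = b then 1 else 0)"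
proof -
  have "{t' \<in> {i..<j}. even t' = b \<and> {w t', w (Suc t')} = {w t, w (Suc t)}} =
      (if i \<le> t \<and> t < j \<and> even t = b then {t} else {})"
  proof (intro equalityI subsetI)
    fix t' assume t': "t' \<in> {t' \<in> {i..<j}. even t' = b \<and> {w t', w (Suc t')} = {w t, w (Suc t)}}"
    then have "t' = t" using inj_onD[OF inj, of t' t] assms(2,3) by auto
    then show "t' \<in> (if i \<le> t \<and> t < j \<and> even t = b then {t} else {})" using t' by auto
  qed (auto split: if_splits)
  then show ?thesis by (simp add: lookup_alt)
qed

context finite_graph
begin

text \<open>The hypothesis \<open>ker\<close> says that the solution space of the incidence relations is spanned by
  the exponent vector of \<open>binom u v\<close>; its entry at \<open>ed 0\<close> is \<open>1\<close>, so integral solutions are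
  integral multiples.\<close>

lemma principal_toric_ideal:
  fixes ed :: "nat \<Rightarrow> 'v set" and \<mu> :: "nat \<Rightarrow> nat" and M :: nat
  defines "H \<equiv> ed ` {..<M}"
  assumes inj: "inj_on ed {..<M}" and HE: "H \<subseteq> E" and M: "0 < M"
    and K: "Poly_Mapping.keys u \<subseteq> H" "Poly_Mapping.keys v \<subseteq> H"
    and u: "\<And>t. t < M \<Longrightarrow> Poly_Mapping.lookup u (ed t) = (if even t then \<mu> t else 0)"
    and v: "\<And>t. t < M \<Longrightarrow> Poly_Mapping.lookup v (ed t) = (if odd t then \<mu> t else 0)"
    and pos: "\<And>t. t < M \<Longrightarrow> 0 < \<mu> t" and uv: "lexp rho u = lexp rho v"
    and ker: "\<And>D :: nat \<Rightarrow> int. (\<And>x. (\<Sum>t\<in>{t \<in> {..<M}. x \<in> ed t}. D t) = 0) \<Longrightarrow> \<forall>t<M. D t = D 0 * (-1) ^ t * int (\<mu> t)"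
  shows "u \<noteq> v" "Poly_Mapping.keys u \<union> Poly_Mapping.keys v = H"
    "toric_ideal H rho = Idl\<^bsub>poly_ring H\<^esub> {binom u v :: ('v set, 'k::field) polynomial}"
    "(binom u v :: ('v set, 'k) polynomial) \<in> circuits E rho"
proof -
  show ne: "u \<noteq> v" using u[OF M] v[OF M] pos[OF M] by auto
  show un: "Poly_Mapping.keys u \<union> Poly_Mapping.keys v = H"
  proof
    show "H \<subseteq> Poly_Mapping.keys u \<union> Poly_Mapping.keys v"
    proof
      fix e assume "e \<in> H"
      then obtain t where "e = ed t" "t < M" by (auto simp: H_def)
      then show "e \<in> Poly_Mapping.keys u \<union> Poly_Mapping.keys v"
        using u[of t] v[of t] pos[of t] by (auto simp: in_keys_iff)
    qed
  qed (use K in auto)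
  let ?f = "binom u v :: ('v set, 'k) polynomial"
  let ?I = "Idl\<^bsub>poly_ring H\<^esub> {?f}"
  have f: "?f \<in> toric_ideal H rho" "supp ?f = H"
    using K ne uv un by (auto simp: binom_in_toric_ideal_iff supp_binom)
  then have carr: "{?f} \<subseteq> carrier (poly_ring H)" by simp
  have fI: "?f \<in> ?I" using Idl_superset[OF carr] by simp
  have multiple: "binom p q \<in> ?I"
    if p: "Poly_Mapping.keys p \<subseteq> H" and q: "Poly_Mapping.keys q \<subseteq> H" and c: "0 \<le> n"
      "\<And>t. t < M \<Longrightarrow> int (Poly_Mapping.lookup p (ed t)) - int (Poly_Mapping.lookup q (ed t)) = n * (-1) ^ t * int (\<mu> t)" for p q n
  proof -
    \<comment> \<open>The aim is \<open>p = (p - s) + s\<close> and \<open>q = (p - s) + r\<close>: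
      since \<open>u\<close> and \<open>v\<close> have no common variable, the difference of
      \<open>p\<close> and \<open>q\<close> forces \<open>s\<close> to divide
      \<open>p\<close>.\<close>
    define s where "s = (\<Sum>i<nat n. u)"
    define r where "r = (\<Sum>i<nat n. v)"
    have s: "Poly_Mapping.lookup s e = nat n * Poly_Mapping.lookup u e"
      and r: "Poly_Mapping.lookup r e = nat n * Poly_Mapping.lookup v e" for e
      by (simp_all add: s_def r_def lookup_sum)
    have *: "Poly_Mapping.lookup s e \<le> Poly_Mapping.lookup p e \<and>
        Poly_Mapping.lookup q e = (Poly_Mapping.lookup p e - Poly_Mapping.lookup s e) + Poly_Mapping.lookup r e" for e
    proof (cases "e \<in> H")
      case True
      then obtain t where t: "e = ed t" "t < M" by (auto simp: H_def)
      have "int (Poly_Mapping.lookup p e) - int (Poly_Mapping.lookup q e) =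
          int (Poly_Mapping.lookup s e) - int (Poly_Mapping.lookup r e)"
        using c(2)[OF t(2)] c(1) u[OF t(2)] v[OF t(2)] unfolding t(1) s r by (cases "even t") auto
      moreover have "Poly_Mapping.lookup s e = 0 \<or> Poly_Mapping.lookup r e = 0"
        using u[OF t(2)] v[OF t(2)] unfolding t(1) s r by auto
      ultimately show ?thesis by auto
    next
      case False
      then have "Poly_Mapping.lookup m e = 0" if "m \<in> {u, v, p, q}" for m
        using that K p q by (auto simp: in_keys_iff subset_iff)
      then show ?thesis by (simp add: s r)
    qed
    have p': "p = (p - s) + s" using lookup_le_imp_add[of s p] * by (metis add.commute)
    have q': "q = (p - s) + r" using * by (intro poly_mapping_eqI) (metis lookup_add lookup_minus)
    have "Poly_Mapping.keys (p - s) \<subseteq> H" using p by (auto simp: in_keys_iff lookup_minus)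
    then have "binom ((p - s) + s) ((p - s) + r) \<in> ?I"
      unfolding s_def r_def by (intro binomial_multiple[OF Idl_ideal[OF carr] fI K])
    then show ?thesis by (simp flip: p' q')
  qed
  show eq: "toric_ideal H rho = ?I"
  proof
    show "?I \<subseteq> toric_ideal H rho"
      using f(1) by (intro Idl_least[OF carr ideal_toric_ideal]) simp
    show "toric_ideal H rho \<subseteq> ?I"
    proof (rule toric_ideal_subset_by_binomials[OF Idl_ideal[OF carr]])
      fix p q :: "'v set monomial"
      assume pq: "Poly_Mapping.keys p \<subseteq> H" "Poly_Mapping.keys q \<subseteq> H" "lexp rho p = lexp rho q"
      define D where "D t = int (Poly_Mapping.lookup p (ed t)) - int (Poly_Mapping.lookup q (ed t))" for t
      have dgH: "dg m x = (\<Sum>t\<in>{t \<in> {..<M}. x \<in> ed t}. int (Poly_Mapping.lookup m (ed t)))"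
        if "Poly_Mapping.keys m \<subseteq> H" for m x
      proof -
        have "dg m x = (\<Sum>e\<in>{e \<in> H. x \<in> e}. int (Poly_Mapping.lookup m e))"
          using that HE unfolding dg_altdef[OF order_trans[OF that HE]]
          by (intro sum.mono_neutral_left) (auto simp: H_def in_keys_iff)
        also have "\<dots> = (\<Sum>t\<in>{t \<in> {..<M}. x \<in> ed t}. int (Poly_Mapping.lookup m (ed t)))"
          unfolding H_def by (rule sum_lessThan_cong[OF inj])
        finally show ?thesis .
      qed
      have "(\<Sum>t\<in>{t \<in> {..<M}. x \<in> ed t}. D t) = 0" for x
        using pq(3) dgH[OF pq(1), of x] dgH[OF pq(2), of x] by (simp add: D_def sum_subtractf lexp_eq_iff)
      then have D: "D t = D 0 * (-1) ^ t * int (\<mu> t)" if "t < M" for t using ker[of D] that by blast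
      show "binom p q \<in> ?I"
      proof (cases "0 \<le> D 0")
        case True
        show ?thesis
        proof (rule multiple[OF pq(1,2) True])
          fix t assume "t < M"
          then have "D t = D 0 * (-1) ^ t * int (\<mu> t)" by (rule D)
          then show "int (Poly_Mapping.lookup p (ed t)) - int (Poly_Mapping.lookup q (ed t)) = D 0 * (-1) ^ t * int (\<mu> t)"
            unfolding D_def[of t] .
        qed
      next
        case False
        have "binom q p \<in> ?I"
        proof (rule multiple[OF pq(2,1), of "- D 0"])
          fix t assume "t < M"
          then have "D t = D 0 * (-1) ^ t * int (\<mu> t)" by (rule D)
          then show "int (Poly_Mapping.lookup q (ed t)) - int (Poly_Mapping.lookup p (ed t)) = - D 0 * (-1) ^ t * int (\<mu> t)"
            unfolding D_def[of t] by linarith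
        qed (use False in simp)
        then have "- binom q p \<in> ?I" by (rule poly_idealD(5)[OF Idl_ideal[OF carr]])
        then show ?thesis by simp
      qed
    qed
  qed
  show "?f \<in> circuits E rho"
  proof (rule circuitI)
    show "?f \<in> toric_ideal E rho" using f(1) HE by (auto simp: toric_ideal_iff)
    show "is_binomial ?f" using ne by (simp add: is_binomial_binom)
    show "\<exists>k. g = ?f * k" if "g \<in> toric_ideal E rho" "supp g \<subseteq> supp ?f" for g
    proof -
      have "g \<in> ?I" using that f(2) unfolding eq[symmetric] by (simp add: toric_ideal_iff)
      then obtain k where "g = k * ?f" using Idl_singleton[of ?f H] f(2) by auto
      then have "g = ?f * k" by (simp add: mult.commute)
      then show ?thesis by blast
    qed
  qed
qed

text \<open>Exactly two edges meet at each vertex of the cycle, so a solution of the incidence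
  relations alternates in sign and is fixed by one value.\<close>

lemma even_cycle_circuit:
  assumes edge: "\<And>t. t < 2 * k \<Longrightarrow> {w t, w (Suc t)} \<in> E" and closed: "w (2 * k) = w 0"
    and inj: "inj_on w {..<2 * k}" and k: "2 \<le> k"
  shows "(binom (alt w True 0 (2 * k)) (alt w False 0 (2 * k)) :: ('v set, 'k::field) polynomial) \<in> sf_circuits E rho"
proof -
  let ?ed = "\<lambda>t. {w t, w (Suc t)}"
  let ?u = "alt w True 0 (2 * k)" and ?v = "alt w False 0 (2 * k)"
  have weq: "w s = w t \<longleftrightarrow> s mod (2 * k) = t mod (2 * k)" if "s \<le> 2 * k" "t \<le> 2 * k" for s t
  proof -
    have "w s = w (s mod (2 * k))" if "s \<le> 2 * k" for s using that closed by (cases "s = 2 * k") auto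
    then have "w s = w t \<longleftrightarrow> w (s mod (2 * k)) = w (t mod (2 * k))" using that by simp
    also have "\<dots> \<longleftrightarrow> s mod (2 * k) = t mod (2 * k)"
      using k by (intro inj_on_eq_iff[OF inj]) auto
    finally show ?thesis .
  qed
  have weq': "w s = w t \<longleftrightarrow> s = t \<or> s = 0 \<and> t = 2 * k \<or> s = 2 * k \<and> t = 0" if "s \<le> 2 * k" "t \<le> 2 * k" for s t
    unfolding weq[OF that] using that k by (cases "s = 2 * k"; cases "t = 2 * k") auto
  have inj_ed: "inj_on ?ed {..<2 * k}"
    by (rule inj_onI) (use k in \<open>auto simp: doubleton_eq_iff weq'\<close>)
  have lookup: "Poly_Mapping.lookup (alt w b 0 (2 * k)) (?ed t) = (if even t = b then 1 else 0)" if "t < 2 * k" for t b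
    using lookup_alt_inj[OF inj_ed le_refl that, of b 0] that by simp
  have K: "Poly_Mapping.keys (alt w b 0 (2 * k)) \<subseteq> ?ed ` {..<2 * k}" for b by (auto simp: keys_alt)
  have "dg ?u x = dg ?v x" for x
    using dg_alt_diff[of 0 "2 * k" w x] edge closed by simp
  then have lexp: "lexp rho ?u = lexp rho ?v" by (simp add: lexp_eq_iff)
  have "(binom ?u ?v :: ('v set, 'k) polynomial) \<in> circuits E rho"
  proof (rule principal_toric_ideal(4)[of ?ed "2 * k" ?u ?v "\<lambda>_. 1", OF inj_ed _ _ K K _ _ _ lexp])
    fix D :: "nat \<Rightarrow> int" assume D: "\<And>x. (\<Sum>t\<in>{t \<in> {..<2 * k}. x \<in> ?ed t}. D t) = 0"
    have "D t = D 0 * (-1) ^ t" if "t < 2 * k" for t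
      using that
    proof (induction t)
      case (Suc t)
      have "{t' \<in> {..<2 * k}. w (Suc t) \<in> ?ed t'} = {t, Suc t}"
        using Suc.prems by (auto simp: weq')
      then have "D t + D (Suc t) = 0" using D[of "w (Suc t)"] by simp
      then show ?case using Suc by simp
    qed simp
    then show "\<forall>t<2 * k. D t = D 0 * (-1) ^ t * int 1" unfolding of_nat_1 mult_1_right by blast
  qed (use edge k lookup in auto)
  moreover have "squarefree_monomial ?u"
    unfolding squarefree_monomial_def
  proof
    fix e
    show "Poly_Mapping.lookup ?u e \<le> 1"
    proof (cases "e \<in> ?ed ` {..<2 * k}")
      case True
      then show ?thesis using lookup by auto
    next
      case False
      then have "Poly_Mapping.lookup ?u e = 0" using K[of True] by (meson in_keys_iff subsetD)
      then show ?thesis by simp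
    qed
  qed
  moreover have "?u \<noteq> ?v" using lookup[of 0 True] lookup[of 0 False] k by auto
  ultimately show ?thesis unfolding sf_circuits_def is_difference_def by blast
qed

text \<open>A solution of the incidence relations alternates along each odd cycle, so the two cycle
  edges at a base vertex carry equal values and the path edge there carries twice that value with
  opposite sign. Hence one value determines the rest, and the entries are 2 on the path, which the
  walk traverses twice.\<close>

lemma dumbbell_circuit:
  assumes db: "dumbbell w a l b"
  defines "N \<equiv> a + 2 * l + b" and "M \<equiv> a + l + b" and "ed \<equiv> \<lambda>t. {w t, w (Suc t)}"
  defines "u \<equiv> alt w True 0 N" and "v \<equiv> alt w False 0 N" and "\<mu> \<equiv> \<lambda>t. if a \<le> t \<and> t < a + l then 2 else (1::nat)"
  shows "u \<noteq> v" "Poly_Mapping.keys u \<union> Poly_Mapping.keys v = ed ` {..<M}" "lexp rho u = lexp rho v"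
    "toric_ideal (ed ` {..<M}) rho = Idl\<^bsub>poly_ring (ed ` {..<M})\<^esub> {binom u v :: ('v set, 'k::field) polynomial}"
    "(binom u v :: ('v set, 'k) polynomial) \<in> circuits E rho"
    "\<And>c t. t < M \<Longrightarrow> Poly_Mapping.lookup (alt w c 0 N) (ed t) = (if even t = c then \<mu> t else 0)"
    "\<And>c. Poly_Mapping.keys (alt w c 0 N) \<subseteq> ed ` {..<M}"
proof -
  have ab: "odd a" "odd b" "3 \<le> a" "3 \<le> b" and edge: "\<And>t. t < M \<Longrightarrow> {w t, w (Suc t)} \<in> E"
    and wa: "w a = w 0" and inj: "inj_on w {1..<M}" and mirror: "\<And>t. t \<le> l \<Longrightarrow> w (M + t) = w (a + l - t)"
    using db by (auto simp: dumbbell_def M_def)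
  have wM: "w M = w (a + l)" using mirror[of 0] by simp
  \<comment> \<open>The coincidences \<open>w 0 = w a\<close> and \<open>w M = w (a + l)\<close> are
    removed by choosing representatives in \<open>{1..<M}\<close>, where \<open>w\<close> is
    injective.\<close>
  define c where "c t = (if t = 0 then a else if t = M then a + l else t)" for t
  have weq: "w s = w t \<longleftrightarrow> c s = c t" if "s \<le> M" "t \<le> M" for s t
  proof -
    have "w s = w (c s)" "c s \<in> {1..<M}" if "s \<le> M" for s using that wa wM ab by (auto simp: c_def M_def)
    then have "w s = w (c s)" "w t = w (c t)" "c s \<in> {1..<M}" "c t \<in> {1..<M}" using that by auto
    then show ?thesis using inj_on_eq_iff[OF inj, of "c s" "c t"] by simp
  qed
  have inj_ed: "inj_on ed {..<M}"
  proof (rule inj_onI)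
    fix s t assume st: "s \<in> {..<M}" "t \<in> {..<M}" "ed s = ed t"
    then have "c s = c t \<and> c (Suc s) = c (Suc t) \<or> c s = c (Suc t) \<and> c (Suc s) = c t"
      by (auto simp: ed_def doubleton_eq_iff weq)
    moreover have "c 0 = a" "c (Suc t) = (if Suc t = M then a + l else Suc t)" for t using ab by (auto simp: c_def M_def)
    ultimately show "s = t" using st(1,2) ab unfolding c_def M_def by (auto split: if_splits)
  qed
  have edgeN: "{w t, w (Suc t)} \<in> E \<and> (M \<le> t \<longrightarrow> {w t, w (Suc t)} = ed (2 * a + 2 * l + b - 1 - t))" if "t < N" for t
  proof (cases "t < M")
    case False
    then have "t = M + (t - M)" "t - M < l" using that by (auto simp: M_def N_def)
    then obtain r where r: "t = M + r" "r < l" by blast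
    then have "{w t, w (Suc t)} = {w (a + l - r), w (a + l - Suc r)}"
      using mirror[of r] mirror[of "Suc r"] by simp
    also have "\<dots> = ed (a + l - Suc r)" using r(2) by (auto simp: ed_def Suc_diff_Suc)
    also have "a + l - Suc r = 2 * a + 2 * l + b - 1 - t" using r by (simp add: M_def)
    finally have "{w t, w (Suc t)} = ed (2 * a + 2 * l + b - 1 - t)" .
    moreover have "ed (2 * a + 2 * l + b - 1 - t) \<in> E" using edge[of "2 * a + 2 * l + b - 1 - t"] False ab by (auto simp: ed_def M_def)
    ultimately show ?thesis by simp
  qed (use edge in auto)
  \<comment> \<open>As \<open>b\<close> is odd, the reflection of positions preserves parity; the
    way back adds each path edge to the same side again, which produces the multiplicity 2.\<close>
  have mirror_alt: "alt w d M N = alt w d a (a + l)" for d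
    unfolding alt_def
  proof (rule sum.reindex_bij_witness[of _ "\<lambda>t. 2 * a + 2 * l + b - 1 - t" "\<lambda>t. 2 * a + 2 * l + b - 1 - t"])
    fix t assume t: "t \<in> {t \<in> {M..<N}. even t = d}"
    then show "2 * a + 2 * l + b - 1 - t \<in> {t \<in> {a..<a + l}. even t = d}" using ab by (auto simp: M_def N_def)
    show "Poly_Mapping.single {w (2 * a + 2 * l + b - 1 - t), w (Suc (2 * a + 2 * l + b - 1 - t))} 1
        = Poly_Mapping.single {w t, w (Suc t)} (1::nat)"
      using edgeN[of t] t by (simp add: ed_def)
  qed (use ab in \<open>auto simp: M_def N_def\<close>)
  have alt_eq: "alt w d 0 N = alt w d 0 M + alt w d a (a + l)" for d
    unfolding mirror_alt[symmetric] by (rule alt_split) (simp_all add: M_def N_def)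
  show lookup: "Poly_Mapping.lookup (alt w d 0 N) (ed t) = (if even t = d then \<mu> t else 0)" if "t < M" for d t
    using lookup_alt_inj[OF inj_ed[unfolded ed_def] le_refl that, of d 0]
      lookup_alt_inj[OF inj_ed[unfolded ed_def] _ that, of "a + l" d a] that
    unfolding alt_eq lookup_add by (auto simp: ed_def \<mu>_def M_def)
  show K: "Poly_Mapping.keys (alt w d 0 N) \<subseteq> ed ` {..<M}" for d
    unfolding alt_eq keys_monomial_add by (auto simp: keys_alt ed_def M_def)
  have "N = M + l" by (simp add: M_def N_def)
  then have "w N = w 0" using mirror[of l] wa by simp
  then have "dg u x = dg v x" for x
    using dg_alt_diff[of 0 N w x] edgeN ab by (simp add: u_def v_def N_def)
  then show lexp: "lexp rho u = lexp rho v" by (simp add: lexp_eq_iff)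
  have ker: "\<forall>t<M. D t = D 0 * (-1) ^ t * int (\<mu> t)"
    if D: "\<And>x. (\<Sum>t\<in>{t \<in> {..<M}. x \<in> ed t}. D t) = 0" for D :: "nat \<Rightarrow> int"
  proof -
    \<comment> \<open>Besides the edges in positions \<open>s - 1\<close> and \<open>s\<close>,
      position 0 starts at \<open>w 0 = w a\<close> and position \<open>M - 1\<close> ends at
      \<open>w M = w (a + l)\<close>.\<close>
    have inc: "{t \<in> {..<M}. w s \<in> ed t} = {s - 1, s} \<union> (if s = a then {0} else {}) \<union> (if s = a + l then {M - 1} else {})"
      if s: "s \<in> {1..<M}" for s
    proof -
      have cs: "c s = s" using s ab by (auto simp: c_def)
      have "w s \<in> ed t \<longleftrightarrow> s = c t \<or> s = c (Suc t)" if "t < M" for t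
        using weq[of s t] weq[of s "Suc t"] s that cs by (auto simp: ed_def)
      then have "{t \<in> {..<M}. w s \<in> ed t} = {t \<in> {..<M}. s = c t \<or> s = c (Suc t)}" by auto
      also have "\<dots> = {s - 1, s} \<union> (if s = a then {0} else {}) \<union> (if s = a + l then {M - 1} else {})"
        using s ab by (auto simp: c_def M_def split: if_splits)
      finally show ?thesis .
    qed
    have step: "D (Suc t) = - D t" if "Suc t < M" "Suc t \<noteq> a" "Suc t \<noteq> a + l" for t
      using D[of "w (Suc t)"] inc[of "Suc t"] that by simp
    have alternate: "D (s + t) = (-1) ^ t * D s" if "s + t < M" "\<And>r. s < r \<Longrightarrow> r \<le> s + t \<Longrightarrow> r \<noteq> a \<and> r \<noteq> a + l" for s t
      using that
    proof (induction t)
      case (Suc t)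
      then show ?case using step[of "s + t"] by simp
    qed simp
    have c1: "D t = (-1) ^ t * D 0" if "t < a" for t using alternate[of 0 t] that by (auto simp: M_def)
    have c3: "D (a + l + t) = (-1) ^ t * D (a + l)" if "t < b" for t using alternate[of "a + l" t] that by (auto simp: M_def)
    have Da1: "D (a - 1) = D 0" using c1[of "a - 1"] ab by simp
    have DM1: "D (M - 1) = D (a + l)" using c3[of "b - 1"] ab by (simp add: M_def)
    have path: "D t = 2 * (-1) ^ t * D 0" if t: "a \<le> t" "t < a + l" for t
    proof -
      have "{t \<in> {..<M}. w a \<in> ed t} = {a - 1, a, 0}" using inc[of a] t ab by (auto simp: M_def)
      then have "D (a - 1) + (D a + D 0) = 0" using D[of "w a"] ab by simp
      then have "D a = - 2 * D 0" using Da1 by simp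
      moreover have "D (a + (t - a)) = (-1) ^ (t - a) * D a" using t by (intro alternate) (auto simp: M_def)
      moreover have "(-1) ^ t = (- ((-1) ^ (t - a)) :: int)" using t ab(1) by (cases "even t") auto
      ultimately show ?thesis using t by simp
    qed
    \<comment> \<open>For \<open>l = 0\<close> the cycles share their base vertex and four edges
      meet there; otherwise the last path edge balances the two edges of the second cycle.\<close>
    have "D (a + l) = (-1) ^ (a + l) * D 0"
    proof (cases "l = 0")
      case True
      then have "{t \<in> {..<M}. w a \<in> ed t} = {a - 1, a, 0, M - 1}" using inc[of a] ab by (auto simp: M_def)
      moreover have "a - 1 < M - 1" "a < M - 1" using ab True by (auto simp: M_def)
      ultimately have "D (a - 1) + (D a + (D 0 + D (M - 1))) = 0" using D[of "w a"] ab by simp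
      then show ?thesis using Da1 DM1 True ab by simp
    next
      case False
      then have "{t \<in> {..<M}. w (a + l) \<in> ed t} = {a + l - 1, a + l, M - 1}" using inc[of "a + l"] ab by (auto simp: M_def)
      moreover have "sum D {a + l - 1, a + l, M - 1} = D (a + l - 1) + (D (a + l) + D (M - 1))"
        by (subst sum.insert, simp, use ab in \<open>force simp: M_def\<close>)+ simp
      ultimately have "D (a + l - 1) + (D (a + l) + D (M - 1)) = 0" using D[of "w (a + l)"] by metis
      moreover have "D (a + l - 1) = 2 * (-1) ^ (a + l - 1) * D 0" using path[of "a + l - 1"] False by auto
      moreover have "(-1) ^ (a + l) = (- ((-1) ^ (a + l - 1)) :: int)" using ab by (cases "even l") auto
      ultimately show ?thesis using DM1 by simp
    qed
    note Dal = this
    show ?thesis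
    proof (intro allI impI)
      fix t assume "t < M"
      then consider "t < a" | "a \<le> t" "t < a + l" | "a + l \<le> t" "t < M" by linarith
      then show "D t = D 0 * (-1) ^ t * int (\<mu> t)"
      proof cases
        case 1
        then have "D t = (-1) ^ t * D 0" by (rule c1)
        then show ?thesis using 1 by (simp add: \<mu>_def mult.commute)
      next
        case 2
        then have "D t = 2 * (-1) ^ t * D 0" by (rule path)
        then show ?thesis using 2 by (simp add: \<mu>_def)
      next
        case 3
        then have "D t = (-1) ^ (t - (a + l)) * D (a + l)" using c3[of "t - (a + l)"] by (simp add: M_def)
        also have "\<dots> = (-1) ^ (t - (a + l) + (a + l)) * D 0" unfolding Dal by (simp only: power_add mult.assoc)
        finally show ?thesis using 3 by (simp add: \<mu>_def)
      qed
    qed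
  qed
  have M0: "0 < M" using ab by (simp add: M_def)
  have HE: "ed ` {..<M} \<subseteq> E" using edge by (auto simp: ed_def)
  note pt = principal_toric_ideal[of ed M u v \<mu>, OF inj_ed HE M0 _ _ _ _ _ lexp ker]
  have pos: "0 < \<mu> t" for t by (simp add: \<mu>_def)
  have prems: "Poly_Mapping.keys u \<subseteq> ed ` {..<M}" "Poly_Mapping.keys v \<subseteq> ed ` {..<M}"
    "\<And>t. t < M \<Longrightarrow> Poly_Mapping.lookup u (ed t) = (if even t then \<mu> t else 0)"
    "\<And>t. t < M \<Longrightarrow> Poly_Mapping.lookup v (ed t) = (if odd t then \<mu> t else 0)"
    using K lookup by (simp_all add: u_def v_def)
  show "u \<noteq> v" by (rule pt(1)[OF prems pos])
  show "Poly_Mapping.keys u \<union> Poly_Mapping.keys v = ed ` {..<M}" by (rule pt(2)[OF prems pos])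
  show "toric_ideal (ed ` {..<M}) rho = Idl\<^bsub>poly_ring (ed ` {..<M})\<^esub> {binom u v :: ('v set, 'k) polynomial}"
    by (rule pt(3)[OF prems pos])
  show "(binom u v :: ('v set, 'k) polynomial) \<in> circuits E rho" by (rule pt(4)[OF prems pos])
qed

text \<open>The only possible path edge is in position \<open>a\<close>, which is odd, so the even
  side is squarefree.\<close>

lemma dumbbell_sf_circuit:
  assumes db: "dumbbell w a l b" and "l \<le> 1"
  shows "(binom (alt w True 0 (a + 2 * l + b)) (alt w False 0 (a + 2 * l + b)) :: ('v set, 'k::field) polynomial) \<in> sf_circuits E rho"
proof -
  note dc = dumbbell_circuit[OF db]
  let ?u = "alt w True 0 (a + 2 * l + b)"
  have "squarefree_monomial ?u"
    unfolding squarefree_monomial_def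
  proof
    fix e
    show "Poly_Mapping.lookup ?u e \<le> 1"
    proof (cases "e \<in> (\<lambda>t. {w t, w (Suc t)}) ` {..<a + l + b}")
      case True
      then obtain t where t: "t < a + l + b" "e = {w t, w (Suc t)}" by auto
      have "\<not> (a \<le> t \<and> t < a + l \<and> even t)"
        using db \<open>l \<le> 1\<close> by (auto simp: dumbbell_def le_Suc_eq less_Suc_eq_le)
      then show ?thesis using dc(6)[OF t(1), of True] t by auto
    next
      case False
      then have "Poly_Mapping.lookup ?u e = 0" using dc(7)[of True] by (meson in_keys_iff subsetD)
      then show ?thesis by simp
    qed
  qed
  then show ?thesis using dc(1) dc(5)[where 'k='k] unfolding sf_circuits_def is_difference_def by blast
qed

text \<open>Two consecutive path edges have exponent 2 and lie on different sides.\<close>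

lemma dumbbell_not_sf_circuit:
  assumes db: "dumbbell w a l b" and "2 \<le> l"
  shows "(binom (alt w True 0 (a + 2 * l + b)) (alt w False 0 (a + 2 * l + b)) :: ('v set, 'k::field) polynomial) \<notin> sf_circuits E rho"
proof
  note dc = dumbbell_circuit[OF db]
  let ?u = "alt w True 0 (a + 2 * l + b)" and ?v = "alt w False 0 (a + 2 * l + b)"
  assume "(binom ?u ?v :: ('v set, 'k) polynomial) \<in> sf_circuits E rho"
  then obtain u' v' where "is_difference (binom ?u ?v :: ('v set, 'k) polynomial) u' v'"
    "squarefree_monomial u' \<or> squarefree_monomial v'" by (auto simp: sf_circuits_def)
  then have "squarefree_monomial ?u \<or> squarefree_monomial ?v"
    using is_difference_binom[of ?u ?v u' v', where 'k='k] dc(1) by (auto simp: doubleton_eq_iff)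
  moreover have "odd a" using db by (simp add: dumbbell_def)
  moreover have "Poly_Mapping.lookup ?v {w a, w (Suc a)} = 2" "Poly_Mapping.lookup ?u {w (Suc a), w (Suc (Suc a))} = 2"
    using dc(6)[of a False] dc(6)[of "Suc a" True] \<open>2 \<le> l\<close> \<open>odd a\<close> by auto
  ultimately show False unfolding squarefree_monomial_def by (metis numeral_le_one_iff semiring_norm(69))
qed

end

section \<open>Induced odd cycles joined by a path\<close>

lemma cycle_edges_rotate: "cycle_edges (rotate n c) = cycle_edges c"
proof -
  have sub: "cycle_edges (rotate n c) \<subseteq> cycle_edges c" for n and c :: "'v list"
  proof
    fix e assume "e \<in> cycle_edges (rotate n c)"
    then obtain i where i: "i < length c" "e = {rotate n c ! i, rotate n c ! (Suc i mod length c)}"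
      by (auto simp: cycle_edges_def)
    then have L: "0 < length c" by auto
    define j where "j = (n + i) mod length c"
    have "rotate n c ! (Suc i mod length c) = c ! ((n + Suc i mod length c) mod length c)"
      using L by (intro nth_rotate) simp
    also have "(n + Suc i mod length c) mod length c = Suc j mod length c"
      by (simp add: j_def mod_simps)
    finally have "e = {c ! j, c ! (Suc j mod length c)}"
      using i by (simp add: nth_rotate j_def)
    moreover have "j < length c" using L by (simp add: j_def)
    ultimately show "e \<in> cycle_edges c" by (auto simp: cycle_edges_def)
  qed
  show ?thesis
  proof (cases "c = []")
    case False
    \<comment> \<open>A suitable further rotation restores \<open>c\<close>, so the reverse
      inclusion is another instance of \<open>sub\<close>.\<close>
    then have "((length c - 1) * n + n) mod length c = 0"
      by (cases c) (simp_all add: add.commute[of _ n] flip: mult_Suc)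
    then have "rotate ((length c - 1) * n) (rotate n c) = c"
      by (simp add: rotate_rotate rotate_id)
    then show ?thesis using sub[of n c] sub[of "(length c - 1) * n" "rotate n c"] by simp
  qed simp
qed

text \<open>Signs have to be controlled twice: \<open>indispensable\<close> determines a binomial
  only up to sign, and reading a walk from an odd position exchanges its sides.\<close>

lemma uminus_circuits:
  assumes "f \<in> circuits J a"
  shows "- f \<in> (circuits J a :: ('j, 'k::comm_ring_1) polynomial set)"
proof -
  have neg: "b divides\<^bsub>poly_ring J\<^esub> - g" "- g divides\<^bsub>poly_ring J\<^esub> c"
    if bg: "b divides\<^bsub>poly_ring J\<^esub> g" and gc: "g divides\<^bsub>poly_ring J\<^esub> c" for b c g :: "('j, 'k) polynomial"
  proof -
    obtain x where x: "supp x \<subseteq> J" "g = b * x" using bg by (auto simp: factor_def)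
    obtain y where y: "supp y \<subseteq> J" "c = g * y" using gc by (auto simp: factor_def)
    have "- g = b * (- x)" "c = - g * (- y)" by (simp_all add: x(2) y(2))
    moreover have "supp (- x) \<subseteq> J" "supp (- y) \<subseteq> J" by (simp_all add: supp_uminus x(1) y(1))
    ultimately show "b divides\<^bsub>poly_ring J\<^esub> - g" "- g divides\<^bsub>poly_ring J\<^esub> c"
      unfolding factor_def poly_ring_simps by blast+
  qed
  have refl: "g divides\<^bsub>poly_ring J\<^esub> g" for g :: "('j, 'k) polynomial"
    unfolding factor_def poly_ring_simps by (intro bexI[of _ 1]) (auto simp: supp_one)
  have div: "b divides\<^bsub>poly_ring J\<^esub> - g \<longleftrightarrow> b divides\<^bsub>poly_ring J\<^esub> g" "- g divides\<^bsub>poly_ring J\<^esub> b \<longleftrightarrow> g divides\<^bsub>poly_ring J\<^esub> b"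
    for b g :: "('j, 'k) polynomial"
    using neg refl by (metis minus_minus)+
  have "f \<in> Units (poly_ring J)" if unit: "- f \<in> Units (poly_ring J)"
  proof -
    obtain g where g: "supp f \<subseteq> J" "supp g \<subseteq> J" "g * - f = 1"
      using unit by (auto simp: Units_def supp_uminus)
    then have "- g * f = 1" "f * - g = 1" "supp (- g) \<subseteq> J" by (simp_all add: supp_uminus mult.commute)
    then show ?thesis using g(1) unfolding Units_def poly_ring_simps by blast
  qed
  moreover have "is_binomial (- f)"
    using assms by (auto simp: circuits_def is_binomial_def is_difference_def) (metis minus_diff_eq)
  moreover have "- f \<in> toric_ideal J a"
    using assms by (intro poly_idealD(5)[OF ideal_toric_ideal]) (simp add: circuits_def)
  ultimately show ?thesis
    using assms by (auto simp: circuits_def ring_irreducible_def irreducible_def properfactor_def div supp_uminus)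
qed

lemma uminus_sf_circuits:
  assumes "f \<in> sf_circuits J a"
  shows "- f \<in> (sf_circuits J a :: ('j, 'k::comm_ring_1) polynomial set)"
proof -
  obtain u v where "is_difference f u v" "squarefree_monomial u \<or> squarefree_monomial v"
    using assms by (auto simp: sf_circuits_def)
  then have "is_difference (- f) v u" "squarefree_monomial v \<or> squarefree_monomial u"
    by (auto simp: is_difference_def)
  then show ?thesis using assms uminus_circuits[of f J a] unfolding sf_circuits_def by blast
qed

section \<open>From the induced configuration to a fundamental circuit, and back to
  generation\<close>

context finite_graph
begin

lemma odd_cycle_starting_at:
  assumes "odd_cycle V E c" "x \<in> set c"
  obtains c' where "odd_cycle V E c'" "c' ! 0 = x" "set c' = set c" "cycle_edges c' = cycle_edges c"
proof -
  obtain i where i: "i < length c" "c ! i = x" using assms(2) by (auto simp: in_set_conv_nth)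
  show ?thesis
  proof (rule that[of "rotate i c"])
    show "odd_cycle V E (rotate i c)"
      using assms(1) by (simp add: odd_cycle_def is_cycle_def cycle_edges_rotate)
    show "rotate i c ! 0 = x" using i nth_rotate[of 0 c i] by (cases "c = []") auto
  qed (simp_all add: cycle_edges_rotate)
qed

text \<open>The cycles are rotated to start at the ends of the path; the walk runs around the first,
  along the path, around the second and back. The last conclusion, that its edges are all those
  induced on its vertices, is what makes the circuit fundamental.\<close>

lemma configuration_dumbbell:
  assumes "induced_cycles_joined_by_path V E c\<^sub>1 c\<^sub>2 p"
  obtains w a l b where "dumbbell w a l b" "2 \<le> l"
    "(\<lambda>t. {w t, w (Suc t)}) ` {..<a + l + b} = induced_edges E (\<Union>t<a + l + b. {w t, w (Suc t)})"
proof -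
  have conf: "odd_cycle V E c\<^sub>1" "odd_cycle V E c\<^sub>2" "set c\<^sub>1 \<inter> set c\<^sub>2 = {}" "is_path V E p" "3 \<le> length p"
    "set p \<inter> set c\<^sub>1 = {hd p}" "set p \<inter> set c\<^sub>2 = {last p}"
    "induced_edges E (set c\<^sub>1 \<union> set c\<^sub>2 \<union> set p) = cycle_edges c\<^sub>1 \<union> cycle_edges c\<^sub>2 \<union> path_edges p"
    using assms by (auto simp: induced_cycles_joined_by_path_def)
  have "hd p \<in> set c\<^sub>1" "last p \<in> set c\<^sub>2" using conf(6,7) by auto
  then obtain c d where c: "odd_cycle V E c" "c ! 0 = hd p" "set c = set c\<^sub>1" "cycle_edges c = cycle_edges c\<^sub>1"
    and d: "odd_cycle V E d" "d ! 0 = last p" "set d = set c\<^sub>2" "cycle_edges d = cycle_edges c\<^sub>2"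
    using odd_cycle_starting_at[OF conf(1)] odd_cycle_starting_at[OF conf(2)] by metis
  define a where "a = length c"
  define b where "b = length d"
  define l where "l = length p - 1"
  define M where "M = a + l + b"
  have ab: "odd a" "odd b" "3 \<le> a" "3 \<le> b" and dist: "distinct c" "distinct d" "distinct p"
    using c(1) d(1) conf(4) by (auto simp: odd_cycle_def is_cycle_def is_path_def a_def b_def)
  have l: "2 \<le> l" "length p = Suc l" using conf(5) by (auto simp: l_def)
  have "p \<noteq> []" using conf(5) by auto
  have p0: "p ! 0 = c ! 0" and pl: "p ! l = d ! 0"
    using c(2) d(2) \<open>p \<noteq> []\<close> by (simp_all add: hd_conv_nth last_conv_nth l_def)
  \<comment> \<open>The segments overlap consistently: position \<open>a\<close> closes the first
    cycle and starts the path, \<open>a + l\<close> ends the path and starts the second cycle, and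
    \<open>M\<close> closes that cycle and starts the way back.\<close>
  define w where "w t = (if t < a then c ! t else if t \<le> a + l then p ! (t - a)
    else if t < M then d ! (t - a - l) else p ! (l - (t - M)))" for t
  define ed where "ed t = {w t, w (Suc t)}" for t
  have w1: "w t = c ! t" if "t < a" for t using that by (simp add: w_def)
  have w2: "w (a + t) = p ! t" if "t \<le> l" for t using that by (simp add: w_def)
  have w3: "w (a + l + t) = d ! t" if "t < b" for t
    using that pl by (cases "t = 0") (auto simp: w_def M_def)
  have w4: "w (M + t) = p ! (l - t)" if "t \<le> l" for t using that ab by (auto simp: w_def M_def)
  have e1: "ed t = {c ! t, c ! (Suc t mod a)}" if "t < a" for t
  proof (cases "Suc t < a")
    case False
    then have "Suc t = a" using that by simp
    then show ?thesis using w1[OF that] w2[of 0] p0 by (simp add: ed_def)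
  qed (use w1 in \<open>simp add: ed_def\<close>)
  have e2: "ed (a + t) = {p ! t, p ! Suc t}" if "t < l" for t
    using w2[of t] w2[of "Suc t"] that by (simp add: ed_def)
  have e3: "ed (a + l + t) = {d ! t, d ! (Suc t mod b)}" if "t < b" for t
  proof (cases "Suc t < b")
    case False
    then have "Suc t = b" using that by simp
    then have "ed (a + l + t) = {w (a + l + t), w (M + 0)}"
      unfolding ed_def M_def by (metis add_0_right add_Suc_right)
    then show ?thesis using w3[OF that] w4[of 0] pl \<open>Suc t = b\<close> by simp
  next
    case True
    then show ?thesis using w3[of t] w3[of "Suc t"] by (simp add: ed_def)
  qed
  have split: "{..<M} = {..<a} \<union> ((+) a ` {..<l} \<union> (+) (a + l) ` {..<b})"
  proof (intro equalityI subsetI)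
    fix t assume "t \<in> {..<M}"
    then consider "t < a" | "a \<le> t" "t - a < l" | "a + l \<le> t" "t - (a + l) < b"
      by (cases "t < a"; cases "t < a + l") (auto simp: M_def)
    then show "t \<in> {..<a} \<union> ((+) a ` {..<l} \<union> (+) (a + l) ` {..<b})"
    proof cases
      case 2
      then have "t \<in> (+) a ` {..<l}" by (intro image_eqI[of _ _ "t - a"]) auto
      then show ?thesis by blast
    next
      case 3
      then have "t \<in> (+) (a + l) ` {..<b}" by (intro image_eqI[of _ _ "t - (a + l)"]) auto
      then show ?thesis by blast
    qed simp
  qed (auto simp: M_def)
  have "ed ` {..<a} = cycle_edges c" using e1 by (force simp: cycle_edges_def a_def)
  moreover have "(\<lambda>t. ed (a + t)) ` {..<l} = path_edges p" using e2 l(2) by (force simp: path_edges_def)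
  moreover have "(\<lambda>t. ed (a + l + t)) ` {..<b} = cycle_edges d" using e3 by (force simp: cycle_edges_def b_def)
  ultimately have H: "ed ` {..<M} = cycle_edges c\<^sub>1 \<union> cycle_edges c\<^sub>2 \<union> path_edges p"
    unfolding split image_Un image_image c(4)[symmetric] d(4)[symmetric] by auto
  define W where "W = set c\<^sub>1 \<union> set c\<^sub>2 \<union> set p"
  have HW: "ed ` {..<M} = induced_edges E W" unfolding W_def conf(8) by (rule H)
  have "W = (\<Union>t<M. ed t)"
  proof
    show "(\<Union>t<M. ed t) \<subseteq> W" using HW by (auto simp: induced_edges_def)
    show "W \<subseteq> (\<Union>t<M. ed t)"
    proof
      fix x assume "x \<in> W"
      then consider "x \<in> set c" | "x \<in> set d" | "x \<in> set p" by (auto simp: W_def c(3) d(3))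
      then show "x \<in> (\<Union>t<M. ed t)"
      proof cases
        case 1
        then obtain t where "t < a" "x = w t" using w1 by (auto simp: in_set_conv_nth a_def)
        then show ?thesis by (intro UN_I[of t]) (auto simp: ed_def M_def)
      next
        case 2
        then obtain t where "t < b" "x = w (a + l + t)" using w3 by (auto simp: in_set_conv_nth b_def)
        then show ?thesis by (intro UN_I[of "a + l + t"]) (auto simp: ed_def M_def)
      next
        case 3
        then obtain t where "t \<le> l" "x = w (a + t)" using w2 l(2) by (auto simp: in_set_conv_nth less_Suc_eq_le)
        then show ?thesis using ab by (intro UN_I[of "a + t"]) (auto simp: ed_def M_def)
      qed
    qed
  qed
  then have ind: "ed ` {..<M} = induced_edges E (\<Union>t<M. ed t)" using HW by simp
  have "inj_on w {1..<M}"
  proof (rule linorder_inj_onI')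
    fix s t assume st: "s \<in> {1..<M}" "t \<in> {1..<M}" "s < t"
    have C: "x = c ! 0" if "x \<in> set c" "x \<in> set p" for x using that conf(6) c(2,3) by auto
    have D: "x = d ! 0" if "x \<in> set d" "x \<in> set p" for x using that conf(7) d(2,3) by auto
    have ne: "0 < length c" "0 < length d" using ab by (auto simp: a_def b_def)
    have inC: "w r \<in> set c" "w r \<noteq> c ! 0" if "1 \<le> r" "r < a" for r
      using that w1[of r] nth_eq_iff_index_eq[OF dist(1), of r 0] ne by (simp_all add: a_def)
    have inP: "w r \<in> set p" if "a \<le> r" "r \<le> a + l" for r using that w2[of "r - a"] l(2) by auto
    have inD: "w r \<in> set d" "w r \<noteq> d ! 0" if "a + l < r" "r < M" for r
      using that w3[of "r - (a + l)"] nth_eq_iff_index_eq[OF dist(2), of "r - (a + l)" 0] ne by (simp_all add: b_def M_def)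
    consider "t < a" | "s < a" "a \<le> t" "t \<le> a + l" | "s < a" "a + l < t" | "a \<le> s" "t \<le> a + l"
      | "a \<le> s" "s \<le> a + l" "a + l < t" | "a + l < s" using st by linarith
    then show "w s \<noteq> w t"
    proof cases
      case 1
      then show ?thesis using st w1[of s] w1[of t] dist(1) by (simp add: nth_eq_iff_index_eq a_def)
    next
      case 2
      then show ?thesis using st C[of "w s"] inC[of s] inP[of t] by auto
    next
      case 3
      then show ?thesis using st inC[of s] inD[of t] conf(3) c(3) d(3) by auto
    next
      case 4
      then show ?thesis
        using st w2[of "s - a"] w2[of "t - a"] dist(3) l(2) by (auto simp: nth_eq_iff_index_eq)
    next
      case 5
      then show ?thesis using st D[of "w t"] inD[of t] inP[of s] by auto
    next
      case 6
      then show ?thesis using st w3[of "s - (a + l)"] w3[of "t - (a + l)"] dist(2)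
        by (auto simp: nth_eq_iff_index_eq b_def M_def)
    qed
  qed
  moreover have "{w t, w (Suc t)} \<in> E" if "t < M" for t
    using that HW by (auto simp: ed_def induced_edges_def)
  moreover have "w a = w 0" using w2[of 0] w1[of 0] p0 ab by simp
  moreover have "w (M + t) = w (a + l - t)" if "t \<le> l" for t
    using w4[OF that] w2[of "l - t"] that by simp
  ultimately have "dumbbell w a l b" using ab by (simp add: dumbbell_def M_def)
  then show ?thesis using that[of w a l b] l(1) ind by (simp add: ed_def M_def)
qed

lemma dg_pos_iff:
  assumes "Poly_Mapping.keys m \<subseteq> E"
  shows "0 < dg m x \<longleftrightarrow> (\<exists>e\<in>Poly_Mapping.keys m. x \<in> e)"
proof -
  have "dg m x = 0 \<longleftrightarrow> (\<forall>e\<in>{e \<in> Poly_Mapping.keys m. x \<in> e}. int (Poly_Mapping.lookup m e) = 0)"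
    unfolding dg_altdef[OF assms] by (intro sum_nonneg_eq_0_iff) auto
  then have "dg m x = 0 \<longleftrightarrow> \<not> (\<exists>e\<in>Poly_Mapping.keys m. x \<in> e)" by (auto simp: in_keys_iff)
  then show ?thesis using dg_nonneg[OF assms, of x] by linarith
qed

text \<open>The variables of the image are the vertices covered by \<open>H\<close>, so the selected
  columns are the edges induced on them, and these form \<open>H\<close> again.\<close>

lemma fundamentalI:
  fixes u v :: "'v set monomial"
  assumes "u \<noteq> v" "Poly_Mapping.keys u \<union> Poly_Mapping.keys v = H" "H = induced_edges E (\<Union>H)"
    and ideal: "toric_ideal H rho = Idl\<^bsub>poly_ring H\<^esub> {binom u v :: ('v set, 'k::field) polynomial}"
  shows "fundamental E rho (binom u v :: ('v set, 'k) polynomial)"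
proof -
  let ?f = "binom u v :: ('v set, 'k) polynomial"
  have K: "Poly_Mapping.keys u \<subseteq> E" "Poly_Mapping.keys v \<subseteq> E" using assms(2,3) by (auto simp: induced_edges_def)
  have "torus_vars rho ?f = {x. 0 < dg u x \<or> 0 < dg v x}"
    unfolding torus_vars_def keys_binom[OF assms(1)] by (auto simp: dg_def)
  also have "\<dots> = \<Union>H" unfolding dg_pos_iff[OF K(1)] dg_pos_iff[OF K(2)] using assms(2) by auto
  finally have T: "torus_vars rho ?f = \<Union>H" .
  have "Poly_Mapping.keys (rho e) = e" if "e \<in> E" for e using that by (auto simp: in_keys_iff lookup_rho)
  then have "torus_columns E rho ?f = {e \<in> E. e \<subseteq> \<Union>H}"
    unfolding torus_columns_def T poly_in_laurent_def by (auto simp: lookup_rho)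
  then have "torus_columns E rho ?f = H" using assms(3) by (simp add: induced_edges_def)
  then show ?thesis using ideal assms(1,2) by (simp add: fundamental_def supp_binom)
qed

lemma fundamental_circuit_exists:
  assumes "induced_cycles_joined_by_path V E c\<^sub>1 c\<^sub>2 p"
  obtains f :: "('v set, 'k::field) polynomial"
  where "f \<in> circuits E rho" "f \<notin> sf_circuits E rho" "fundamental E rho f"
proof -
  obtain w a l b where w: "dumbbell w a l b" "2 \<le> l"
    "(\<lambda>t. {w t, w (Suc t)}) ` {..<a + l + b} = induced_edges E (\<Union>t<a + l + b. {w t, w (Suc t)})"
    by (rule configuration_dumbbell[OF assms])
  note dc = dumbbell_circuit[OF w(1)]
  show ?thesis
    by (rule that[OF dc(5) dumbbell_not_sf_circuit[OF w(1,2)] fundamentalI[OF dc(1,2) w(3) dc(4)]])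
qed

lemma not_conn_sf_circuit:
  assumes noconf: "\<not> (\<exists>c c' p. induced_cycles_joined_by_path V E c c' p)"
    and "Poly_Mapping.keys u \<subseteq> E" "Poly_Mapping.keys v \<subseteq> E" "lexp rho u = lexp rho v" "\<not> fibre_conn E rho u v"
  shows "(binom u v :: ('v set, 'k::field) polynomial) \<in> sf_circuits E rho"
proof -
  obtain w k where w: "rigid_walk V E w k" "u = alt w True 0 (2 * k)" "v = alt w False 0 (2 * k)"
    using rigid_walk_exists[OF assms(2-5)] .
  interpret rigid_walk V E w k by (rule w(1))
  from cycle_or_dumbbell[OF noconf] show ?thesis
  proof (elim disjE exE conjE)
    assume inj: "inj_on w {..<2 * k}"
    \<comment> \<open>For \<open>k = 1\<close> the walk goes forth and back along one edge, so its
      two sides agree.\<close>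
    have "k \<noteq> 1"
    proof
      assume "k = 1"
      moreover have "{w 0, w 1} = {w 1, w 2}" using period[of 0] \<open>k = 1\<close> by (auto simp: numeral_2_eq_2)
      ultimately have "u = v"
        using alt_Suc[of 0 1 w] by (auto simp: w(2,3) numeral_2_eq_2)
      then show False using assms(5) by auto
    qed
    then show ?thesis
      unfolding w(2,3) using even_cycle_circuit[OF edge _ inj] period[of 0] k_pos by simp
  next
    fix i a l b
    assume *: "l \<le> 1" "2 * k = a + 2 * l + b" "dumbbell (\<lambda>t. w (i + t)) a l b"
    \<comment> \<open>The dumbbell is read from position \<open>i\<close>; an odd shift exchanges
      the sides, which changes only the sign of the binomial.\<close>
    have alt: "alt (\<lambda>t. w (i + t)) c 0 (a + 2 * l + b) = alt w (c = even i) 0 (2 * k)" for c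
      using alt_shift[of w i c 0 "2 * k"] alt_period[of "c = even i" i] by (simp add: *(2) add.commute)
    have "binom (alt w (even i) 0 (2 * k)) (alt w (odd i) 0 (2 * k)) \<in> (sf_circuits E rho :: ('v set, 'k) polynomial set)"
      using dumbbell_sf_circuit[OF *(3,1), where 'k='k] unfolding alt by simp
    then show ?thesis
      using uminus_sf_circuits[of "binom v u" E rho] by (cases "even i") (auto simp: w(2,3))
  qed
qed

lemma generated_by_sf_circuits:
  assumes "\<not> (\<exists>c c' p. induced_cycles_joined_by_path V E c c' p)"
  shows "toric_ideal E rho = Idl\<^bsub>poly_ring E\<^esub> (sf_circuits E rho :: ('v set, 'k::field) polynomial set)"
proof -
  let ?S = "sf_circuits E rho :: ('v set, 'k) polynomial set"
  have S: "?S \<subseteq> toric_ideal E rho" by (auto simp: sf_circuits_def circuits_def)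
  then have carr: "?S \<subseteq> carrier (poly_ring E)" by (simp add: toric_ideal_def subset_iff)
  have "Idl\<^bsub>poly_ring E\<^esub> ?S \<subseteq> toric_ideal E rho" by (rule Idl_least[OF carr ideal_toric_ideal S])
  moreover have "toric_ideal E rho \<subseteq> Idl\<^bsub>poly_ring E\<^esub> ?S"
    using not_conn_sf_circuit[OF assms] Idl_superset[OF carr]
    by (intro toric_ideal_subsetI[OF Idl_ideal[OF carr]]) blast
  ultimately show ?thesis by blast
qed

text \<open>The sides of such a circuit must be linked, since an unlinked pair would give a member
  of \<open>sf_circuits\<close>.\<close>

lemma circuit_redundant:
  fixes f :: "('v set, 'k::field) polynomial"
  assumes "\<not> (\<exists>c c' p. induced_cycles_joined_by_path V E c c' p)"
    and "f \<in> circuits E rho" "f \<notin> sf_circuits E rho"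
  shows "redundant E rho f"
proof -
  obtain u v where uv: "f = binom u v" "u \<noteq> v"
    using assms(2) by (auto simp: circuits_def is_binomial_def is_difference_def)
  have "binom u v \<in> (toric_ideal E rho :: ('v set, 'k) polynomial set)"
    using assms(2) by (simp add: circuits_def uv(1))
  then have K: "Poly_Mapping.keys u \<subseteq> E" "Poly_Mapping.keys v \<subseteq> E" "lexp rho u = lexp rho v"
    unfolding binom_in_toric_ideal_iff[OF uv(2)] by auto
  have "fibre_conn E rho u v"
    using not_conn_sf_circuit[OF assms(1) K, where 'k='k] assms(3) uv(1) by blast
  then show ?thesis unfolding uv(1) by (rule redundantI[OF _ uv(2) K(3)])
qed

text \<open>Unlinked monomials are sides of rigid walks and so have degree at most
  \<open>card V\<close>, which provides a finite generating set.\<close>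

lemma indispensable_imp_not_redundant:
  fixes f :: "('v set, 'k::field) polynomial"
  assumes "indispensable E rho f"
  shows "\<not> redundant E rho f"
proof -
  obtain F :: "('v set, 'k) polynomial set" where "finite F" "binomial_generators E rho F"
  proof (rule finite_binomial_generators[of "card V"])
    fix u v assume "Poly_Mapping.keys u \<subseteq> E" "Poly_Mapping.keys v \<subseteq> E" "lexp rho u = lexp rho v" "\<not> fibre_conn E rho u v"
    then obtain w k where w: "rigid_walk V E w k" "u = alt w True 0 (2 * k)" by (rule rigid_walk_exists)
    then show "tdeg u \<le> card V" using rigid_walk.length_bound[OF w(1)] by simp
  qed
  then show ?thesis by (rule indispensable_not_redundant[OF assms])
qed

lemma sf_circuit_if_indispensable:
  fixes f :: "('v set, 'k::field) polynomial"
  assumes gen: "toric_ideal E rho = Idl\<^bsub>poly_ring E\<^esub> (sf_circuits E rho :: ('v set, 'k) polynomial set)"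
    and f: "indispensable E rho f"
  shows "f \<in> sf_circuits E rho"
proof -
  have "sf_circuits E rho \<subseteq> carrier (poly_ring E :: ('v set, 'k) polynomial ring)"
    and "\<forall>f\<in>(sf_circuits E rho :: ('v set, 'k) polynomial set). is_binomial f"
    by (auto simp: sf_circuits_def circuits_def toric_ideal_def)
  then have "binomial_generators E rho (sf_circuits E rho :: ('v set, 'k) polynomial set)"
    unfolding binomial_generators_def by (intro conjI gen[symmetric])
  then have "f \<in> sf_circuits E rho \<or> - f \<in> sf_circuits E rho" using f by (auto simp: indispensable_def)
  then show ?thesis using uminus_sf_circuits[of "- f" E rho] by auto
qed

text \<open>An edge between the two cycles belongs to the induced subgraph, hence to the path, and
  would join its two ends; a path with at least three vertices has no such edge.\<close>

lemma odd_cycle_condition_no_configuration: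
  assumes "odd_cycle_condition V E"
  shows "\<not> induced_cycles_joined_by_path V E c\<^sub>1 c\<^sub>2 p"
proof
  assume "induced_cycles_joined_by_path V E c\<^sub>1 c\<^sub>2 p"
  then have conf: "odd_cycle V E c\<^sub>1" "odd_cycle V E c\<^sub>2" "set c\<^sub>1 \<inter> set c\<^sub>2 = {}" "is_path V E p" "3 \<le> length p"
    "set p \<inter> set c\<^sub>1 = {hd p}" "set p \<inter> set c\<^sub>2 = {last p}"
    "induced_edges E (set c\<^sub>1 \<union> set c\<^sub>2 \<union> set p) = cycle_edges c\<^sub>1 \<union> cycle_edges c\<^sub>2 \<union> path_edges p"
    by (auto simp: induced_cycles_joined_by_path_def)
  obtain x y where xy: "x \<in> set c\<^sub>1" "y \<in> set c\<^sub>2" "{x, y} \<in> E"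
    using assms conf(1-3) unfolding odd_cycle_condition_def by blast
  then have "{x, y} \<in> cycle_edges c\<^sub>1 \<union> cycle_edges c\<^sub>2 \<union> path_edges p"
    unfolding conf(8)[symmetric] by (auto simp: induced_edges_def)
  moreover have "{x, y} \<notin> cycle_edges c\<^sub>1" "{x, y} \<notin> cycle_edges c\<^sub>2"
    using cycle_edges_subset[of "{x, y}"] xy conf(3) by blast+
  ultimately have pe: "{x, y} \<in> path_edges p" by blast
  then have "x \<in> set p" "y \<in> set p" using path_edges_subset by blast+
  then have "x = hd p" "y = last p" using xy conf(6,7) by blast+
  moreover have "p \<noteq> []" using conf(5) by auto
  ultimately have "{p ! 0, p ! (length p - 1)} \<in> path_edges p"
    using pe by (simp add: hd_conv_nth last_conv_nth)
  then obtain i where i: "Suc i < length p" "{p ! 0, p ! (length p - 1)} = {p ! i, p ! Suc i}"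
    by (auto simp: path_edges_def)
  have idx: "r = s" if "p ! r = p ! s" "r < length p" "s < length p" for r s
    using that conf(4) by (simp add: is_path_def nth_eq_iff_index_eq)
  have len: "0 < length p" "i < length p" "length p - 1 < length p" using i(1) by auto
  show False
    using doubleton_eq_iff[THEN iffD1, OF i(2)]
  proof (elim disjE conjE)
    assume "p ! 0 = p ! i" "p ! (length p - 1) = p ! Suc i"
    then have "0 = i" "length p - 1 = Suc i" using idx len i(1) by blast+
    then show False using conf(5) by simp
  next
    assume "p ! 0 = p ! Suc i"
    then have "0 = Suc i" using idx len i(1) by blast
    then show False by simp
  qed
qed

end

theorem theorem2p4:
  fixes V :: "'v set" and E :: "'v set set"
    and I :: "('v set, 'k::field) polynomial set"
    and C Csf :: "('v set, 'k) polynomial set"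
  assumes "finite_simple_graph V E" and "connected_graph V E"
    and I: "I = toric_ideal E rho"
    and C: "C = circuits E rho"
    and Csf: "Csf = sf_circuits E rho"
  shows "(I = Idl\<^bsub>poly_ring E\<^esub> Csf \<longleftrightarrow> (\<forall>f\<in>C - Csf. redundant E rho f))
     \<and> (I = Idl\<^bsub>poly_ring E\<^esub> Csf \<longleftrightarrow> (\<forall>f\<in>C - Csf. \<not> indispensable E rho f))
     \<and> (I = Idl\<^bsub>poly_ring E\<^esub> Csf \<longleftrightarrow> (\<forall>f\<in>C - Csf. \<not> fundamental E rho f))
     \<and> (I = Idl\<^bsub>poly_ring E\<^esub> Csf \<longleftrightarrow> \<not> (\<exists>c\<^sub>1 c\<^sub>2 p. induced_cycles_joined_by_path V E c\<^sub>1 c\<^sub>2 p))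
     \<and> (odd_cycle_condition V E \<longrightarrow> \<not> (\<exists>c\<^sub>1 c\<^sub>2 p. induced_cycles_joined_by_path V E c\<^sub>1 c\<^sub>2 p))"
proof -
  interpret finite_graph V E by unfold_locales (rule assms(1))
  let ?conf = "\<exists>c\<^sub>1 c\<^sub>2 p. induced_cycles_joined_by_path V E c\<^sub>1 c\<^sub>2 p"
  have i_iii: "\<forall>f\<in>C - Csf. \<not> indispensable E rho f" if "I = Idl\<^bsub>poly_ring E\<^esub> Csf"
    using that sf_circuit_if_indispensable[where 'k='k] unfolding I C Csf by blast
  have ii_iii: "\<forall>f\<in>C - Csf. \<not> indispensable E rho f" if "\<forall>f\<in>C - Csf. redundant E rho f"
    using that indispensable_imp_not_redundant[where 'k='k] by blast
  have iii_iv: "\<forall>f\<in>C - Csf. \<not> fundamental E rho f" if "\<forall>f\<in>C - Csf. \<not> indispensable E rho f"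
    using that fundamental_circuit_indispensable[where 'k='k] unfolding C by blast
  have iv_v: "\<not> ?conf" if "\<forall>f\<in>C - Csf. \<not> fundamental E rho f"
    using that fundamental_circuit_exists[where 'k='k] unfolding C Csf by (metis DiffI)
  have v_i: "I = Idl\<^bsub>poly_ring E\<^esub> Csf" if "\<not> ?conf"
    unfolding I Csf by (rule generated_by_sf_circuits[OF that])
  have v_ii: "\<forall>f\<in>C - Csf. redundant E rho f" if "\<not> ?conf"
    using circuit_redundant[OF that, where 'k='k] unfolding C Csf by blast
  have "odd_cycle_condition V E \<longrightarrow> \<not> ?conf" using odd_cycle_condition_no_configuration by blast
  then show ?thesis using i_iii ii_iii iii_iv iv_v v_i v_ii by argo
qed

end
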